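(* Let $\mathbf H$ be a smooth periodic Hankel operator and let its non-flat band functions be enumerated as $E_0,E_1,\dots$ so that $|E_0(k)|>|E_1(k)|>\cdots$ for all $k\in(0,\omega/2)$. Then for each $k\in(0,\omega/2)$, $$(-1)^{n+1}\frac{d}{dk}|E_n(k)|>0,\qquad n=0,1,\dots;$$ i.e. $|E_0|,|E_2|,\dots$ attain a maximum at $k=0$ and a minimum at $k=\omega/2$ (on $[0,\omega/2]$), while $|E_1|,|E_3|,\dots$ attain a minimum at $k=0$ and a maximum at $k=\omega/2$.
   Context: Fix $T>0$, $\omega=2\pi/T$. $p$ is a real-valued $T$-periodic function with Fourier coefficients $\widetilde p_\ell=\frac1T\int_0^Te^{-i\ell\omega x}p(x)dx$ satisfying $\sum_\ell|\widetilde p_\ell|(1+\ell^2)^{1/4}<\infty$; $\mathbf H$ is the Hankel operator on $L^2(\mathbb R_+)$ with kernel $h(t)=p(\log t)/t$ (a smooth periodic Hankel operator). For $k\in\mathbb R$, $H(k)$ is the trace class self-adjoint operator on $\ell^2(\mathbb Z)$ with matrix $[H(k)]_{n,m}=B(\frac12-i\omega n-ik,\frac12+i\omega m+ik)\widetilde p_{n-m}$, $B(z_1,z_2)=\Gamma(z_1)\Gamma(z_2)/\Gamma(z_1+z_2)$. Band functions: there is a (unique up to ordering) finite or countable list $\mathcal E$, repetitions allowed, of non-vanishing real analytic real-valued functions on $\mathbb R$ such that for every $k$ the non-zero eigenvalues of $H(k)$, counted with multiplicity, are exactly the values $E(k)$, $E\in\mathcal E$, counted with repetition. Non-flat band functions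 are the non-constant ones; their absolute values are pairwise distinct at each $k\in(0,\omega/2)$, so the stated enumeration is possible. *)

theory Defs
  imports "HOL-Analysis.Analysis"
begin

definition Beta_c :: "complex \<Rightarrow> complex \<Rightarrow> complex" where
  "Beta_c z1 z2 = Gamma z1 * Gamma z2 / Gamma (z1 + z2)"

definition freq :: "real \<Rightarrow> real" where
  "freq T = 2 * pi / T"

definition fourier_coeff :: "real \<Rightarrow> (real \<Rightarrow> real) \<Rightarrow> int \<Rightarrow> complex" where
  "fourier_coeff T p l =
     complex_of_real (1 / T) *
     integral {0..T} (\<lambda>x. exp (- \<i> * of_int l * of_real (freq T) * of_real x) * of_real (p x))"

definition smooth_periodic_symbol :: "real \<Rightarrow> (real \<Rightarrow> real) \<Rightarrow> bool" where
  "smooth_periodic_symbol T p \<longleftrightarrow>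
     T > 0 \<and> (\<forall>x. p (x + T) = p x) \<and> p absolutely_integrable_on {0..T} \<and>
     (\<lambda>l::int. cmod (fourier_coeff T p l) * (1 + (real_of_int l)\<^sup>2) powr (1/4)) summable_on UNIV"

definition Hk :: "real \<Rightarrow> (real \<Rightarrow> real) \<Rightarrow> real \<Rightarrow> int \<Rightarrow> int \<Rightarrow> complex" where
  "Hk T p k n m =
     Beta_c (1/2 - \<i> * of_real (freq T) * of_int n - \<i> * of_real k)
            (1/2 + \<i> * of_real (freq T) * of_int m + \<i> * of_real k) *
     fourier_coeff T p (n - m)"

definition ell2 :: "(int \<Rightarrow> complex) \<Rightarrow> bool" where
  "ell2 x \<longleftrightarrow> (\<lambda>n. (cmod (x n))\<^sup>2) summable_on UNIV"

definition eigenspace_l2 :: "(int \<Rightarrow> int \<Rightarrow> complex) \<Rightarrow> complex \<Rightarrow> (int \<Rightarrow> complex) set" where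
  "eigenspace_l2 M lam =
     {x. ell2 x \<and> (\<forall>n. ((\<lambda>m. M n m * x m) has_sum (lam * x n)) UNIV)}"

definition lin_indep_c :: "(int \<Rightarrow> complex) set \<Rightarrow> bool" where
  "lin_indep_c S \<longleftrightarrow> finite S \<and>
     (\<forall>c. (\<forall>n. (\<Sum>v\<in>S. c v * v n) = 0) \<longrightarrow> (\<forall>v\<in>S. c v = 0))"

text \<open>lam is an eigenvalue of multiplicity exactly d (d = 0: not an eigenvalue):
  the eigenspace has dimension d.\<close>
definition eig_mult :: "(int \<Rightarrow> int \<Rightarrow> complex) \<Rightarrow> complex \<Rightarrow> nat \<Rightarrow> bool" where
  "eig_mult M lam d \<longleftrightarrow>
     (\<exists>S. S \<subseteq> eigenspace_l2 M lam \<and> lin_indep_c S \<and> card S = d) \<and>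
     (\<forall>S. S \<subseteq> eigenspace_l2 M lam \<and> lin_indep_c S \<longrightarrow> card S \<le> d)"

definition real_analytic :: "(real \<Rightarrow> real) \<Rightarrow> bool" where
  "real_analytic f \<longleftrightarrow>
     (\<forall>x. \<exists>r>0. \<exists>a::nat \<Rightarrow> real. \<forall>y. \<bar>y - x\<bar> < r \<longrightarrow> (\<lambda>n. a n * (y - x) ^ n) sums f y)"

text \<open>E (indexed by J) is a list of band functions of H: non-vanishing real analytic
  real functions such that for every k the non-zero eigenvalues of H(k), counted with
  multiplicity, are exactly the values E i k, i in J, counted with repetition.\<close>
definition band_functions ::
  "real \<Rightarrow> (real \<Rightarrow> real) \<Rightarrow> nat set \<Rightarrow> (nat \<Rightarrow> real \<Rightarrow> real) \<Rightarrow> bool" where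
  "band_functions T p J E \<longleftrightarrow>
     (\<forall>i\<in>J. real_analytic (E i) \<and> (\<forall>k. E i k \<noteq> 0)) \<and>
     (\<forall>k. \<forall>lam::complex. lam \<noteq> 0 \<longrightarrow>
        finite {i\<in>J. complex_of_real (E i k) = lam} \<and>
        eig_mult (Hk T p k) lam (card {i\<in>J. complex_of_real (E i k) = lam}))"

definition flat :: "(real \<Rightarrow> real) \<Rightarrow> bool" where
  "flat f \<longleftrightarrow> (\<exists>c. \<forall>k. f k = c)"

end

theory Submission
  imports Defs "HOL-Complex_Analysis.Complex_Analysis" "HOL-Real_Asymp.Real_Asymp"
    "Jordan_Normal_Form.Determinant"
begin

text \<open>
  Write \<open>\<omega> = 2\<pi>/T\<close> and \<open>B(z\<^sub>1, z\<^sub>2) = \<Gamma>(z\<^sub>1) \<Gamma>(z\<^sub>2) / \<Gamma>(z\<^sub>1 + z\<^sub>2)\<close>. Then \<open>H(k) = D Q D*\<close>, where \<open>Q\<close> is a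
  Hermitian Toeplitz matrix and \<open>D\<close> is diagonal with \<open>|D\<^sub>n|\<^sup>2 = \<pi> / cosh \<pi>(\<omega>n + k)\<close>. The hypothesis on
  the symbol says that the matrix entries of \<open>H(k)\<close> are absolutely summable, hence
  \<open>det(1 + z H(k))\<close> is the sum of \<open>z\<^bsup>|S|\<^esup> det(Q\<^sub>S) \<Prod>\<^bsub>n\<in>S\<^esub> \<pi> / cosh \<pi>(\<omega>n + k)\<close> over all finite sets \<open>S\<close> of
  integers. Since \<open>det(Q\<^sub>S)\<close> does not change under translations of \<open>S\<close>, only the sums of the products
  over the translates of a fixed \<open>S\<close> depend on \<open>k\<close>. By partial fractions such a sum is constant for
  even \<open>|S|\<close> and a multiple of \<open>F(k) = \<Sum>\<^sub>n 1 / cosh \<pi>(\<omega>n + k)\<close> for odd \<open>|S|\<close>, so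
  \<open>det(1 \<plusminus> z H(k)) = \<beta>(z) \<plusminus> \<alpha>(z) F(k)\<close> with entire \<open>\<alpha>\<close>, \<open>\<beta>\<close>. The special case \<open>Q = 1\<close>, where the
  determinant is an explicit product, shows that \<open>F' < 0\<close> on \<open>(0, \<omega>/2)\<close>.

  Thus the numbers \<open>1/|E(k)|\<close> are the positive zeros of \<open>G(k, z) = \<beta>(z)\<^sup>2 - \<alpha>(z)\<^sup>2 F(k)\<^sup>2\<close>. After division
  by the common zeros of \<open>\<alpha>\<close> and \<open>\<beta>\<close>, which account for the flat bands and enter with even multiplicity,
  \<open>G\<close> is strictly increasing in \<open>k\<close> at its zeros. So along a non-flat band the sign of the derivative is
  given by the direction in which \<open>G(k, _)\<close> changes sign, and this alternates because \<open>G(k, 0) = 1\<close> and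
  the sign changes exactly at the non-flat bands.
\<close>

section \<open>Determinants of absolutely summable matrices\<close>

text \<open>The determinant is defined by its expansion over finite sets because a summable bound on
  the absolute row sums then controls all minors at once, and zeros of the determinant can be
  compared with eigenvectors through finite truncations. The parity of |S| matters because the
  product of two shifted secants is a multiple of a difference of shifted tanh, and one more secant
  leads back to secants; over the lattice, differences of tanh telescope to constants. The delicate
  point is a common zero of \<open>\<alpha>\<close> and \<open>\<beta>\<close>. There
  \<open>G(k, _)\<close> vanishes for every k, and as far as the determinant shows a non-flat band
  may meet a flat one. Once the common factor is removed, a remaining zero moves strictly with k, to
  a place where \<open>\<alpha>\<close> does not vanish and which therefore belongs to a non-flat
  band. Only finitely many non-flat bands come near a given point, so one of them passes through the
  original zero. This transversality replaces any comparison of multiplicities of eigenvalues with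
  orders of zeros.\<close>

definition principal_minor :: "('i \<Rightarrow> 'i \<Rightarrow> complex) \<Rightarrow> 'i set \<Rightarrow> complex" where
  "principal_minor A S = (\<Sum>\<sigma> | \<sigma> permutes S. of_int (sign \<sigma>) * (\<Prod>i\<in>S. A i (\<sigma> i)))"

text \<open>Von Koch's expansion of det(1 - A). With this sign,
  \<open>fredholm_det (\<lambda>i j. z * A i j)\<close> should vanish at the reciprocals of the
  non-zero eigenvalues.\<close>

definition fredholm_det :: "('i \<Rightarrow> 'i \<Rightarrow> complex) \<Rightarrow> complex" where
  "fredholm_det A = (\<Sum>\<^sub>\<infinity>S\<in>Collect finite. (-1) ^ card S * principal_minor A S)"

text \<open>The product of the row sums, multiplied out, runs over all maps from \<open>S\<close> to
  itself, and the permutations of Leibniz's formula are among them. Thus no factorial enters the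
  bound.\<close>

lemma norm_principal_minor_le:
  assumes "finite S" and r: "\<And>i. i \<in> S \<Longrightarrow> (\<Sum>j\<in>S. norm (A i j)) \<le> r i"
  shows "norm (principal_minor A S) \<le> (\<Prod>i\<in>S. r i)"
proof -
  have fin: "finite {\<sigma>. \<sigma> permutes S}" using assms(1) by (rule finite_permutations)
  \<comment> \<open>Permutations of \<open>S\<close> are the identity outside \<open>S\<close>,
    members of \<open>PiE\<close> are undefined there; restriction passes injectively from one
    convention to the other.\<close>
  let ?e = "\<lambda>\<sigma>. restrict \<sigma> S"
  have inj: "inj_on ?e {\<sigma>. \<sigma> permutes S}"
  proof (rule inj_onI, clarsimp)
    fix x y assume *: "x permutes S" "y permutes S" "restrict x S = restrict y S"
    show "x = y"
    proof
      fix i show "x i = y i"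
        using * by (cases "i \<in> S") (metis restrict_apply', simp add: permutes_not_in)
    qed
  qed
  have "norm (principal_minor A S) \<le> (\<Sum>\<sigma> | \<sigma> permutes S. \<Prod>i\<in>S. norm (A i (\<sigma> i)))"
    unfolding principal_minor_def
    by (rule order_trans[OF norm_sum], rule sum_mono) (auto simp: norm_mult prod_norm sign_def)
  also have "\<dots> = (\<Sum>\<sigma> | \<sigma> permutes S. \<Prod>i\<in>S. norm (A i (?e \<sigma> i)))"
    by (intro sum.cong prod.cong) auto
  also have "\<dots> = (\<Sum>g\<in>?e ` {\<sigma>. \<sigma> permutes S}. \<Prod>i\<in>S. norm (A i (g i)))"
    by (subst sum.reindex[OF inj]) simp
  also have "\<dots> \<le> (\<Sum>g\<in>PiE S (\<lambda>_. S). \<Prod>i\<in>S. norm (A i (g i)))"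
    by (rule sum_mono2) (auto simp: assms(1) finite_PiE permutes_in_image intro!: prod_nonneg)
  also have "\<dots> = (\<Prod>i\<in>S. \<Sum>j\<in>S. norm (A i j))"
    using assms(1) by (subst prod_sum_PiE) auto
  also have "\<dots> \<le> (\<Prod>i\<in>S. r i)"
    by (rule prod_mono) (auto simp: r sum_nonneg)
  finally show ?thesis .
qed

text \<open>A partial sum is at most a finite product of factors \<open>1 + r i\<close>, hence at
  most the exponential of the sum of \<open>r\<close>.\<close>

lemma summable_on_prod_finite_subsets:
  fixes r :: "'i \<Rightarrow> real"
  assumes r0: "\<And>i. r i \<ge> 0" and r: "r summable_on UNIV"
  shows "(\<lambda>S. \<Prod>i\<in>S. r i) summable_on Collect finite"
proof (rule nonneg_bounded_partial_sums_imp_summable_on)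
  show "\<forall>\<^sub>F F in finite_subsets_at_top (Collect finite). (\<Sum>S\<in>F. \<Prod>i\<in>S. r i) \<le> exp (infsum r UNIV)"
  proof (rule eventually_finite_subsets_at_top_weakI)
    fix F :: "'i set set" assume F: "finite F" "F \<subseteq> Collect finite"
    have fin: "finite (\<Union>F)" using F by auto
    have "(\<Sum>S\<in>F. \<Prod>i\<in>S. r i) \<le> (\<Sum>S\<in>Pow (\<Union>F). \<Prod>i\<in>S. r i)"
      by (rule sum_mono2) (auto simp: fin r0 prod_nonneg)
    also have "\<dots> = (\<Prod>i\<in>\<Union>F. r i + 1)"
      by (subst prod_add[OF fin]) simp
    also have "\<dots> \<le> (\<Prod>i\<in>\<Union>F. exp (r i))"
      by (rule prod_mono) (auto simp: r0 add.commute)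
    also have "\<dots> = exp (\<Sum>i\<in>\<Union>F. r i)" by (simp add: exp_sum fin)
    also have "\<dots> \<le> exp (infsum r UNIV)"
      using finite_sum_le_infsum[OF r fin] r0 by simp
    finally show "(\<Sum>S\<in>F. \<Prod>i\<in>S. r i) \<le> exp (infsum r UNIV)" .
  qed
qed (simp add: r0 prod_nonneg)

text \<open>Dominated convergence for unordered sums: by the M-test the finite partial sums converge
  uniformly in \<open>n\<close>, so the two limits may be exchanged.\<close>

lemma tendsto_infsum_dominated:
  fixes f :: "nat \<Rightarrow> 'a \<Rightarrow> 'b :: banach"
  assumes M: "M summable_on X"
    and le: "\<And>n x. x \<in> X \<Longrightarrow> norm (f n x) \<le> M x"
    and lim: "\<And>x. x \<in> X \<Longrightarrow> (\<lambda>n. f n x) \<longlonglongrightarrow> g x"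
  shows "(\<lambda>n. \<Sum>\<^sub>\<infinity>x\<in>X. f n x) \<longlonglongrightarrow> (\<Sum>\<^sub>\<infinity>x\<in>X. g x)"
proof -
  have g: "norm (g x) \<le> M x" if "x \<in> X" for x
    by (rule LIMSEQ_le_const2[OF tendsto_norm[OF lim[OF that]]]) (use le[OF that] in auto)
  have u: "uniform_limit UNIV (\<lambda>F n. \<Sum>x\<in>F. f n x) (\<lambda>n. \<Sum>\<^sub>\<infinity>x\<in>X. f n x) (finite_subsets_at_top X)"
    by (rule Weierstrass_m_test_general[OF _ M]) (use le in auto)
  have gs: "((\<lambda>F. \<Sum>x\<in>F. g x) \<longlongrightarrow> (\<Sum>\<^sub>\<infinity>x\<in>X. g x)) (finite_subsets_at_top X)"
  proof -
    have "g summable_on X"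
      by (rule abs_summable_summable, rule summable_on_comparison_test[OF M]) (auto simp: g)
    then show ?thesis using has_sum_infsum[of g X] unfolding has_sum_def by simp
  qed
  show ?thesis
  proof (rule metric_LIMSEQ_I)
    fix e :: real assume e: "e > 0"
    have "eventually (\<lambda>F. (\<forall>n. dist (\<Sum>x\<in>F. f n x) (\<Sum>\<^sub>\<infinity>x\<in>X. f n x) < e/3) \<and>
        dist (\<Sum>x\<in>F. g x) (\<Sum>\<^sub>\<infinity>x\<in>X. g x) < e/3 \<and> finite F \<and> F \<subseteq> X) (finite_subsets_at_top X)"
    proof (intro eventually_conj)
      show "\<forall>\<^sub>F F in finite_subsets_at_top X. \<forall>n. dist (\<Sum>x\<in>F. f n x) (\<Sum>\<^sub>\<infinity>x\<in>X. f n x) < e/3"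
        using uniform_limitD[OF u, of "e/3"] e by simp
      show "\<forall>\<^sub>F F in finite_subsets_at_top X. dist (\<Sum>x\<in>F. g x) (\<Sum>\<^sub>\<infinity>x\<in>X. g x) < e/3"
        using tendstoD[OF gs, of "e/3"] e by simp
    qed (auto intro!: eventually_finite_subsets_at_top_weakI)
    then obtain F where F: "\<And>n. dist (\<Sum>x\<in>F. f n x) (\<Sum>\<^sub>\<infinity>x\<in>X. f n x) < e/3"
        "dist (\<Sum>x\<in>F. g x) (\<Sum>\<^sub>\<infinity>x\<in>X. g x) < e/3" "finite F" "F \<subseteq> X"
      using eventually_happens finite_subsets_at_top_neq_bot by blast
    have Flim: "(\<lambda>n. \<Sum>x\<in>F. f n x) \<longlonglongrightarrow> (\<Sum>x\<in>F. g x)"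
      using F(4) lim by (intro tendsto_sum) auto
    obtain N where N: "\<And>n. n \<ge> N \<Longrightarrow> dist (\<Sum>x\<in>F. f n x) (\<Sum>x\<in>F. g x) < e/3"
      using metric_LIMSEQ_D[OF Flim, of "e/3"] e by auto
    have "dist (\<Sum>\<^sub>\<infinity>x\<in>X. f n x) (\<Sum>\<^sub>\<infinity>x\<in>X. g x) < e" if "n \<ge> N" for n
      using F(1)[of n] F(2) N[OF that] dist_triangle[of "\<Sum>\<^sub>\<infinity>x\<in>X. f n x" "\<Sum>\<^sub>\<infinity>x\<in>X. g x" "\<Sum>x\<in>F. f n x"]
        dist_triangle[of "\<Sum>x\<in>F. f n x" "\<Sum>\<^sub>\<infinity>x\<in>X. g x" "\<Sum>x\<in>F. g x"]
        dist_commute[of "\<Sum>\<^sub>\<infinity>x\<in>X. f n x" "\<Sum>x\<in>F. f n x"] by linarith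
    then show "\<exists>N. \<forall>n\<ge>N. dist (\<Sum>\<^sub>\<infinity>x\<in>X. f n x) (\<Sum>\<^sub>\<infinity>x\<in>X. g x) < e" by blast
  qed
qed

text \<open>Since \<open>r\<close> does not depend on \<open>n\<close>, the products of
  \<open>r\<close> over \<open>S\<close> dominate the minors of all \<open>B n\<close> at
  once.\<close>

lemma fredholm_det_tendsto:
  fixes r :: "'i \<Rightarrow> real"
  assumes r: "r summable_on UNIV"
    and row: "\<And>n i U. finite U \<Longrightarrow> (\<Sum>j\<in>U. norm (B n i j)) \<le> r i"
    and lim: "\<And>i j. (\<lambda>n. B n i j) \<longlonglongrightarrow> A i j"
  shows "(\<lambda>n. fredholm_det (B n)) \<longlonglongrightarrow> fredholm_det A"
proof -
  have r0: "r i \<ge> 0" for i using row[of "{}" 0 i] by simp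
  show ?thesis
    unfolding fredholm_det_def
  proof (rule tendsto_infsum_dominated[OF summable_on_prod_finite_subsets[OF r0 r]])
    fix n and S :: "'i set" assume "S \<in> Collect finite"
    then show "norm ((-1) ^ card S * principal_minor (B n) S) \<le> prod r S"
      by (simp add: norm_mult norm_power norm_principal_minor_le row)
  next
    fix S :: "'i set" assume "S \<in> Collect finite"
    then show "(\<lambda>n. (-1) ^ card S * principal_minor (B n) S) \<longlonglongrightarrow> (-1) ^ card S * principal_minor A S"
      unfolding principal_minor_def by (intro tendsto_intros lim)
  qed
qed

lemma summable_on_fredholm_det:
  fixes r :: "'i \<Rightarrow> real"
  assumes r: "r summable_on UNIV"
    and row: "\<And>i U. finite U \<Longrightarrow> (\<Sum>j\<in>U. norm (A i j)) \<le> r i"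
  shows "(\<lambda>S. norm (principal_minor A S)) summable_on Collect finite"
proof (rule summable_on_comparison_test)
  show "(\<lambda>S. \<Prod>i\<in>S. r i) summable_on Collect finite"
    by (rule summable_on_prod_finite_subsets[OF _ r]) (use row[of "{}"] in simp)
qed (auto intro!: norm_principal_minor_le row)

text \<open>When the product over the rows is multiplied out, \<open>S\<close> is the set of rows
  that contribute an entry of -A. The Kronecker factors of the other rows vanish unless the
  permutation fixes \<open>U - S\<close> pointwise, that is, permutes \<open>S\<close>.\<close>

lemma principal_minor_one_minus:
  assumes U: "finite U"
  shows "principal_minor (\<lambda>i j. (if i = j then 1 else 0) - A i j) U
       = (\<Sum>S\<in>Pow U. (-1) ^ card S * principal_minor A S)"
proof -
  have fin: "finite {\<sigma>. \<sigma> permutes U}" using U by (rule finite_permutations)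
  have "principal_minor (\<lambda>i j. (if i = j then 1 else 0) - A i j) U
     = (\<Sum>\<sigma> | \<sigma> permutes U. of_int (sign \<sigma>) * (\<Prod>i\<in>U. - A i (\<sigma> i) + (if i = \<sigma> i then 1 else 0)))"
    unfolding principal_minor_def by simp
  also have "\<dots> = (\<Sum>\<sigma> | \<sigma> permutes U. \<Sum>S\<in>Pow U. of_int (sign \<sigma>) *
       ((\<Prod>i\<in>S. - A i (\<sigma> i)) * (\<Prod>i\<in>U - S. if i = \<sigma> i then 1 else 0)))"
    by (subst prod_add[OF U]) (simp add: sum_distrib_left)
  also have "\<dots> = (\<Sum>S\<in>Pow U. \<Sum>\<sigma> | \<sigma> permutes U. of_int (sign \<sigma>) *
       ((\<Prod>i\<in>S. - A i (\<sigma> i)) * (\<Prod>i\<in>U - S. if i = \<sigma> i then 1 else 0)))"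
    by (rule sum.swap)
  also have "\<dots> = (\<Sum>S\<in>Pow U. (-1) ^ card S * principal_minor A S)"
  proof (rule sum.cong[OF refl])
    fix S assume S: "S \<in> Pow U"
    have sub: "{\<sigma>. \<sigma> permutes S} \<subseteq> {\<sigma>. \<sigma> permutes U}"
      using S permutes_subset by blast
    have "(\<Sum>\<sigma> | \<sigma> permutes U. of_int (sign \<sigma>) *
       ((\<Prod>i\<in>S. - A i (\<sigma> i)) * (\<Prod>i\<in>U - S. if i = \<sigma> i then 1 else 0)))
      = (\<Sum>\<sigma> | \<sigma> permutes S. of_int (sign \<sigma>) *
       ((\<Prod>i\<in>S. - A i (\<sigma> i)) * (\<Prod>i\<in>U - S. if i = \<sigma> i then 1 else 0)))"
    proof (rule sum.mono_neutral_right[OF fin sub], rule ballI)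
      fix \<sigma> assume "\<sigma> \<in> {\<sigma>. \<sigma> permutes U} - {\<sigma>. \<sigma> permutes S}"
      then have \<sigma>: "\<sigma> permutes U" "\<not> \<sigma> permutes S" by auto
      have "\<exists>i\<in>U - S. \<sigma> i \<noteq> i"
      proof (rule ccontr)
        assume "\<not> ?thesis"
        then show False using \<sigma> permutes_superset[OF \<sigma>(1), of S] by blast
      qed
      then have "(\<Prod>i\<in>U - S. if i = \<sigma> i then 1 else (0::complex)) = 0"
        using U by (intro prod_zero) (auto, metis Diff_iff)
      then show "of_int (sign \<sigma>) *
       ((\<Prod>i\<in>S. - A i (\<sigma> i)) * (\<Prod>i\<in>U - S. if i = \<sigma> i then 1 else 0)) = 0" by (simp only: mult_zero_right)
    qed
    also have "\<dots> = (\<Sum>\<sigma> | \<sigma> permutes S. (-1) ^ card S * (of_int (sign \<sigma>) * (\<Prod>i\<in>S. A i (\<sigma> i))))"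
    proof (rule sum.cong[OF refl])
      fix \<sigma> assume "\<sigma> \<in> {\<sigma>. \<sigma> permutes S}"
      then have "(\<Prod>i\<in>U - S. if i = \<sigma> i then 1 else (0::complex)) = 1"
        by (intro prod.neutral) (auto simp: permutes_not_in)
      then show "of_int (sign \<sigma>) * ((\<Prod>i\<in>S. - A i (\<sigma> i)) * (\<Prod>i\<in>U - S. if i = \<sigma> i then 1 else 0))
        = (-1) ^ card S * (of_int (sign \<sigma>) * (\<Prod>i\<in>S. A i (\<sigma> i)))"
        by (simp only: prod_uminus mult_1_right) (simp add: mult_ac)
    qed
    also have "\<dots> = (-1) ^ card S * principal_minor A S"
      by (simp add: principal_minor_def sum_distrib_left)
    finally show "(\<Sum>\<sigma> | \<sigma> permutes U. of_int (sign \<sigma>) *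
       ((\<Prod>i\<in>S. - A i (\<sigma> i)) * (\<Prod>i\<in>U - S. if i = \<sigma> i then 1 else 0)))
       = (-1) ^ card S * principal_minor A S" .
  qed
  finally show ?thesis .
qed

lemma principal_minor_zero_row:
  assumes "finite S" "i \<in> S" "\<And>j. A i j = 0"
  shows "principal_minor A S = 0"
  unfolding principal_minor_def using assms by (intro sum.neutral) auto

text \<open>A set that is not contained in \<open>U\<close> has a zero row, so its minor drops out
  and the expansion becomes finite.\<close>

lemma fredholm_det_finite:
  assumes U: "finite U" and supp: "\<And>i j. i \<notin> U \<Longrightarrow> A i j = 0"
  shows "fredholm_det A = principal_minor (\<lambda>i j. (if i = j then 1 else 0) - A i j) U"
proof -
  have "fredholm_det A = (\<Sum>\<^sub>\<infinity>S\<in>Pow U. (-1) ^ card S * principal_minor A S)"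
    unfolding fredholm_det_def
  proof (rule infsum_cong_neutral)
    fix S assume "S \<in> Collect finite - Pow U"
    then obtain i where "finite S" "i \<in> S" "i \<notin> U" by auto
    then show "(-1) ^ card S * principal_minor A S = 0"
      using principal_minor_zero_row[of S i A] supp by simp
  qed (use U finite_subset in auto)
  also have "\<dots> = (\<Sum>S\<in>Pow U. (-1) ^ card S * principal_minor A S)"
    using U by simp
  finally show ?thesis by (simp add: principal_minor_one_minus[OF U])
qed

text \<open>Transport along a bijection preserves signs. It serves to number the rows by 0, ..., n -
  1, and to see that the minors of a Toeplitz matrix are invariant under translation.\<close>

lemma principal_minor_reindex:
  assumes S: "finite S" and inj: "inj_on \<phi> S"
  shows "principal_minor A (\<phi> ` S) = principal_minor (\<lambda>i j. A (\<phi> i) (\<phi> j)) S"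
proof -
  have bij: "bij_betw \<phi> S (\<phi> ` S)" using inj by (simp add: bij_betw_def)
  define \<psi> where "\<psi> = inv_into S \<phi>"
  define h where "h = (\<lambda>\<sigma> x. if x \<in> \<phi> ` S then \<phi> (\<sigma> (\<psi> x)) else x)"
  have bb: "bij_betw h {\<sigma>. \<sigma> permutes S} {\<sigma>. \<sigma> permutes (\<phi> ` S)}"
    unfolding h_def \<psi>_def by (rule bij_betw_permutations[OF bij])
  have sgn: "sign (h \<sigma>) = sign \<sigma>" if "\<sigma> permutes S" for \<sigma>
  proof -
    have "h \<sigma> = map_permutation S \<phi> \<sigma>"
      by (auto simp: h_def \<psi>_def map_permutation_def restrict_id_def fun_eq_iff)
    then show ?thesis using sign_map_permutation[OF inj that S] by simp
  qed
  have "principal_minor A (\<phi> ` S) = (\<Sum>\<sigma> | \<sigma> permutes S. of_int (sign (h \<sigma>)) * (\<Prod>i\<in>\<phi> ` S. A i (h \<sigma> i)))"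
    unfolding principal_minor_def by (rule sum.reindex_bij_betw[OF bb, symmetric])
  also have "\<dots> = (\<Sum>\<sigma> | \<sigma> permutes S. of_int (sign \<sigma>) * (\<Prod>i\<in>S. A (\<phi> i) (\<phi> (\<sigma> i))))"
  proof (rule sum.cong[OF refl])
    fix \<sigma> assume \<sigma>: "\<sigma> \<in> {\<sigma>. \<sigma> permutes S}"
    have "(\<Prod>i\<in>\<phi> ` S. A i (h \<sigma> i)) = (\<Prod>i\<in>S. A (\<phi> i) (h \<sigma> (\<phi> i)))"
      by (rule prod.reindex[OF inj, unfolded o_def])
    also have "\<dots> = (\<Prod>i\<in>S. A (\<phi> i) (\<phi> (\<sigma> i)))"
      by (rule prod.cong) (auto simp: h_def \<psi>_def inv_into_f_f[OF inj])
    finally show "of_int (sign (h \<sigma>)) * (\<Prod>i\<in>\<phi> ` S. A i (h \<sigma> i)) = of_int (sign \<sigma>) * (\<Prod>i\<in>S. A (\<phi> i) (\<phi> (\<sigma> i)))"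
      using sgn \<sigma> by simp
  qed
  finally show ?thesis by (simp add: principal_minor_def)
qed

lemma principal_minor_eq_0_iff:
  assumes U: "finite U"
  shows "principal_minor M U = 0 \<longleftrightarrow>
    (\<exists>x. (\<exists>i\<in>U. x i \<noteq> 0) \<and> (\<forall>i\<in>U. (\<Sum>j\<in>U. M i j * x j) = 0))"
proof -
  obtain \<phi> where \<phi>: "bij_betw \<phi> {0..<card U} U"
    using ex_bij_betw_nat_finite[OF U] by blast
  define n where "n = card U"
  define A where "A = Matrix.mat n n (\<lambda>(i, j). M (\<phi> i) (\<phi> j))"
  have A: "A \<in> carrier_mat n n" by (simp add: A_def)
  have inj: "inj_on \<phi> {0..<n}" and im: "\<phi> ` {0..<n} = U"
    using \<phi> by (auto simp: bij_betw_def n_def)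
  have "Determinant.det A = principal_minor (\<lambda>i j. M (\<phi> i) (\<phi> j)) {0..<n}"
    unfolding det_def'[OF A] principal_minor_def
  proof (rule sum.cong[OF refl], clarify)
    fix p assume p: "p permutes {0..<n}"
    have "(\<Prod>i = 0..<n. A $$ (i, p i)) = (\<Prod>i = 0..<n. M (\<phi> i) (\<phi> (p i)))"
    proof (rule prod.cong[OF refl])
      fix i assume "i \<in> {0..<n}"
      then have "i < n" "p i < n" using permutes_in_image[OF p, of i] by auto
      then show "A $$ (i, p i) = M (\<phi> i) (\<phi> (p i))" by (simp add: A_def)
    qed
    then show "signof p * (\<Prod>i = 0..<n. A $$ (i, p i)) = of_int (sign p) * (\<Prod>i = 0..<n. M (\<phi> i) (\<phi> (p i)))"
      by simp
  qed
  also have "\<dots> = principal_minor M U"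
    using principal_minor_reindex[OF _ inj, of M] im by simp
  finally have det: "principal_minor M U = Determinant.det A" by simp
  have row: "vec_index (A *\<^sub>v v) i = (\<Sum>j\<in>U. M (\<phi> i) j * x j)"
    if v: "v \<in> carrier_vec n" and i: "i < n" and vx: "\<And>j. j < n \<Longrightarrow> vec_index v j = x (\<phi> j)" for v i and x :: "'a \<Rightarrow> complex"
  proof -
    have "vec_index (A *\<^sub>v v) i = (\<Sum>j = 0..<n. M (\<phi> i) (\<phi> j) * x (\<phi> j))"
      using v i vx by (auto simp: A_def scalar_prod_def intro!: sum.cong)
    also have "\<dots> = (\<Sum>j\<in>U. M (\<phi> i) j * x j)"
      using sum.reindex[OF inj, of "\<lambda>j. M (\<phi> i) j * x j"] im by simp
    finally show ?thesis .
  qed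
  show ?thesis
    unfolding det det_0_iff_vec_prod_zero_field[OF A]
  proof
    assume "\<exists>v. v \<in> carrier_vec n \<and> v \<noteq> 0\<^sub>v n \<and> A *\<^sub>v v = 0\<^sub>v n"
    then obtain v where v: "v \<in> carrier_vec n" "v \<noteq> 0\<^sub>v n" "A *\<^sub>v v = 0\<^sub>v n" by blast
    define x where "x = (\<lambda>i. vec_index v (inv_into {0..<n} \<phi> i))"
    have x: "vec_index v j = x (\<phi> j)" if "j < n" for j
      using that inj by (simp add: x_def)
    obtain j where j: "j < n" "vec_index v j \<noteq> 0" using v(1,2) by (metis eq_vecI carrier_vecD index_zero_vec(1,2))
    have "(\<exists>i\<in>U. x i \<noteq> 0)" using j x im by (intro bexI[of _ "\<phi> j"]) auto
    moreover have "\<forall>i\<in>U. (\<Sum>j\<in>U. M i j * x j) = 0"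
    proof
      fix i assume "i \<in> U"
      then obtain i' where i': "i' < n" "i = \<phi> i'" using im by auto
      have "vec_index (A *\<^sub>v v) i' = 0" using v(3) i'(1) by simp
      then show "(\<Sum>j\<in>U. M i j * x j) = 0" using row[OF v(1) i'(1), of x] x i' by simp
    qed
    ultimately show "\<exists>x. (\<exists>i\<in>U. x i \<noteq> 0) \<and> (\<forall>i\<in>U. (\<Sum>j\<in>U. M i j * x j) = 0)" by blast
  next
    assume "\<exists>x. (\<exists>i\<in>U. x i \<noteq> 0) \<and> (\<forall>i\<in>U. (\<Sum>j\<in>U. M i j * x j) = 0)"
    then obtain x i where x: "i \<in> U" "x i \<noteq> 0" "\<And>i. i\<in>U \<Longrightarrow> (\<Sum>j\<in>U. M i j * x j) = 0" by blast
    define v where "v = Matrix.vec n (\<lambda>j. x (\<phi> j))"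
    have v: "v \<in> carrier_vec n" by (simp add: v_def)
    have vx: "vec_index v j = x (\<phi> j)" if "j < n" for j using that by (simp add: v_def)
    obtain i' where i': "i' < n" "i = \<phi> i'" using x(1) im by auto
    have "v \<noteq> 0\<^sub>v n" using vx[OF i'(1)] x(2) i' by auto
    moreover have "A *\<^sub>v v = 0\<^sub>v n"
    proof (rule eq_vecI)
      fix j assume "j < dim_vec (0\<^sub>v n)"
      then have j: "j < n" by simp
      then have "\<phi> j \<in> U" using im by auto
      then show "vec_index (A *\<^sub>v v) j = vec_index (0\<^sub>v n) j" using row[OF v j, of x] vx x(3) j by simp
    qed (simp add: A_def)
    ultimately show "\<exists>v. v \<in> carrier_vec n \<and> v \<noteq> 0\<^sub>v n \<and> A *\<^sub>v v = 0\<^sub>v n" using v by blast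
  qed
qed

lemma fredholm_det_finite_eq_0_iff:
  assumes U: "finite U" and supp: "\<And>i j. i \<notin> U \<Longrightarrow> A i j = 0"
  shows "fredholm_det A = 0 \<longleftrightarrow>
    (\<exists>x. (\<exists>i\<in>U. x i \<noteq> 0) \<and> (\<forall>i\<in>U. (\<Sum>j\<in>U. A i j * x j) = x i))"
proof -
  have "(\<Sum>j\<in>U. ((if i = j then 1 else 0) - A i j) * x j) = x i - (\<Sum>j\<in>U. A i j * x j)" if "i \<in> U" for i x
  proof -
    have "(\<Sum>j\<in>U. ((if i = j then 1 else 0) - A i j) * x j) = (\<Sum>j\<in>U. (if i = j then x j else 0) - A i j * x j)"
      by (intro sum.cong) (auto simp: algebra_simps)
    also have "\<dots> = x i - (\<Sum>j\<in>U. A i j * x j)" using U that by (simp add: sum_subtractf)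
    finally show ?thesis .
  qed
  then have "(\<forall>i\<in>U. (\<Sum>j\<in>U. ((if i = j then 1 else 0) - A i j) * x j) = 0) \<longleftrightarrow>
      (\<forall>i\<in>U. (\<Sum>j\<in>U. A i j * x j) = x i)" for x
    by (metis (no_types, lifting) right_minus_eq)
  moreover have "fredholm_det A = principal_minor (\<lambda>i j. (if i = j then 1 else 0) - A i j) U"
    by (rule fredholm_det_finite[OF U]) (rule supp)
  ultimately show ?thesis
    by (simp only: principal_minor_eq_0_iff[OF U])
qed

section \<open>Dependence of the determinant on the spectral parameter\<close>

lemma fredholm_det_zero [simp]: "fredholm_det (\<lambda>i j. 0) = 1"
  using fredholm_det_finite[of "{}" "\<lambda>i j. 0"] by (simp add: principal_minor_def)

lemma principal_minor_cmult:
  "finite S \<Longrightarrow> principal_minor (\<lambda>i j. z * A i j) S = z ^ card S * principal_minor A S"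
  by (simp add: principal_minor_def prod.distrib sum_distrib_left mult_ac)

text \<open>Grouping finite sets by size makes a power series of the unordered expansion. The field
  is general because complex determinants and real lattice determinants are both treated this
  way.\<close>

lemma sums_by_card:
  fixes f :: "'i set \<Rightarrow> 'b :: {real_normed_field, banach}"
  assumes "(\<lambda>S. norm (f S * z ^ card S)) summable_on Collect finite"
  shows "(\<lambda>n. (\<Sum>\<^sub>\<infinity>S | finite S \<and> card S = n. f S) * z ^ n) sums (\<Sum>\<^sub>\<infinity>S\<in>Collect finite. f S * z ^ card S)"
proof (rule has_sum_imp_sums)
  let ?B = "\<lambda>n. {S::'i set. finite S \<and> card S = n}"
  have sm: "(\<lambda>S. f S * z ^ card S) summable_on Collect finite"
    using assms by (rule abs_summable_summable)
  have bij: "bij_betw snd (Sigma UNIV ?B) (Collect finite)"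
    by (rule bij_betwI[of _ _ _ "\<lambda>S. (card S, S)"]) auto
  have "((\<lambda>S. f S * z ^ card S) has_sum (\<Sum>\<^sub>\<infinity>S\<in>Collect finite. f S * z ^ card S)) (Collect finite)"
    using sm by simp
  then have 1: "((\<lambda>p. f (snd p) * z ^ card (snd p)) has_sum (\<Sum>\<^sub>\<infinity>S\<in>Collect finite. f S * z ^ card S)) (Sigma UNIV ?B)"
    by (subst has_sum_reindex_bij_betw[OF bij])
  show "((\<lambda>n. (\<Sum>\<^sub>\<infinity>S | finite S \<and> card S = n. f S) * z ^ n) has_sum (\<Sum>\<^sub>\<infinity>S\<in>Collect finite. f S * z ^ card S)) UNIV"
  proof (rule has_sum_SigmaD[OF 1])
    fix n :: nat
    have s: "(\<lambda>S. f S * z ^ card S) summable_on ?B n"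
      by (rule summable_on_subset_banach[OF sm]) auto
    have "(\<Sum>\<^sub>\<infinity>S\<in>?B n. f S * z ^ card S) = (\<Sum>\<^sub>\<infinity>S\<in>?B n. f S * z ^ n)"
      by (rule infsum_cong) auto
    also have "\<dots> = (\<Sum>\<^sub>\<infinity>S | finite S \<and> card S = n. f S) * z ^ n"
      by (rule infsum_cmult_left')
    finally have "((\<lambda>S. f S * z ^ card S) has_sum (\<Sum>\<^sub>\<infinity>S | finite S \<and> card S = n. f S) * z ^ n) (?B n)"
      using has_sum_infsum[OF s] by simp
    then show "((\<lambda>y. f (snd (n, y)) * z ^ card (snd (n, y))) has_sum (\<Sum>\<^sub>\<infinity>S | finite S \<and> card S = n. f S) * z ^ n) (?B n)"
      by simp
  qed
qed

context
  fixes A :: "'i \<Rightarrow> 'i \<Rightarrow> complex" and r :: "'i \<Rightarrow> real"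
  assumes r: "r summable_on UNIV"
    and row: "\<And>i U. finite U \<Longrightarrow> (\<Sum>j\<in>U. norm (A i j)) \<le> r i"
begin

lemma summable_on_norm_minor_power:
  "(\<lambda>S. norm (principal_minor A S * z ^ card S)) summable_on Collect finite"
proof -
  have "(\<lambda>S. norm (principal_minor (\<lambda>i j. z * A i j) S)) summable_on Collect finite"
  proof (rule summable_on_fredholm_det)
    show "(\<lambda>i. norm z * r i) summable_on UNIV" using r by (rule summable_on_cmult_right)
    show "(\<Sum>j\<in>U. norm (z * A i j)) \<le> norm z * r i" if "finite U" for i U
      using row[OF that, of i] by (simp add: norm_mult sum_distrib_left[symmetric] mult_left_mono)
  qed
  then show ?thesis
    by (rule iffD1[OF summable_on_cong, rotated]) (simp add: principal_minor_cmult mult.commute)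
qed

lemma fredholm_det_sums:
  "(\<lambda>n. (\<Sum>\<^sub>\<infinity>S | finite S \<and> card S = n. principal_minor A S) * (- z) ^ n)
     sums fredholm_det (\<lambda>i j. z * A i j)"
proof -
  have "fredholm_det (\<lambda>i j. z * A i j) = (\<Sum>\<^sub>\<infinity>S\<in>Collect finite. principal_minor A S * (- z) ^ card S)"
    unfolding fredholm_det_def
    by (rule infsum_cong) (simp add: principal_minor_cmult power_minus[of z] mult_ac)
  then show ?thesis
    using sums_by_card[OF summable_on_norm_minor_power, of "- z"] by simp
qed

lemma fredholm_det_holomorphic: "(\<lambda>z. fredholm_det (\<lambda>i j. z * A i j)) holomorphic_on UNIV"
proof -
  define c where "c = (\<lambda>n. (\<Sum>\<^sub>\<infinity>S | finite S \<and> card S = n. principal_minor A S) * (-1) ^ n)"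
  have c: "(\<lambda>n. c n * (z - 0) ^ n) sums fredholm_det (\<lambda>i j. z * A i j)" for z
    using fredholm_det_sums[of z] by (simp add: c_def power_minus[of z] mult_ac)
  have "(\<lambda>z. fredholm_det (\<lambda>i j. z * A i j)) holomorphic_on ball 0 R" for R
    by (rule power_series_holomorphic[OF c])
  then have "(\<lambda>z. fredholm_det (\<lambda>i j. z * A i j)) holomorphic_on (\<Union>R\<in>UNIV. ball 0 R)"
    by (intro holomorphic_on_UN_open) auto
  moreover have "(\<Union>R\<in>UNIV. ball 0 R) = (UNIV :: complex set)"
    by (auto intro: gt_ex)
  ultimately show ?thesis by simp
qed

end



text \<open>The column \<open>i0\<close> of each truncation is corrected so that the truncated vector becomes an exact
  fixed vector; the corrected truncations still converge to the matrix.\<close>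
lemma fredholm_det_eq_0_if_fixed_vector:
  fixes A :: "int \<Rightarrow> int \<Rightarrow> complex" and r :: "int \<Rightarrow> real"
  assumes r: "r summable_on UNIV"
    and row: "\<And>i U. finite U \<Longrightarrow> (\<Sum>j\<in>U. norm (A i j)) \<le> r i"
    and bd: "\<And>i. norm (x i) \<le> C" and nz: "x i0 \<noteq> 0"
    and fixed: "\<And>i. ((\<lambda>j. A i j * x j) has_sum x i) UNIV"
  shows "fredholm_det A = 0"
proof -
  \<comment> \<open>The windows are widened by |i0| so that each of them contains the column
    \<open>i0\<close> that is to be corrected.\<close>
  define U where "U = (\<lambda>N::nat. {- int N - \<bar>i0\<bar>..int N + \<bar>i0\<bar>})"
  have fin: "finite (U N)" and i0: "i0 \<in> U N" for N by (auto simp: U_def)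
  define \<epsilon> where "\<epsilon> = (\<lambda>N i. x i - (\<Sum>j\<in>U N. A i j * x j))"
  define B where "B = (\<lambda>N i j. if i \<in> U N \<and> j \<in> U N then A i j + (if j = i0 then \<epsilon> N i / x i0 else 0) else 0)"
  have C0: "C \<ge> 0" using bd[of 0] norm_ge_zero order_trans by blast
  have eventually_U: "eventually (\<lambda>N. i \<in> U N) sequentially" for i
    by (rule eventually_sequentiallyI[of "nat \<bar>i\<bar>"]) (auto simp: U_def)
  have filt: "filterlim U (finite_subsets_at_top UNIV) sequentially"
    unfolding filterlim_finite_subsets_at_top
  proof (intro allI impI, safe)
    fix X :: "int set" assume X: "finite X"
    have "eventually (\<lambda>N. \<forall>i\<in>X. i \<in> U N) sequentially"
      using X eventually_U by (simp add: eventually_ball_finite_distrib)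
    then show "\<forall>\<^sub>F N in sequentially. finite (U N) \<and> X \<subseteq> U N \<and> U N \<subseteq> UNIV"
      by eventually_elim (auto simp: fin)
  qed
  have \<epsilon>_lim: "(\<lambda>N. \<epsilon> N i) \<longlonglongrightarrow> 0" for i
  proof -
    have "(\<lambda>N. \<Sum>j\<in>U N. A i j * x j) \<longlonglongrightarrow> x i"
      using fixed[of i] unfolding has_sum_def by (rule filterlim_compose[OF _ filt])
    then show ?thesis unfolding \<epsilon>_def by (auto intro: tendsto_eq_intros)
  qed
  have \<epsilon>_le: "norm (\<epsilon> N i) \<le> 2 * C * r i" for N i
  proof -
    have s: "norm (\<Sum>j\<in>V. A i j * x j) \<le> C * r i" if "finite V" for V
    proof -
      have "norm (\<Sum>j\<in>V. A i j * x j) \<le> (\<Sum>j\<in>V. norm (A i j) * C)"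
        by (rule sum_norm_le) (simp add: norm_mult mult_left_mono bd)
      also have "\<dots> \<le> C * r i"
        using mult_left_mono[OF row[OF that, of i] C0] by (simp add: sum_distrib_left mult.commute)
      finally show ?thesis .
    qed
    \<comment> \<open>\<open>x i\<close> is the limit of sums bounded by \<open>C * r i\<close>. So
      the equation itself improves the bound \<open>C\<close> to a summable one, which the corrected
      matrices need as row bound.\<close>
    have "norm (x i) \<le> C * r i"
      by (rule tendsto_upperbound[OF tendsto_norm[OF fixed[of i, unfolded has_sum_def]]])
         (auto intro!: eventually_finite_subsets_at_top_weakI s)
    then show ?thesis
      using s[OF fin, of N] norm_triangle_ineq4[of "x i" "\<Sum>j\<in>U N. A i j * x j"] unfolding \<epsilon>_def by linarith
  qed
  have "fredholm_det (B N) = 0" for N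
  proof -
    have "(\<Sum>j\<in>U N. B N i j * x j) = x i" if i: "i \<in> U N" for i
    proof -
      have "(\<Sum>j\<in>U N. B N i j * x j) = (\<Sum>j\<in>U N. A i j * x j + (if j = i0 then \<epsilon> N i else 0))"
        using i nz by (intro sum.cong) (auto simp: B_def field_simps)
      also have "\<dots> = x i" using i0 fin by (simp add: sum.distrib \<epsilon>_def)
      finally show ?thesis .
    qed
    then have "\<exists>x. (\<exists>i\<in>U N. x i \<noteq> 0) \<and> (\<forall>i\<in>U N. (\<Sum>j\<in>U N. B N i j * x j) = x i)"
      using i0 nz by blast
    moreover have "B N i j = 0" if "i \<notin> U N" for i j using that by (simp add: B_def)
    ultimately show ?thesis using fredholm_det_finite_eq_0_iff[OF fin, of N "B N"] by blast
  qed
  moreover have "(\<lambda>N. fredholm_det (B N)) \<longlonglongrightarrow> fredholm_det A"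
  proof (rule fredholm_det_tendsto)
    show "(\<lambda>i. (1 + 2 * C / norm (x i0)) * r i) summable_on UNIV"
      using r by (rule summable_on_cmult_right)
    show "(\<Sum>j\<in>V. norm (B N i j)) \<le> (1 + 2 * C / norm (x i0)) * r i" if "finite V" for N i V
    proof -
      have "(\<Sum>j\<in>V. norm (B N i j)) \<le> (\<Sum>j\<in>V. norm (A i j) + (if j = i0 then norm (\<epsilon> N i) / norm (x i0) else 0))"
        by (rule sum_mono) (auto simp: B_def norm_divide intro!: order_trans[OF norm_triangle_ineq])
      also have "\<dots> \<le> r i + norm (\<epsilon> N i) / norm (x i0)"
        using row[OF that, of i] that by (auto simp: sum.distrib intro: add_increasing2)
      also have "\<dots> \<le> r i + 2 * C * r i / norm (x i0)"
        by (intro add_left_mono divide_right_mono \<epsilon>_le) auto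
      finally show ?thesis by (simp add: algebra_simps)
    qed
    show "(\<lambda>N. B N i j) \<longlonglongrightarrow> A i j" for i j
    proof (rule Lim_transform_eventually)
      show "(\<lambda>N. A i j + (if j = i0 then \<epsilon> N i / x i0 else 0)) \<longlonglongrightarrow> A i j"
        using tendsto_divide[OF \<epsilon>_lim[of i] tendsto_const[of "x i0"]] nz
        by (cases "j = i0") (auto intro!: tendsto_eq_intros)
      show "\<forall>\<^sub>F N in sequentially. A i j + (if j = i0 then \<epsilon> N i / x i0 else 0) = B N i j"
        using eventually_U[of i] eventually_U[of j] by eventually_elim (simp add: B_def)
    qed
  qed
  ultimately show ?thesis by (simp add: LIMSEQ_const_iff)
qed

section \<open>From a zero of the determinant to a fixed vector\<close>

lemma finite_ge_summable_on:
  fixes r :: "'i \<Rightarrow> real"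
  assumes r: "r summable_on UNIV" and r0: "\<And>i. r i \<ge> 0" and c: "c > 0"
  shows "finite {i. r i \<ge> c}"
proof (rule ccontr)
  assume "\<not> ?thesis"
  moreover obtain n :: nat where n: "infsum r UNIV < n * c"
    using c reals_Archimedean3 by blast
  ultimately obtain F where F: "F \<subseteq> {i. r i \<ge> c}" "finite F" "card F = n"
    using infinite_arbitrarily_large by blast
  have "n * c \<le> (\<Sum>i\<in>F. r i)"
    using F sum_bounded_below[of F c r] by auto
  also have "\<dots> \<le> infsum r UNIV" using finite_sum_le_infsum[OF r F(2)] r0 by simp
  finally show False using n by simp
qed

text \<open>Hurwitz's theorem provides zeros of the truncated determinants that tend to 1, hence
  fixed vectors of scaled truncations. Normalised in the supremum norm, these lie in a compact
  product of discs of radii \<open>2 * r i\<close>; a coordinatewise limit solves the equation, and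
  it is non-zero because the maxima are all attained in one finite set.\<close>

lemma fixed_vector_if_fredholm_det_eq_0:
  fixes A :: "int \<Rightarrow> int \<Rightarrow> complex" and r :: "int \<Rightarrow> real"
  assumes r: "r summable_on UNIV"
    and row: "\<And>i U. finite U \<Longrightarrow> (\<Sum>j\<in>U. norm (A i j)) \<le> r i"
    and det0: "fredholm_det A = 0"
  obtains x i0 C where "x i0 \<noteq> 0" "\<And>i. norm (x i) \<le> C * r i"
    "\<And>i. ((\<lambda>j. A i j * x j) has_sum x i) UNIV"
proof -
  have r0: "r i \<ge> 0" for i using row[of "{}" i] by simp
  define U where "U = (\<lambda>N::nat. {- int N..int N})"
  have fin: "finite (U N)" for N by (auto simp: U_def)
  have eventually_U: "eventually (\<lambda>N. i \<in> U N) sequentially" for i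
    by (rule eventually_sequentiallyI[of "nat \<bar>i\<bar>"]) (auto simp: U_def)
  define A' where "A' = (\<lambda>N i j. if i \<in> U N \<and> j \<in> U N then A i j else 0)"
  have row': "(\<Sum>j\<in>V. norm (A' N i j)) \<le> r i" if "finite V" for N i V
    by (rule order_trans[OF sum_mono row[OF that]]) (simp add: A'_def)
  have A'_lim: "(\<lambda>N. A' N i j) \<longlonglongrightarrow> A i j" for i j
  proof (rule tendsto_eventually)
    show "\<forall>\<^sub>F N in sequentially. A' N i j = A i j"
      using eventually_U[of i] eventually_U[of j] by eventually_elim (simp add: A'_def)
  qed
  define g where "g = (\<lambda>z. fredholm_det (\<lambda>i j. z * A i j))"
  define G where "G = (\<lambda>N z. fredholm_det (\<lambda>i j. z * A' N i j))"
  have g_holo: "g holomorphic_on UNIV"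
    unfolding g_def by (rule fredholm_det_holomorphic[OF r row])
  have G_holo: "G N holomorphic_on UNIV" for N
    unfolding G_def by (rule fredholm_det_holomorphic[OF r row'])
  have unif: "uniform_limit K G g sequentially" if K: "compact K" for K
  proof -
    obtain R where R: "\<And>z. z \<in> K \<Longrightarrow> norm z \<le> R" using K compact_imp_bounded bounded_iff by metis
    define R' where "R' = max R 0"
    have R': "\<And>z. z \<in> K \<Longrightarrow> norm z \<le> R'" "R' \<ge> 0" using R by (auto simp: R'_def max.coboundedI1)
    \<comment> \<open>A majorant, uniform over \<open>z\<close> in the disc of radius
      \<open>R'\<close>, of the terms by which \<open>G N z\<close> and \<open>g z\<close>
      differ.\<close>
    define D where "D = (\<lambda>N S. norm (principal_minor (A' N) S - principal_minor A S) * R' ^ card S)"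
    have min_le: "norm (principal_minor M S) * R' ^ card S \<le> (\<Prod>i\<in>S. R' * r i)"
      if "finite S" and M: "\<And>i U. finite U \<Longrightarrow> (\<Sum>j\<in>U. norm (M i j)) \<le> r i" for M S
    proof -
      have "norm (principal_minor M S) \<le> (\<Prod>i\<in>S. r i)"
        by (rule norm_principal_minor_le[OF that(1)]) (rule M[OF that(1)])
      then have "R' ^ card S * norm (principal_minor M S) \<le> R' ^ card S * (\<Prod>i\<in>S. r i)"
        using R'(2) by (intro mult_left_mono) auto
      then show ?thesis by (simp add: prod.distrib mult.commute)
    qed
    have D_le: "norm (D N S) \<le> 2 * (\<Prod>i\<in>S. R' * r i)" if S: "finite S" for N S
    proof -
      have "D N S \<le> (norm (principal_minor (A' N) S) + norm (principal_minor A S)) * R' ^ card S"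
        unfolding D_def by (intro mult_right_mono norm_triangle_ineq4) (simp add: R')
      also have "\<dots> \<le> 2 * (\<Prod>i\<in>S. R' * r i)"
        using min_le[OF S, of "A' N"] min_le[OF S, of A] row row' by (simp add: algebra_simps)
      finally show ?thesis by (simp add: D_def R')
    qed
    have sumM: "(\<lambda>S. 2 * (\<Prod>i\<in>S. R' * r i)) summable_on Collect finite"
      by (intro summable_on_cmult_right summable_on_prod_finite_subsets r) (simp add: R' r0)
    have D_summable: "(D N) summable_on Collect finite" for N
      by (rule abs_summable_summable, rule summable_on_comparison_test[OF sumM]) (use D_le in auto)
    have "(\<lambda>N. \<Sum>\<^sub>\<infinity>S\<in>Collect finite. D N S) \<longlonglongrightarrow> (\<Sum>\<^sub>\<infinity>S::int set\<in>Collect finite. 0)"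
    proof (rule tendsto_infsum_dominated[OF sumM])
      fix S :: "int set" assume "S \<in> Collect finite"
      have "(\<lambda>N. principal_minor (A' N) S) \<longlonglongrightarrow> principal_minor A S"
        unfolding principal_minor_def by (intro tendsto_intros A'_lim)
      then show "(\<lambda>N. D N S) \<longlonglongrightarrow> 0"
        unfolding D_def by (auto intro!: tendsto_mult_left_zero tendsto_norm_zero LIM_zero)
    qed (use D_le in auto)
    then have lim: "(\<lambda>N. \<Sum>\<^sub>\<infinity>S\<in>Collect finite. D N S) \<longlonglongrightarrow> 0" by simp
    have le: "dist (G N z) (g z) \<le> (\<Sum>\<^sub>\<infinity>S\<in>Collect finite. D N S)" if z: "z \<in> K" for N z
    proof -
      define f where "f = (\<lambda>S. (-1) ^ card S * principal_minor (\<lambda>i j. z * A' N i j) S - (-1) ^ card S * principal_minor (\<lambda>i j. z * A i j) S)"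
      have s: "(\<lambda>S. (-1) ^ card S * principal_minor (\<lambda>i j. z * M i j) S) summable_on Collect finite"
        if M: "\<And>i U. finite U \<Longrightarrow> (\<Sum>j\<in>U. norm (M i j)) \<le> r i" for M
        by (rule abs_summable_summable, rule iffD1[OF summable_on_cong, OF _ summable_on_norm_minor_power[OF r M, of z]])
           (simp_all add: norm_mult norm_power principal_minor_cmult mult.commute)
      have fs: "(f has_sum (G N z - g z)) (Collect finite)"
        unfolding f_def G_def g_def fredholm_det_def diff_conv_add_uminus
        by (intro has_sum_add has_sum_uminusI has_sum_infsum s row row')
      have fle: "norm (f S) \<le> D N S" if "S \<in> Collect finite" for S
      proof -
        have "f S = (-1) ^ card S * z ^ card S * (principal_minor (A' N) S - principal_minor A S)"
          using that by (simp add: f_def principal_minor_cmult algebra_simps)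
        then have "norm (f S) = norm z ^ card S * norm (principal_minor (A' N) S - principal_minor A S)"
          by (simp add: norm_mult norm_power)
        also have "\<dots> \<le> D N S"
          unfolding D_def by (subst mult.commute, intro mult_left_mono power_mono R'(1) z) auto
        finally show ?thesis .
      qed
      have "norm (G N z - g z) \<le> (\<Sum>\<^sub>\<infinity>S\<in>Collect finite. D N S)"
        by (rule norm_infsum_le[OF fs has_sum_infsum[OF D_summable] fle])
      then show ?thesis by (simp add: dist_norm)
    qed
    show ?thesis
    proof (rule uniform_limitI)
      fix e :: real assume "e > 0"
      then have "\<forall>\<^sub>F N in sequentially. (\<Sum>\<^sub>\<infinity>S\<in>Collect finite. D N S) < e"
        using lim order_tendstoD(2) by blast
      then show "\<forall>\<^sub>F N in sequentially. \<forall>z\<in>K. dist (G N z) (g z) < e"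
        by eventually_elim (use le in \<open>auto intro: le_less_trans\<close>)
    qed
  qed
  have g1: "g 1 = 0" and g0: "g 0 = 1" using det0 by (simp_all add: g_def)
  \<comment> \<open>Otherwise the shifted sequence \<open>G (N + n)\<close> has no zero in a disc
    about 1, and Hurwitz's theorem forbids the zero of its non-constant limit at 1.\<close>
  have "\<exists>N z. N \<ge> n \<and> dist 1 z < 1 / (real n + 1) \<and> G N z = 0" for n :: nat
  proof (rule ccontr)
    assume no: "\<not> ?thesis"
    let ?S = "ball (1::complex) (1 / (real n + 1))"
    have "g 1 \<noteq> 0"
    proof (rule Hurwitz_no_zeros[of ?S "\<lambda>N. G (N + n)" g])
      show "G (N + n) holomorphic_on ?S" for N using G_holo holomorphic_on_subset by blast
      show "g holomorphic_on ?S" using g_holo holomorphic_on_subset by blast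
      show "uniform_limit K (\<lambda>N. G (N + n)) g sequentially" if "compact K" for K
        using unif[OF that] unfolding uniform_limit_iff eventually_sequentially by (meson trans_le_add1)
      show "\<not> g constant_on ?S"
      proof
        assume "g constant_on ?S"
        then have "g z = 0" if "z \<in> ?S" for z
          using g1 that centre_in_ball[of "1::complex" "1 / (real n + 1)"] unfolding constant_on_def by fastforce
        then have "g 0 = 0"
          by (intro analytic_continuation_open[of ?S UNIV g "\<lambda>_. 0" 0])
             (auto simp: g_holo)
        then show False using g0 by simp
      qed
      show "G (N + n) z \<noteq> 0" if "z \<in> ?S" for N z
        using no that by (metis le_add2 mem_ball)
    qed auto
    then show False using g1 by simp
  qed
  then obtain N z where N: "\<And>n. N n \<ge> n" and z: "\<And>n. dist 1 (z n) < 1 / (real n + 1)"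
    and Gz: "\<And>n. G (N n) (z n) = 0" by metis
  have z_lim: "z \<longlonglongrightarrow> 1"
  proof (rule metric_LIMSEQ_I)
    fix e :: real assume "e > 0"
    then obtain n0 where n0: "inverse (real (Suc n0)) < e" using reals_Archimedean by blast
    have "dist (z n) 1 < e" if "n \<ge> n0" for n
    proof -
      have "dist (z n) 1 < 1 / (real n + 1)" using z[of n] by (simp add: dist_commute)
      also have "\<dots> \<le> inverse (real (Suc n0))" using that by (simp add: field_simps)
      finally show ?thesis using n0 by simp
    qed
    then show "\<exists>no. \<forall>n\<ge>no. dist (z n) 1 < e" by blast
  qed
  have z_le: "norm (z n) \<le> 2" for n
  proof -
    have "dist 1 (z n) < 1" using z[of n] by (rule less_le_trans) (simp add: field_simps)
    then show ?thesis using norm_triangle_ineq2[of "z n" 1] by (simp add: dist_norm norm_minus_commute)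
  qed
  have "\<exists>y. (\<exists>i. norm (y i) = 1) \<and> (\<forall>j. norm (y j) \<le> 1) \<and>
     (\<forall>i. y i = z n * (\<Sum>j\<in>U (N n). A' (N n) i j * y j))" for n
  proof -
    have "\<exists>x. (\<exists>i\<in>U (N n). x i \<noteq> 0) \<and> (\<forall>i\<in>U (N n). (\<Sum>j\<in>U (N n). (z n * A' (N n) i j) * x j) = x i)"
      using Gz[of n] unfolding G_def
      by (subst (asm) fredholm_det_finite_eq_0_iff[OF fin, of "N n"]) (auto simp: A'_def)
    then obtain x where x: "\<exists>i\<in>U (N n). x i \<noteq> 0" "\<And>i. i \<in> U (N n) \<Longrightarrow> (\<Sum>j\<in>U (N n). (z n * A' (N n) i j) * x j) = x i"
      by blast
    define m where "m = Max ((\<lambda>i. norm (x i)) ` U (N n))"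
    have m: "norm (x i) \<le> m" if "i \<in> U (N n)" for i
      unfolding m_def using that fin by (intro Max_ge) auto
    have "m \<in> (\<lambda>i. norm (x i)) ` U (N n)"
      unfolding m_def using fin x(1) by (intro Max_in) auto
    then obtain i where i: "i \<in> U (N n)" "m = norm (x i)" by blast
    have mpos: "m > 0" using x(1) m by (metis less_le_trans zero_less_norm_iff)
    define y where "y = (\<lambda>i. if i \<in> U (N n) then x i / of_real m else 0)"
    have "norm (y i) = 1" using i mpos by (simp add: y_def norm_divide)
    moreover have "\<forall>j. norm (y j) \<le> 1" using m mpos by (simp add: y_def norm_divide)
    moreover have "y i = z n * (\<Sum>j\<in>U (N n). A' (N n) i j * y j)" for i
    proof (cases "i \<in> U (N n)")
      case True
      have "z n * (\<Sum>j\<in>U (N n). A' (N n) i j * y j) = (\<Sum>j\<in>U (N n). (z n * A' (N n) i j) * x j) / of_real m"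
        by (simp add: y_def sum_distrib_left sum_divide_distrib mult_ac)
      then show ?thesis using x(2)[OF True] True by (simp add: y_def)
    next
      case False
      then show ?thesis by (simp add: y_def A'_def)
    qed
    ultimately show ?thesis by blast
  qed
  then obtain y where y1: "\<And>n. \<exists>i. norm (y n i) = 1" and y_le1: "\<And>n j. norm (y n j) \<le> 1"
    and y: "\<And>n i. y n i = z n * (\<Sum>j\<in>U (N n). A' (N n) i j * y n j)" by metis
  \<comment> \<open>One application of the truncated matrix turns the bound 1 into a summable bound;
    the 2 is the bound on \<open>z n\<close>.\<close>
  have y_le: "norm (y n i) \<le> 2 * r i" for n i
  proof -
    have "norm (\<Sum>j\<in>U (N n). A' (N n) i j * y n j) \<le> (\<Sum>j\<in>U (N n). norm (A' (N n) i j))"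
      by (rule sum_norm_le) (simp add: norm_mult mult_left_le y_le1)
    also have "\<dots> \<le> r i" by (rule row'[OF fin])
    finally show ?thesis using z_le[of n] by (subst y) (auto simp: norm_mult intro!: mult_mono)
  qed
  \<comment> \<open>A coordinate of modulus 1 forces \<open>1 \<le> 2 * r i\<close>, so for every
    \<open>n\<close> the maximum is attained in this finite set.\<close>
  define P where "P = {i. r i \<ge> 1/2}"
  have P: "finite P" unfolding P_def by (rule finite_ge_summable_on[OF r r0]) simp
  have yP: "(\<Sum>i\<in>P. norm (y n i)) \<ge> 1" for n
  proof -
    obtain i where i: "norm (y n i) = 1" using y1 by blast
    then have "i \<in> P" using y_le[of n i] by (simp add: P_def)
    then show ?thesis using member_le_sum[of i P "\<lambda>i. norm (y n i)"] P i by simp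
  qed
  \<comment> \<open>Tychonoff's theorem; convergence in the product topology is convergence of each
    coordinate.\<close>
  have "compact (PiE UNIV (\<lambda>i. cball (0::complex) (2 * r i)))"
    using compactin_PiE[of "\<lambda>_. euclidean" UNIV "\<lambda>i. cball (0::complex) (2 * r i)"]
    by (simp add: euclidean_product_topology)
  then have "seq_compact (PiE UNIV (\<lambda>i. cball (0::complex) (2 * r i)))"
    by (rule compact_imp_seq_compact)
  moreover have "\<forall>n. y n \<in> PiE UNIV (\<lambda>i. cball 0 (2 * r i))"
    using y_le by auto
  ultimately obtain l s where s: "strict_mono s" "(y \<circ> s) \<longlonglongrightarrow> l"
    unfolding seq_compact_def by metis
  have l: "(\<lambda>n. y (s n) i) \<longlonglongrightarrow> l i" for i
    using continuous_on_tendsto_compose[OF continuous_on_product_coordinates[of i] s(2)] by (simp add: comp_def)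
  have l_le: "norm (l i) \<le> 2 * r i" for i
    by (rule LIMSEQ_le_const2[OF tendsto_norm[OF l]]) (use y_le in auto)
  have "(\<lambda>n. \<Sum>i\<in>P. norm (y (s n) i)) \<longlonglongrightarrow> (\<Sum>i\<in>P. norm (l i))"
    by (intro tendsto_intros l)
  then have "1 \<le> (\<Sum>i\<in>P. norm (l i))"
    by (rule LIMSEQ_le_const) (use yP in auto)
  then have "(\<Sum>i\<in>P. norm (l i)) \<noteq> 0" by linarith
  then obtain i0 where i0: "l i0 \<noteq> 0" by (metis norm_zero sum.neutral)
  have "((\<lambda>j. A i j * l j) has_sum l i) UNIV" for i
  proof -
    have As: "(\<lambda>j. norm (A i j)) summable_on UNIV"
      by (rule nonneg_bounded_partial_sums_imp_summable_on[where C = "r i"])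
         (auto intro!: eventually_finite_subsets_at_top_weakI row)
    have l1: "norm (l j) \<le> 1" for j
      by (rule LIMSEQ_le_const2[OF tendsto_norm[OF l]]) (use y_le1 in auto)
    have "(\<lambda>j. norm (A i j * l j)) summable_on UNIV"
      by (rule summable_on_comparison_test[OF As]) (auto simp: norm_mult l1 mult_left_le)
    then have Al: "(\<lambda>j. A i j * l j) summable_on UNIV" by (rule abs_summable_summable)
    have Ns: "filterlim (\<lambda>n. N (s n)) sequentially sequentially"
    proof (rule filterlim_at_top_mono)
      show "filterlim (\<lambda>n. n) sequentially sequentially" by (rule filterlim_ident)
      show "\<forall>\<^sub>F n in sequentially. n \<le> N (s n)"
        using order_trans[OF seq_suble[OF s(1)] N] by simp
    qed
    have lim: "(\<lambda>n. \<Sum>\<^sub>\<infinity>j\<in>UNIV. A' (N (s n)) i j * y (s n) j) \<longlonglongrightarrow> (\<Sum>\<^sub>\<infinity>j\<in>UNIV. A i j * l j)"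
    proof (rule tendsto_infsum_dominated[OF As])
      show "norm (A' (N (s n)) i j * y (s n) j) \<le> norm (A i j)" for n j
        by (auto simp: norm_mult A'_def y_le1 mult_left_le)
      show "(\<lambda>n. A' (N (s n)) i j * y (s n) j) \<longlonglongrightarrow> A i j * l j" for j
        by (intro tendsto_mult l filterlim_compose[OF A'_lim Ns])
    qed
    have "(\<Sum>\<^sub>\<infinity>j\<in>UNIV. A' (N n) i j * y n j) = (\<Sum>j\<in>U (N n). A' (N n) i j * y n j)" for n
    proof -
      have "(\<Sum>\<^sub>\<infinity>j\<in>UNIV. A' (N n) i j * y n j) = (\<Sum>\<^sub>\<infinity>j\<in>U (N n). A' (N n) i j * y n j)"
        by (rule infsum_cong_neutral) (auto simp: A'_def)
      then show ?thesis using fin by simp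
    qed
    then have "(\<lambda>n. z (s n) * (\<Sum>\<^sub>\<infinity>j\<in>UNIV. A' (N (s n)) i j * y (s n) j)) = (\<lambda>n. y (s n) i)"
      by (simp only: y[symmetric])
    moreover have "(\<lambda>n. z (s n) * (\<Sum>\<^sub>\<infinity>j\<in>UNIV. A' (N (s n)) i j * y (s n) j)) \<longlonglongrightarrow> 1 * (\<Sum>\<^sub>\<infinity>j\<in>UNIV. A i j * l j)"
      using LIMSEQ_subseq_LIMSEQ[OF z_lim s(1)] by (intro tendsto_mult lim) (simp add: o_def)
    ultimately have "(\<lambda>n. y (s n) i) \<longlonglongrightarrow> (\<Sum>\<^sub>\<infinity>j\<in>UNIV. A i j * l j)" by simp
    then have "l i = (\<Sum>\<^sub>\<infinity>j\<in>UNIV. A i j * l j)" using l LIMSEQ_unique by blast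
    then show ?thesis using has_sum_infsum[OF Al] by simp
  qed
  then show ?thesis using that[of l i0 2] i0 l_le by blast
qed

section \<open>Lattice sums of hyperbolic secants\<close>

lemma tanh_diff_eq: "tanh u - tanh v = sinh (u - v) / (cosh u * cosh (v::real))"
  by (simp add: tanh_def sinh_diff field_simps)

text \<open>A linear span, given inductively so that coefficients need not be named.
  \<open>H\<close> records the shifts, since partial fractions require a new shift to differ from
  all the old ones.\<close>

inductive sech_comb :: "real set \<Rightarrow> (real \<Rightarrow> real) \<Rightarrow> bool" for H where
  zero: "sech_comb H (\<lambda>x. 0)"
| base: "a \<in> H \<Longrightarrow> sech_comb H (\<lambda>x. 1 / cosh (x + a))"
| add: "sech_comb H f \<Longrightarrow> sech_comb H g \<Longrightarrow> sech_comb H (\<lambda>x. f x + g x)"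
| scale: "sech_comb H f \<Longrightarrow> sech_comb H (\<lambda>x. c * f x)"

text \<open>The generators are differences because a single tanh does not decay and has no lattice
  sum.\<close>

inductive tanh_comb :: "real set \<Rightarrow> (real \<Rightarrow> real) \<Rightarrow> bool" for H where
  zero: "tanh_comb H (\<lambda>x. 0)"
| base: "a \<in> H \<Longrightarrow> b \<in> H \<Longrightarrow> tanh_comb H (\<lambda>x. tanh (x + a) - tanh (x + b))"
| add: "tanh_comb H f \<Longrightarrow> tanh_comb H g \<Longrightarrow> tanh_comb H (\<lambda>x. f x + g x)"
| scale: "tanh_comb H f \<Longrightarrow> tanh_comb H (\<lambda>x. c * f x)"

text \<open>The addition theorem for tanh read backwards; the division by
  \<open>sinh (a - w)\<close> is why \<open>w\<close> must be a new shift.\<close>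

lemma sech_comb_mult_sech:
  assumes "sech_comb H f" "w \<notin> H"
  shows "tanh_comb (insert w H) (\<lambda>x. f x * (1 / cosh (x + w)))"
  using assms
proof (induction rule: sech_comb.induct)
  case zero
  then show ?case using tanh_comb.zero by simp
next
  case (base a)
  then have "sinh (a - w) \<noteq> 0" by auto
  then have eq: "1 / cosh (x + a) * (1 / cosh (x + w)) = (1 / sinh (a - w)) * (tanh (x + a) - tanh (x + w))" for x
    by (simp add: tanh_diff_eq)
  show ?case unfolding eq
    by (intro tanh_comb.scale tanh_comb.base) (use base in auto)
next
  case (add f g)
  then show ?case unfolding distrib_right by (intro tanh_comb.add) auto
next
  case (scale f c)
  then show ?case unfolding mult.assoc by (intro tanh_comb.scale) auto
qed

text \<open>Writing x + w as (x + u) - (u - w) and expanding \<open>cosh\<close> separates the two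
  denominators.\<close>

lemma tanh_mult_sech:
  assumes "u \<noteq> (w::real)"
  shows "tanh (x + u) * (1 / cosh (x + w))
    = (- 1 / sinh (u - w)) * (1 / cosh (x + u)) + (cosh (u - w) / sinh (u - w)) * (1 / cosh (x + w))"
proof -
  have nz: "sinh (u - w) \<noteq> 0" using assms by auto
  have "cosh (x + w) = cosh (x + u) * cosh (u - w) - sinh (x + u) * sinh (u - w)"
    using cosh_diff[of "x + u" "u - w"] by simp
  then show ?thesis using nz cosh_real_pos[of "x + u"] cosh_real_pos[of "x + w"]
    by (simp add: tanh_def field_simps)
qed

lemma tanh_comb_mult_sech:
  assumes "tanh_comb H f" "w \<notin> H"
  shows "sech_comb (insert w H) (\<lambda>x. f x * (1 / cosh (x + w)))"
  using assms
proof (induction rule: tanh_comb.induct)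
  case zero
  then show ?case using sech_comb.zero by simp
next
  case (base a b)
  then have "a \<noteq> w" "b \<noteq> w" by auto
  note eq = tanh_mult_sech[OF this(1)] tanh_mult_sech[OF this(2)]
  have eq': "(tanh (x + a) - tanh (x + b)) * (1 / cosh (x + w)) =
      ((- 1 / sinh (a - w)) * (1 / cosh (x + a)) + (cosh (a - w) / sinh (a - w)) * (1 / cosh (x + w)))
      + (- 1) * ((- 1 / sinh (b - w)) * (1 / cosh (x + b)) + (cosh (b - w) / sinh (b - w)) * (1 / cosh (x + w)))" for x
    unfolding left_diff_distrib eq by simp
  show ?case unfolding eq'
    by (intro sech_comb.add sech_comb.scale sech_comb.base) (use base in auto)
next
  case (add f g)
  then show ?case unfolding distrib_right by (intro sech_comb.add) auto
next
  case (scale f c)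
  then show ?case unfolding mult.assoc by (intro sech_comb.scale) auto
qed

text \<open>Every further factor moves the product from one span to the other, starting with a
  single secant in \<open>sech_comb\<close>. This is the source of the parity distinction.\<close>

lemma prod_sech_comb:
  fixes h :: "'i \<Rightarrow> real"
  assumes "finite S" "S \<noteq> {}" "inj_on h S"
  shows "(odd (card S) \<longrightarrow> sech_comb (h ` S) (\<lambda>x. \<Prod>i\<in>S. 1 / cosh (x + h i))) \<and>
         (even (card S) \<longrightarrow> tanh_comb (h ` S) (\<lambda>x. \<Prod>i\<in>S. 1 / cosh (x + h i)))"
  using assms
proof (induction rule: finite_ne_induct)
  case (singleton i)
  then show ?case by (auto intro: sech_comb.base)
next
  case (insert i S)
  then have IH: "odd (card S) \<Longrightarrow> sech_comb (h ` S) (\<lambda>x. \<Prod>i\<in>S. 1 / cosh (x + h i))"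
    "even (card S) \<Longrightarrow> tanh_comb (h ` S) (\<lambda>x. \<Prod>i\<in>S. 1 / cosh (x + h i))" by auto
  have notin: "h i \<notin> h ` S" using insert by auto
  have eq: "(\<Prod>j\<in>insert i S. 1 / cosh (x + h j)) = (\<Prod>j\<in>S. 1 / cosh (x + h j)) * (1 / cosh (x + h i))" for x
    using insert by (simp add: mult.commute)
  show ?case unfolding eq image_insert
    using IH sech_comb_mult_sech[OF _ notin] tanh_comb_mult_sech[OF _ notin] insert by auto
qed

section \<open>Sums over the lattice\<close>

lemma has_sum_int_nonneg:
  fixes f :: "int \<Rightarrow> real"
  assumes f0: "\<And>n. f n \<ge> 0"
    and lim: "(\<lambda>N. \<Sum>n\<in>{- int N..<int N}. f n) \<longlonglongrightarrow> s"
  shows "(f has_sum s) UNIV"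
proof -
  define U where "U = (\<lambda>N::nat. {- int N..<int N})"
  have filt: "filterlim U (finite_subsets_at_top UNIV) sequentially"
    unfolding filterlim_finite_subsets_at_top
  proof (intro allI impI, safe)
    fix X :: "int set" assume X: "finite X"
    have "\<forall>\<^sub>F N in sequentially. i \<in> U N" for i
      by (rule eventually_sequentiallyI[of "nat \<bar>i\<bar> + 1"]) (auto simp: U_def)
    then have "eventually (\<lambda>N. \<forall>i\<in>X. i \<in> U N) sequentially"
      using X by (simp add: eventually_ball_finite_distrib)
    then show "\<forall>\<^sub>F N in sequentially. finite (U N) \<and> X \<subseteq> U N \<and> U N \<subseteq> UNIV"
      by eventually_elim (auto simp: U_def)
  qed
  have "incseq (\<lambda>N. sum f (U N))"
    by (rule incseq_SucI) (auto simp: U_def f0 intro!: sum_mono2)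
  then have le: "sum f (U N) \<le> s" for N
    using incseq_le lim unfolding U_def by blast
  have "f summable_on UNIV"
  proof (rule nonneg_bounded_partial_sums_imp_summable_on)
    show "\<forall>\<^sub>F X in finite_subsets_at_top UNIV. sum f X \<le> s"
    proof (rule eventually_finite_subsets_at_top_weakI)
      fix X :: "int set" assume X: "finite X"
      have "\<forall>\<^sub>F N in sequentially. X \<subseteq> U N"
        using filt X unfolding filterlim_finite_subsets_at_top by (auto elim!: eventually_mono)
      then obtain N where "X \<subseteq> U N" using eventually_happens by fastforce
      then have "sum f X \<le> sum f (U N)" by (intro sum_mono2) (auto simp: U_def f0)
      then show "sum f X \<le> s" using le order_trans by blast
    qed
  qed (rule f0)
  then have "(f has_sum infsum f UNIV) UNIV" by simp
  moreover from this have "(\<lambda>N. sum f (U N)) \<longlonglongrightarrow> infsum f UNIV"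
    unfolding has_sum_def by (rule filterlim_compose[OF _ filt])
  then have "infsum f UNIV = s" using lim LIMSEQ_unique unfolding U_def by blast
  ultimately show ?thesis by simp
qed

lemma summable_on_int_powr:
  fixes q :: real
  assumes "0 \<le> q" "q < 1"
  shows "(\<lambda>n::int. q ^ nat \<bar>n\<bar>) summable_on UNIV"
proof -
  have s: "(\<lambda>n::nat. q ^ n) summable_on UNIV"
    using assms by (intro norm_summable_imp_summable_on) (auto intro!: summable_geometric simp: norm_power)
  have 1: "(\<lambda>n::int. q ^ nat \<bar>n\<bar>) summable_on range int"
    by (subst summable_on_reindex) (use s in \<open>auto simp: o_def\<close>)
  have 2: "(\<lambda>n::int. q ^ nat \<bar>n\<bar>) summable_on range (\<lambda>n. - int n)"
    by (subst summable_on_reindex) (use s in \<open>auto simp: o_def inj_def\<close>)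
  have "(UNIV :: int set) = range int \<union> range (\<lambda>n. - int n)"
    by (auto, metis int_cases2 rangeI)
  then show ?thesis using summable_on_union[OF 1 2] by simp
qed

definition sech_lat :: "real \<Rightarrow> real \<Rightarrow> int \<Rightarrow> real" where
  "sech_lat \<omega> k n = 1 / cosh (pi * (\<omega> * of_int n + k))"

definition sech_sum :: "real \<Rightarrow> real \<Rightarrow> real" where
  "sech_sum \<omega> k = (\<Sum>\<^sub>\<infinity>n. sech_lat \<omega> k n)"

lemma sech_lat_pos: "sech_lat \<omega> k n > 0"
  by (simp add: sech_lat_def)

lemma sech_le_exp: "1 / cosh x \<le> 2 * exp (- \<bar>x::real\<bar>)"
proof -
  have "exp \<bar>x\<bar> \<le> 2 * cosh x" by (simp add: cosh_def abs_if)
  then show ?thesis by (simp add: exp_minus field_simps)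
qed

text \<open>The bound is uniform for bounded \<open>k\<close>, as required both for differentiating
  \<open>sech_sum\<close> term by term and for bounding infinite products from below.\<close>

lemma sech_lat_le:
  assumes "\<omega> > 0" "\<bar>k\<bar> \<le> M"
  shows "sech_lat \<omega> k n \<le> 2 * exp (pi * M) * exp (- pi * \<omega>) ^ nat \<bar>n\<bar>"
proof -
  have "\<omega> * \<bar>of_int n\<bar> - M \<le> \<bar>\<omega> * of_int n + k\<bar>"
    using assms abs_mult[of \<omega> "of_int n"] by linarith
  then have "pi * (\<omega> * \<bar>of_int n\<bar> - M) \<le> \<bar>pi * (\<omega> * of_int n + k)\<bar>"
    by (simp add: abs_mult)
  then have "exp (- \<bar>pi * (\<omega> * of_int n + k)\<bar>) \<le> exp (pi * M - pi * \<omega> * \<bar>of_int n\<bar>)"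
    by (simp add: algebra_simps)
  also have "\<dots> = exp (pi * M) * exp (- pi * \<omega>) ^ nat \<bar>n\<bar>"
    by (simp add: exp_of_nat_mult[symmetric] exp_add[symmetric] algebra_simps)
  finally show ?thesis
    unfolding sech_lat_def using sech_le_exp[of "pi * (\<omega> * of_int n + k)"] by linarith
qed

lemma summable_on_sech_lat_bound:
  assumes "\<omega> > 0"
  shows "(\<lambda>n. C * exp (- pi * \<omega>) ^ nat \<bar>n\<bar>) summable_on (UNIV :: int set)"
  using assms by (intro summable_on_cmult_right summable_on_int_powr) auto

lemma summable_on_sech_lat:
  assumes "\<omega> > 0"
  shows "sech_lat \<omega> k summable_on UNIV"
  by (rule summable_on_comparison_test[OF summable_on_sech_lat_bound[OF assms, of "2 * exp (pi * \<bar>k\<bar>)"]])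
     (use sech_lat_le[OF assms, of k] less_imp_le[OF sech_lat_pos] in auto)

lemma has_sum_sech_lat:
  assumes "\<omega> > 0"
  shows "(sech_lat \<omega> k has_sum sech_sum \<omega> k) UNIV"
  unfolding sech_sum_def using summable_on_sech_lat[OF assms] by simp

lemma sech_sum_pos:
  assumes "\<omega> > 0"
  shows "sech_sum \<omega> k > 0"
proof -
  have "sech_lat \<omega> k 0 \<le> sech_sum \<omega> k"
    unfolding sech_sum_def
    using finite_sum_le_infsum[OF summable_on_sech_lat[OF assms, of k], of "{0}"] less_imp_le[OF sech_lat_pos] by auto
  then show ?thesis using sech_lat_pos[of \<omega> k 0] by linarith
qed

text \<open>For \<open>m = 1\<close> the sum telescopes to the difference of the limits 1 and -1 of
  tanh; a shift by \<open>m\<close> is \<open>m\<close> such steps. The value is free of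
  \<open>k\<close>.\<close>

lemma has_sum_tanh_diff:
  assumes \<omega>: "\<omega> > 0"
  shows "((\<lambda>j::int. tanh (pi * (\<omega> * of_int (j + m) + k)) - tanh (pi * (\<omega> * of_int j + k))) has_sum 2 * of_int m) UNIV"
proof -
  define t where "t = (\<lambda>j::int. tanh (pi * (\<omega> * of_int j + k)))"
  have shift: "((\<lambda>j. f (j + m)) has_sum s) UNIV \<longleftrightarrow> (f has_sum s) UNIV" for f :: "int \<Rightarrow> real" and m s
    by (rule has_sum_reindex_bij_betw[OF bij_betw_byWitness[where f' = "\<lambda>j. j - m"]]) auto
  have one: "((\<lambda>j. t (j + 1) - t j) has_sum 2) UNIV"
  proof (rule has_sum_int_nonneg)
    show "t (n + 1) - t n \<ge> 0" for n
      using \<omega> by (simp add: t_def)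
    have tel: "(\<Sum>n\<in>{- int N..<int N}. t (n + 1) - t n) = t (int N) - t (- int N)" for N
    proof (induction N)
      case (Suc N)
      have "{- int (Suc N)..<int (Suc N)} = insert (- 1 - int N) (insert (int N) {- int N..<int N})" by auto
      then show ?case using Suc by (simp add: algebra_simps)
    qed simp
    have "filterlim (\<lambda>N. pi * (\<omega> * real N + k)) at_top sequentially"
      using \<omega> by real_asymp
    then have 1: "(\<lambda>N. t (int N)) \<longlonglongrightarrow> 1"
      unfolding t_def using filterlim_compose[OF tanh_real_at_top] by simp
    have "filterlim (\<lambda>N. pi * (- (\<omega> * real N) + k)) at_bot sequentially"
      using \<omega> by real_asymp
    then have 2: "(\<lambda>N. t (- int N)) \<longlonglongrightarrow> - 1"
      unfolding t_def using filterlim_compose[OF tanh_real_at_bot] by simp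
    show "(\<lambda>N. \<Sum>n\<in>{- int N..<int N}. t (n + 1) - t n) \<longlonglongrightarrow> 2"
      unfolding tel using tendsto_diff[OF 1 2] by simp
  qed
  have nat: "((\<lambda>j. t (j + int m) - t j) has_sum 2 * of_nat m) UNIV" for m :: nat
  proof (induction m)
    case (Suc m)
    have "((\<lambda>j. (t (j + int m + 1) - t (j + int m)) + (t (j + int m) - t j)) has_sum (2 + 2 * of_nat m)) UNIV"
      by (intro has_sum_add Suc) (use one shift[of "\<lambda>j. t (j + 1) - t j" "int m" 2] in simp)
    then show ?case by (simp add: algebra_simps)
  qed simp
  have "((\<lambda>j. t (j + m) - t j) has_sum 2 * of_int m) UNIV"
  proof (cases "m \<ge> 0")
    case True
    then show ?thesis using nat[of "nat m"] by simp
  next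
    case False
    then have "((\<lambda>j. t (j - m) - t j) has_sum (- 2 * of_int m)) UNIV"
      using nat[of "nat (- m)"] by simp
    then have "((\<lambda>j. t j - t (j + m)) has_sum (- 2 * of_int m)) UNIV"
      using shift[of "\<lambda>j. t (j - m) - t j" m] by simp
    then show ?thesis using has_sum_uminusI by fastforce
  qed
  then show ?thesis by (simp add: t_def)
qed

text \<open>A shift by a lattice vector only renumbers the sum, so all generators have the same sum
  \<open>sech_sum \<omega> k\<close>, and \<open>K\<close> can be chosen before
  \<open>k\<close>.\<close>

lemma sech_comb_lattice_sum:
  assumes \<omega>: "\<omega> > 0" and "sech_comb H f" "H \<subseteq> range (\<lambda>n::int. pi * \<omega> * of_int n)"
  shows "\<exists>K. \<forall>k. ((\<lambda>j::int. f (pi * (\<omega> * of_int j + k))) has_sum K * sech_sum \<omega> k) UNIV"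
  using assms(2,3)
proof (induction rule: sech_comb.induct)
  case zero
  show ?case by (rule exI[of _ 0]) simp
next
  case (base a)
  then obtain m :: int where a: "a = pi * \<omega> * of_int m" by auto
  have "((\<lambda>j. 1 / cosh (pi * (\<omega> * of_int j + k) + a)) has_sum sech_sum \<omega> k) UNIV" for k
  proof -
    have "(\<lambda>j. 1 / cosh (pi * (\<omega> * of_int j + k) + a)) = (\<lambda>j. sech_lat \<omega> k (j + m))"
      by (auto simp: sech_lat_def a algebra_simps)
    moreover have "((\<lambda>j. sech_lat \<omega> k (j + m)) has_sum sech_sum \<omega> k) UNIV \<longleftrightarrow> (sech_lat \<omega> k has_sum sech_sum \<omega> k) UNIV"
      by (rule has_sum_reindex_bij_betw[OF bij_betw_byWitness[where f' = "\<lambda>j. j - m"]]) auto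
    ultimately show ?thesis using has_sum_sech_lat[OF \<omega>] by simp
  qed
  then show ?case by (intro exI[of _ 1]) simp
next
  case (add f g)
  then obtain K L where "\<And>k. ((\<lambda>j::int. f (pi * (\<omega> * of_int j + k))) has_sum K * sech_sum \<omega> k) UNIV"
    "\<And>k. ((\<lambda>j::int. g (pi * (\<omega> * of_int j + k))) has_sum L * sech_sum \<omega> k) UNIV" by blast
  then show ?case
    by (intro exI[of _ "K + L"] allI) (auto simp: distrib_right intro!: has_sum_add)
next
  case (scale f c)
  then obtain K where "\<And>k. ((\<lambda>j::int. f (pi * (\<omega> * of_int j + k))) has_sum K * sech_sum \<omega> k) UNIV" by blast
  then show ?case
    by (intro exI[of _ "c * K"] allI) (auto simp: mult.assoc intro!: has_sum_cmult_right)
qed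

lemma tanh_comb_lattice_sum:
  assumes \<omega>: "\<omega> > 0" and "tanh_comb H f" "H \<subseteq> range (\<lambda>n::int. pi * \<omega> * of_int n)"
  shows "\<exists>K. \<forall>k. ((\<lambda>j::int. f (pi * (\<omega> * of_int j + k))) has_sum K) UNIV"
  using assms(2,3)
proof (induction rule: tanh_comb.induct)
  case zero
  show ?case by (rule exI[of _ 0]) simp
next
  case (base a b)
  then have "a \<in> range (\<lambda>n::int. pi * \<omega> * of_int n)" "b \<in> range (\<lambda>n::int. pi * \<omega> * of_int n)" by auto
  then obtain m n :: int where a: "a = pi * \<omega> * of_int m" and b: "b = pi * \<omega> * of_int n" by blast
  have "((\<lambda>j. tanh (pi * (\<omega> * of_int j + k) + a) - tanh (pi * (\<omega> * of_int j + k) + b)) has_sum 2 * of_int m + - (2 * of_int n)) UNIV" for k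
  proof -
    have "(\<lambda>j. tanh (pi * (\<omega> * of_int j + k) + a) - tanh (pi * (\<omega> * of_int j + k) + b)) =
      (\<lambda>j. (tanh (pi * (\<omega> * of_int (j + m) + k)) - tanh (pi * (\<omega> * of_int j + k))) +
         - (tanh (pi * (\<omega> * of_int (j + n) + k)) - tanh (pi * (\<omega> * of_int j + k))))"
      by (auto simp: a b algebra_simps)
    then show ?thesis
      using has_sum_add[OF has_sum_tanh_diff[OF \<omega>, of m k] has_sum_uminusI[OF has_sum_tanh_diff[OF \<omega>, of n k]]] by simp
  qed
  then show ?case by blast
next
  case (add f g)
  then obtain K L where "\<And>k. ((\<lambda>j::int. f (pi * (\<omega> * of_int j + k))) has_sum K) UNIV"
    "\<And>k. ((\<lambda>j::int. g (pi * (\<omega> * of_int j + k))) has_sum L) UNIV" by blast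
  then show ?case
    by (intro exI[of _ "K + L"] allI has_sum_add) auto
next
  case (scale f c)
  then obtain K where "\<And>k. ((\<lambda>j::int. f (pi * (\<omega> * of_int j + k))) has_sum K) UNIV" by blast
  then show ?case
    by (intro exI[of _ "c * K"] allI has_sum_cmult_right) auto
qed

text \<open>Each non-empty finite set of integers is a translate, in a unique way, of a set with
  minimum 0. As \<open>f\<close> is constant on translates, the inner sum over the translates is a
  lattice sum of a product of secants; absolute summability justifies the double summation.\<close>

lemma lattice_minor_sum:
  fixes f :: "int set \<Rightarrow> real"
  assumes \<omega>: "\<omega> > 0" and r: "r > 0"
    and inv: "\<And>S j. finite S \<Longrightarrow> f ((\<lambda>n. n + j) ` S) = f S"
    and sm: "\<And>k. (\<lambda>S. f S * (\<Prod>n\<in>S. sech_lat \<omega> k n)) summable_on {S. finite S \<and> card S = r}"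
  shows "\<exists>K. \<forall>k. (\<Sum>\<^sub>\<infinity>S | finite S \<and> card S = r. f S * (\<Prod>n\<in>S. sech_lat \<omega> k n))
     = (if even r then K else K * sech_sum \<omega> k)"
proof -
  define M where "M = {S::int set. finite S \<and> card S = r \<and> Min S = 0}"
  define h where "h = (\<lambda>(S, j::int). (\<lambda>n. n + j) ` S)"
  have Min_shift: "Min ((\<lambda>n. n + j) ` S) = Min S + j" if "finite S" "S \<noteq> {}" for S :: "int set" and j
    using Min_add_commute[OF that, of "\<lambda>x. x" j] by simp
  have bij: "bij_betw h (M \<times> UNIV) {S. finite S \<and> card S = r}"
  proof (rule bij_betw_byWitness[where f' = "\<lambda>S. ((\<lambda>n. n - Min S) ` S, Min S)"])
    show "\<forall>a\<in>M \<times> UNIV. ((\<lambda>n. n - Min (h a)) ` h a, Min (h a)) = a"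
    proof (intro ballI)
      fix a assume "a \<in> M \<times> (UNIV :: int set)"
      then obtain S j where a: "a = (S, j)" and "S \<in> M" by blast
      then have "S \<noteq> {}" "finite S" "Min S = 0" using r by (auto simp: M_def)
      then have "Min (h (S, j)) = j" using Min_shift[of S j] by (simp add: h_def)
      then show "((\<lambda>n. n - Min (h a)) ` h a, Min (h a)) = a"
        by (simp add: a) (simp add: h_def image_image)
    qed
    show "\<forall>S\<in>{S. finite S \<and> card S = r}. h ((\<lambda>n. n - Min S) ` S, Min S) = S"
      by (simp add: h_def image_image)
    show "h ` (M \<times> UNIV) \<subseteq> {S. finite S \<and> card S = r}"
      by (auto simp: h_def M_def card_image)
    show "(\<lambda>S. ((\<lambda>n. n - Min S) ` S, Min S)) ` {S. finite S \<and> card S = r} \<subseteq> M \<times> UNIV"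
    proof (intro image_subsetI)
      fix S :: "int set" assume "S \<in> {S. finite S \<and> card S = r}"
      then have S: "finite S" "card S = r" by auto
      then have "S \<noteq> {}" using r by auto
      then show "((\<lambda>n. n - Min S) ` S, Min S) \<in> M \<times> UNIV"
        using S Min_add_commute[of S "\<lambda>n. n" "- Min S"] by (simp add: M_def card_image inj_on_def del: minus_Min_eq_Max)
    qed
  qed
  have ex: "\<exists>K. \<forall>k. ((\<lambda>j. \<Prod>n\<in>S. sech_lat \<omega> k (n + j)) has_sum (if even r then K else K * sech_sum \<omega> k)) UNIV"
    if "S \<in> M" for S
  proof -
    have S: "finite S" "S \<noteq> {}" "card S = r" using that r by (auto simp: M_def)
    have inj: "inj_on (\<lambda>n::int. pi * \<omega> * of_int n) S" using \<omega> by (auto simp: inj_on_def)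
    have eq: "(\<Prod>n\<in>S. sech_lat \<omega> k (n + j)) = (\<Prod>n\<in>S. 1 / cosh (pi * (\<omega> * of_int j + k) + pi * \<omega> * of_int n))" for k j
      by (simp add: sech_lat_def algebra_simps)
    have H: "(\<lambda>n. pi * \<omega> * of_int n) ` S \<subseteq> range (\<lambda>n::int. pi * \<omega> * of_int n)" by auto
    show ?thesis
    proof (cases "even r")
      case True
      then show ?thesis unfolding eq
        using tanh_comb_lattice_sum[OF \<omega> _ H] prod_sech_comb[OF S(1,2) inj] S(3) by simp
    next
      case False
      then show ?thesis unfolding eq
        using sech_comb_lattice_sum[OF \<omega> _ H] prod_sech_comb[OF S(1,2) inj] S(3) by simp
    qed
  qed
  then obtain K where K: "\<And>S k. S \<in> M \<Longrightarrow>
      ((\<lambda>j. \<Prod>n\<in>S. sech_lat \<omega> k (n + j)) has_sum (if even r then K S else K S * sech_sum \<omega> k)) UNIV"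
    by metis
  have fh: "f (h (S, j)) * (\<Prod>n\<in>h (S, j). sech_lat \<omega> k n) = f S * (\<Prod>n\<in>S. sech_lat \<omega> k (n + j))"
    if "S \<in> M" for S j k
    using that inv by (simp add: h_def M_def prod.reindex)
  have main: "(\<Sum>\<^sub>\<infinity>S | finite S \<and> card S = r. f S * (\<Prod>n\<in>S. sech_lat \<omega> k n))
      = (\<Sum>\<^sub>\<infinity>S\<in>M. f S * (if even r then K S else K S * sech_sum \<omega> k))" for k
  proof -
    have "(\<Sum>\<^sub>\<infinity>S | finite S \<and> card S = r. f S * (\<Prod>n\<in>S. sech_lat \<omega> k n))
       = (\<Sum>\<^sub>\<infinity>x\<in>M \<times> UNIV. f (h x) * (\<Prod>n\<in>h x. sech_lat \<omega> k n))"
      by (rule infsum_reindex_bij_betw[OF bij, symmetric])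
    also have "\<dots> = (\<Sum>\<^sub>\<infinity>S\<in>M. \<Sum>\<^sub>\<infinity>j. f (h (S, j)) * (\<Prod>n\<in>h (S, j). sech_lat \<omega> k n))"
      by (rule infsum_Sigma_banach[symmetric]) (use sm[of k] summable_on_reindex_bij_betw[OF bij, of "\<lambda>S. f S * (\<Prod>n\<in>S. sech_lat \<omega> k n)"] in simp)
    also have "\<dots> = (\<Sum>\<^sub>\<infinity>S\<in>M. f S * (if even r then K S else K S * sech_sum \<omega> k))"
    proof (rule infsum_cong)
      fix S assume S: "S \<in> M"
      have "(\<Sum>\<^sub>\<infinity>j. f (h (S, j)) * (\<Prod>n\<in>h (S, j). sech_lat \<omega> k n)) = (\<Sum>\<^sub>\<infinity>j. f S * (\<Prod>n\<in>S. sech_lat \<omega> k (n + j)))"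
        by (simp only: fh[OF S])
      also have "\<dots> = f S * (if even r then K S else K S * sech_sum \<omega> k)"
        by (rule infsumI, rule has_sum_cmult_right, rule K[OF S])
      finally show "(\<Sum>\<^sub>\<infinity>j. f (h (S, j)) * (\<Prod>n\<in>h (S, j). sech_lat \<omega> k n)) = f S * (if even r then K S else K S * sech_sum \<omega> k)" .
    qed
    finally show ?thesis .
  qed
  show ?thesis
  proof (cases "even r")
    case True
    then show ?thesis using main by simp
  next
    case False
    have "(\<Sum>\<^sub>\<infinity>S\<in>M. f S * (K S * sech_sum \<omega> k)) = (\<Sum>\<^sub>\<infinity>S\<in>M. f S * K S) * sech_sum \<omega> k" for k
      by (simp only: mult.assoc[symmetric] infsum_cmult_left')
    then show ?thesis using False main by simp
  qed
qed

text \<open>The coefficients are kept abstract for two instances: \<open>Hk_coeff T p\<close>, which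
  gives det(1 + z H(k)), and the constant 1, which gives the product of all
  \<open>1 + z * sech_lat \<omega> k n\<close>.\<close>

definition lattice_det :: "(int set \<Rightarrow> real) \<Rightarrow> real \<Rightarrow> real \<Rightarrow> real \<Rightarrow> real" where
  "lattice_det f \<omega> k z = (\<Sum>\<^sub>\<infinity>S\<in>Collect finite. f S * (\<Prod>n\<in>S. sech_lat \<omega> k n) * z ^ card S)"

context
  fixes f :: "int set \<Rightarrow> real" and \<omega> :: real
  assumes \<omega>: "\<omega> > 0"
    and inv: "\<And>S j. finite S \<Longrightarrow> f ((\<lambda>n. n + j) ` S) = f S"
    and sm: "\<And>k z. (\<lambda>S. norm (f S * (\<Prod>n\<in>S. sech_lat \<omega> k n) * z ^ card S)) summable_on Collect finite"
begin

lemma lattice_det_sums: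
  "(\<lambda>r. (\<Sum>\<^sub>\<infinity>S | finite S \<and> card S = r. f S * (\<Prod>n\<in>S. sech_lat \<omega> k n)) * z ^ r) sums lattice_det f \<omega> k z"
  unfolding lattice_det_def by (rule sums_by_card[OF sm])

lemma lattice_det_coeff:
  "\<exists>K. \<forall>k. (\<Sum>\<^sub>\<infinity>S | finite S \<and> card S = r. f S * (\<Prod>n\<in>S. sech_lat \<omega> k n)) = (if even r then K else K * sech_sum \<omega> k)"
proof (cases "r = 0")
  case True
  have "{S::int set. finite S \<and> card S = 0} = {{}}" by auto
  then show ?thesis using True by simp
next
  case False
  have "(\<lambda>S. f S * (\<Prod>n\<in>S. sech_lat \<omega> k n)) summable_on {S. finite S \<and> card S = r}" for k
  proof (rule summable_on_subset_banach)
    show "(\<lambda>S. f S * (\<Prod>n\<in>S. sech_lat \<omega> k n)) summable_on Collect finite"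
      using sm[of k 1] by (subst abs_summable_summable) simp_all
  qed auto
  then show ?thesis using False by (intro lattice_minor_sum \<omega> inv) auto
qed

text \<open>Only coefficients of even order survive, and these do not depend on
  \<open>k\<close>.\<close>

lemma lattice_det_even:
  "lattice_det f \<omega> k z + lattice_det f \<omega> k (- z) = lattice_det f \<omega> k' z + lattice_det f \<omega> k' (- z)"
proof (rule sums_unique2)
  let ?c = "\<lambda>k r. \<Sum>\<^sub>\<infinity>S | finite S \<and> card S = r. f S * (\<Prod>n\<in>S. sech_lat \<omega> k n)"
  show "(\<lambda>r. ?c k r * z ^ r + ?c k r * (- z) ^ r) sums (lattice_det f \<omega> k z + lattice_det f \<omega> k (- z))"
    by (intro sums_add lattice_det_sums)
  have "?c k r * z ^ r + ?c k r * (- z) ^ r = ?c k' r * z ^ r + ?c k' r * (- z) ^ r" for r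
  proof (cases "even r")
    case True
    then obtain K where "\<And>k. ?c k r = K" using lattice_det_coeff[of r] by auto
    then show ?thesis by simp
  qed simp
  then show "(\<lambda>r. ?c k r * z ^ r + ?c k r * (- z) ^ r) sums (lattice_det f \<omega> k' z + lattice_det f \<omega> k' (- z))"
    using sums_add[OF lattice_det_sums[of k' z] lattice_det_sums[of k' "- z"]] by simp
qed

text \<open>Only coefficients of odd order survive, and they are proportional to
  \<open>sech_sum \<omega> k\<close>; cross-multiplication states this without the factor of
  proportionality.\<close>

lemma lattice_det_odd:
  "(lattice_det f \<omega> k z - lattice_det f \<omega> k (- z)) * sech_sum \<omega> k'
    = (lattice_det f \<omega> k' z - lattice_det f \<omega> k' (- z)) * sech_sum \<omega> k"
proof (rule sums_unique2)
  let ?c = "\<lambda>k r. \<Sum>\<^sub>\<infinity>S | finite S \<and> card S = r. f S * (\<Prod>n\<in>S. sech_lat \<omega> k n)"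
  show "(\<lambda>r. (?c k r * z ^ r - ?c k r * (- z) ^ r) * sech_sum \<omega> k') sums ((lattice_det f \<omega> k z - lattice_det f \<omega> k (- z)) * sech_sum \<omega> k')"
    by (intro sums_mult2 sums_diff lattice_det_sums)
  have "(?c k r * z ^ r - ?c k r * (- z) ^ r) * sech_sum \<omega> k' = (?c k' r * z ^ r - ?c k' r * (- z) ^ r) * sech_sum \<omega> k" for r
  proof (cases "even r")
    case False
    then obtain K where "\<And>k. ?c k r = K * sech_sum \<omega> k" using lattice_det_coeff[of r] by auto
    then show ?thesis by (simp add: algebra_simps)
  qed simp
  then show "(\<lambda>r. (?c k r * z ^ r - ?c k r * (- z) ^ r) * sech_sum \<omega> k') sums ((lattice_det f \<omega> k' z - lattice_det f \<omega> k' (- z)) * sech_sum \<omega> k)"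
    using sums_mult2[OF sums_diff[OF lattice_det_sums[of k' z] lattice_det_sums[of k' "- z"]], of "sech_sum \<omega> k"] by simp
qed

end

section \<open>Monotonicity of the secant sum\<close>

lemma sech_lat_has_derivative:
  "((\<lambda>k. sech_lat \<omega> k n) has_real_derivative
     - pi * tanh (pi * (\<omega> * of_int n + k)) * sech_lat \<omega> k n) (at k)"
  unfolding sech_lat_def
  by (auto intro!: derivative_eq_intros simp: tanh_def field_simps power2_eq_square)

text \<open>By the mean value inequality the difference quotients of the terms are dominated by the
  exponential bound for |k| + 1, so the derivative may be taken term by term.\<close>

lemma sech_sum_has_derivative:
  assumes \<omega>: "\<omega> > 0"
  shows "\<exists>D. (sech_sum \<omega> has_real_derivative D) (at k)"
proof -
  define b where "b = (\<lambda>n::int. pi * (2 * exp (pi * (\<bar>k\<bar> + 1))) * exp (- pi * \<omega>) ^ nat \<bar>n\<bar>)"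
  have b: "b summable_on UNIV"
    unfolding b_def by (rule summable_on_sech_lat_bound[OF \<omega>])
  define D where "D = (\<Sum>\<^sub>\<infinity>n. - pi * tanh (pi * (\<omega> * of_int n + k)) * sech_lat \<omega> k n)"
  have lip: "\<bar>sech_lat \<omega> (k + h) n - sech_lat \<omega> k n\<bar> \<le> b n * \<bar>h\<bar>" if h: "\<bar>h\<bar> < 1" for h n
  proof -
    have "norm (sech_lat \<omega> (k + h) n - sech_lat \<omega> k n) \<le> b n * norm (k + h - k)"
    proof (rule field_differentiable_bound[where S = "cball k 1"])
      fix y assume y: "y \<in> cball k 1"
      show "((\<lambda>k. sech_lat \<omega> k n) has_field_derivative - pi * tanh (pi * (\<omega> * of_int n + y)) * sech_lat \<omega> y n) (at y within cball k 1)"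
        by (rule has_field_derivative_at_within[OF sech_lat_has_derivative])
      have "\<bar>y\<bar> \<le> \<bar>k\<bar> + 1" using y by (auto simp: dist_real_def)
      then have "sech_lat \<omega> y n \<le> 2 * exp (pi * (\<bar>k\<bar> + 1)) * exp (- pi * \<omega>) ^ nat \<bar>n\<bar>"
        using sech_lat_le[OF \<omega>] by blast
      then have s: "pi * sech_lat \<omega> y n \<le> b n" unfolding b_def by (simp add: mult.assoc)
      have "\<bar>tanh (pi * (\<omega> * of_int n + y))\<bar> \<le> 1"
        using tanh_real_bounds[of "pi * (\<omega> * of_int n + y)"] by auto
      then have "\<bar>tanh (pi * (\<omega> * of_int n + y))\<bar> * (pi * sech_lat \<omega> y n) \<le> 1 * (pi * sech_lat \<omega> y n)"
        using less_imp_le[OF sech_lat_pos[of \<omega> y n]] by (intro mult_right_mono) auto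
      then show "norm (- pi * tanh (pi * (\<omega> * of_int n + y)) * sech_lat \<omega> y n) \<le> b n"
        using order_trans[OF _ s] less_imp_le[OF sech_lat_pos[of \<omega> y n]] by (simp add: abs_mult mult_ac)
    qed (use h in \<open>auto simp: dist_real_def\<close>)
    then show ?thesis by simp
  qed
  \<comment> \<open>The limit is tested on sequences, to which dominated convergence applies; the
    restriction to a ball makes the bound valid for every member of a sequence.\<close>
  have "((\<lambda>h. (sech_sum \<omega> (k + h) - sech_sum \<omega> k) / h) \<longlongrightarrow> D) (at 0 within ball 0 1)"
    unfolding tendsto_at_iff_sequentially
  proof (intro allI impI)
    fix X :: "nat \<Rightarrow> real" assume X: "\<forall>i. X i \<in> ball 0 1 - {0}" "X \<longlonglongrightarrow> 0"
    have "(\<lambda>i. \<Sum>\<^sub>\<infinity>n. (sech_lat \<omega> (k + X i) n - sech_lat \<omega> k n) / X i) \<longlonglongrightarrow> D"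
      unfolding D_def
    proof (rule tendsto_infsum_dominated[OF b])
      fix i n show "norm ((sech_lat \<omega> (k + X i) n - sech_lat \<omega> k n) / X i) \<le> b n"
        using lip[of "X i" n] X(1)[rule_format, of i] by (simp add: divide_simps abs_mult)
    next
      fix n :: int
      have "((\<lambda>h. (sech_lat \<omega> (k + h) n - sech_lat \<omega> k n) / h) \<longlongrightarrow>
          - pi * tanh (pi * (\<omega> * of_int n + k)) * sech_lat \<omega> k n) (at 0)"
        using sech_lat_has_derivative unfolding DERIV_def .
      then show "(\<lambda>i. (sech_lat \<omega> (k + X i) n - sech_lat \<omega> k n) / X i) \<longlonglongrightarrow>
          - pi * tanh (pi * (\<omega> * of_int n + k)) * sech_lat \<omega> k n"
        unfolding tendsto_at_iff_sequentially using X by (auto simp: o_def)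
    qed
    moreover have "(\<Sum>\<^sub>\<infinity>n. (sech_lat \<omega> (k + h) n - sech_lat \<omega> k n) / h) = (sech_sum \<omega> (k + h) - sech_sum \<omega> k) / h" for h
    proof -
      have "((\<lambda>n. (sech_lat \<omega> (k + h) n + - sech_lat \<omega> k n) * (1 / h)) has_sum ((sech_sum \<omega> (k + h) + - sech_sum \<omega> k) * (1 / h))) UNIV"
        by (intro has_sum_cmult_left has_sum_add has_sum_uminusI has_sum_sech_lat \<omega>)
      then show ?thesis by (simp add: infsumI)
    qed
    ultimately show "((\<lambda>h. (sech_sum \<omega> (k + h) - sech_sum \<omega> k) / h) \<circ> X) \<longlonglongrightarrow> D"
      by (simp add: o_def)
  qed
  then have "((\<lambda>h. (sech_sum \<omega> (k + h) - sech_sum \<omega> k) / h) \<longlongrightarrow> D) (at 0)"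
    by (subst (asm) at_within_open) auto
  then show ?thesis unfolding DERIV_def by blast
qed

text \<open>From 1/(1 - x) = 1 + x/(1 - x) \<le> exp(x/(1 - x)) one gets 1 - x \<ge> exp(-x/(1 -
  \<open>\<theta>\<close>)). The resulting bound does not depend on the number of factors.\<close>

lemma prod_one_minus_ge:
  fixes x :: "'i \<Rightarrow> real"
  assumes "\<And>i. i \<in> A \<Longrightarrow> 0 \<le> x i" "\<And>i. i \<in> A \<Longrightarrow> x i \<le> \<theta>" "\<theta> < 1" "finite A"
    and "(\<Sum>i\<in>A. x i) \<le> M"
  shows "(\<Prod>i\<in>A. 1 - x i) \<ge> exp (- M / (1 - \<theta>))"
proof -
  have one: "exp (- x i / (1 - \<theta>)) \<le> 1 - x i" if i: "i \<in> A" for i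
  proof -
    have xi: "0 \<le> x i" "x i \<le> \<theta>" "x i < 1" using assms i by force+
    have "1 / (1 - x i) = 1 + x i / (1 - x i)" using xi by (simp add: field_simps)
    also have "\<dots> \<le> exp (x i / (1 - x i))" by (rule exp_ge_add_one_self)
    also have "\<dots> \<le> exp (x i / (1 - \<theta>))"
      using xi assms(3) by (auto intro!: divide_left_mono)
    finally have "1 \<le> exp (x i / (1 - \<theta>)) * (1 - x i)" using xi by (simp add: field_simps)
    then show ?thesis by (simp add: exp_minus field_simps)
  qed
  have "exp (- M / (1 - \<theta>)) \<le> exp (\<Sum>i\<in>A. - x i / (1 - \<theta>))"
    using assms(3,5) by (simp add: sum_negf sum_divide_distrib[symmetric] divide_right_mono)
  also have "\<dots> = (\<Prod>i\<in>A. exp (- x i / (1 - \<theta>)))" using assms(4) by (rule exp_sum)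
  also have "\<dots> \<le> (\<Prod>i\<in>A. 1 - x i)" by (rule prod_mono) (use one in auto)
  finally show ?thesis .
qed


text \<open>For coefficients 1 the lattice determinant is a product. With z = -\<open>c0\<close> it
  vanishes at \<open>k0\<close>, and its even and odd parts then make it a positive multiple of
  F(k0) - F(k), where F is \<open>sech_sum \<omega>\<close>. To the right of \<open>k0\<close> the
  product is at least a constant times its factor n = 0, which grows with positive slope, so F must
  decrease with negative slope.\<close>

lemma sech_sum_deriv_neg:
  assumes \<omega>: "\<omega> > 0" and k0: "0 < k0" "k0 < \<omega> / 2"
    and D: "(sech_sum \<omega> has_real_derivative D) (at k0)"
  shows "D < 0"
proof -
  define f where "f = (\<lambda>S::int set. 1::real)"
  have prod_power: "(\<Prod>n\<in>S. sech_lat \<omega> k n) * z ^ card S = (\<Prod>n\<in>S. z * sech_lat \<omega> k n)" for k z S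
    by (simp add: prod.distrib mult.commute)
  have sm: "(\<lambda>S. norm (f S * (\<Prod>n\<in>S. sech_lat \<omega> k n) * z ^ card S)) summable_on Collect finite" for k z
  proof -
    have "(\<lambda>S. \<Prod>n\<in>S. \<bar>z\<bar> * sech_lat \<omega> k n) summable_on Collect finite"
      using summable_on_sech_lat[OF \<omega>] less_imp_le[OF sech_lat_pos]
      by (intro summable_on_prod_finite_subsets summable_on_cmult_right) auto
    moreover have "norm (f S * (\<Prod>n\<in>S. sech_lat \<omega> k n) * z ^ card S) = (\<Prod>n\<in>S. \<bar>z\<bar> * sech_lat \<omega> k n)" for S
      by (simp add: f_def prod_power abs_prod abs_mult abs_of_pos[OF sech_lat_pos] del: prod.distrib)
    ultimately show ?thesis by simp
  qed
  note ev = lattice_det_even[OF \<omega>, of f, OF _ sm] and od = lattice_det_odd[OF \<omega>, of f, OF _ sm]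
  have lim: "(\<lambda>N. \<Prod>n\<in>{- int N..int N}. 1 + z * sech_lat \<omega> k n) \<longlonglongrightarrow> lattice_det f \<omega> k z" for k z
  proof -
    define P where "P = (\<lambda>N::nat. Pow {- int N..int N})"
    have "filterlim P (finite_subsets_at_top (Collect finite)) sequentially"
      unfolding filterlim_finite_subsets_at_top
    proof (intro allI impI, elim conjE)
      fix X :: "int set set" assume X: "finite X" "X \<subseteq> Collect finite"
      then have fin: "finite (\<Union>X)" by auto
      have "\<forall>\<^sub>F N in sequentially. i \<in> {- int N..int N}" for i
        by (rule eventually_sequentiallyI[of "nat \<bar>i\<bar>"]) auto
      then have "eventually (\<lambda>N. \<forall>i\<in>\<Union>X. i \<in> {- int N..int N}) sequentially"
        by (intro eventually_ball_finite[OF fin] ballI)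
      then show "\<forall>\<^sub>F N in sequentially. finite (P N) \<and> X \<subseteq> P N \<and> P N \<subseteq> Collect finite"
        by eventually_elim (auto simp: P_def intro: finite_subset)
    qed
    moreover have "((\<lambda>S. f S * (\<Prod>n\<in>S. sech_lat \<omega> k n) * z ^ card S) has_sum lattice_det f \<omega> k z) (Collect finite)"
      unfolding lattice_det_def by (rule has_sum_infsum, rule abs_summable_summable, rule sm)
    ultimately have "(\<lambda>N. \<Sum>S\<in>P N. f S * (\<Prod>n\<in>S. sech_lat \<omega> k n) * z ^ card S) \<longlonglongrightarrow> lattice_det f \<omega> k z"
      unfolding has_sum_def by (rule filterlim_compose[rotated])
    moreover have "(\<Sum>S\<in>P N. f S * (\<Prod>n\<in>S. sech_lat \<omega> k n) * z ^ card S) = (\<Prod>n\<in>{- int N..int N}. 1 + z * sech_lat \<omega> k n)" for N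
      using prod_add[of "{- int N..int N}" "\<lambda>n. z * sech_lat \<omega> k n" "\<lambda>_. 1"]
      by (simp add: P_def f_def prod_power add.commute)
    ultimately show ?thesis by simp
  qed
  \<comment> \<open>Chosen to make the factor n = 0 of the product vanish at
    \<open>k0\<close>.\<close>
  define c0 where "c0 = cosh (pi * k0)"
  have c0: "c0 > 0" by (simp add: c0_def)
  define b where "b = lattice_det f \<omega> k0 c0"
  have b1: "b \<ge> 1"
    unfolding b_def
    by (rule LIMSEQ_le_const[OF lim]) (use c0 less_imp_le[OF sech_lat_pos] in \<open>auto intro!: exI[of _ 0] prod_ge_1\<close>)
  have zero: "lattice_det f \<omega> k0 (- c0) = 0"
  proof (rule LIMSEQ_unique[OF lim])
    have "(\<Prod>n\<in>{- int N..int N}. 1 + - c0 * sech_lat \<omega> k0 n) = 0" for N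
      by (rule prod_zero) (auto intro!: bexI[of _ 0] simp: c0_def sech_lat_def)
    then show "(\<lambda>N. \<Prod>n\<in>{- int N..int N}. 1 + - c0 * sech_lat \<omega> k0 n) \<longlonglongrightarrow> 0" by (simp only: tendsto_const)
  qed
  have Fk0: "sech_sum \<omega> k0 > 0" by (rule sech_sum_pos[OF \<omega>])
  have det: "lattice_det f \<omega> k (- c0) * (2 * sech_sum \<omega> k0) = b * (sech_sum \<omega> k0 - sech_sum \<omega> k)" for k
  proof -
    have 1: "lattice_det f \<omega> k c0 = b - lattice_det f \<omega> k (- c0)"
      using ev[of k c0 k0] zero unfolding b_def by (simp add: f_def)
    have "(lattice_det f \<omega> k c0 - lattice_det f \<omega> k (- c0)) * sech_sum \<omega> k0 = b * sech_sum \<omega> k"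
      using od[of k c0 k0] zero unfolding b_def by (simp add: f_def)
    then show ?thesis unfolding 1 by (simp add: algebra_simps)
  qed
  \<comment> \<open>For 0 < k < \<open>\<omega>\<close> / 2 and n \<noteq> 0 the point
    \<open>\<omega>\<close> n + k has distance at least \<open>\<omega>\<close> / 2 from 0;
    \<open>\<theta>\<close> bounds what the other factors subtract from 1.\<close>
  define \<theta> where "\<theta> = c0 / cosh (pi * (\<omega> / 2))"
  have \<theta>: "\<theta> < 1"
    using k0 \<omega> by (simp add: \<theta>_def c0_def cosh_real_nonneg_less_iff)
  \<comment> \<open>The bound of \<open>sech_lat_le\<close> for |k| \<le> \<open>\<omega>\<close>,
    summed over the lattice.\<close>
  define M where "M = c0 * (\<Sum>\<^sub>\<infinity>n::int. 2 * exp (pi * \<omega>) * exp (- pi * \<omega>) ^ nat \<bar>n\<bar>)"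
  define \<delta> where "\<delta> = exp (- M / (1 - \<theta>))"
  have lower: "\<delta> * (1 - c0 / cosh (pi * k)) \<le> lattice_det f \<omega> k (- c0)" if k: "k0 < k" "k < \<omega> / 2" for k
  proof (rule LIMSEQ_le_const[OF lim])
    have c0k: "c0 < cosh (pi * k)" using k k0 by (simp add: c0_def cosh_real_nonneg_less_iff)
    have "\<delta> * (1 - c0 / cosh (pi * k)) \<le> (\<Prod>n\<in>{- int N..int N}. 1 + - c0 * sech_lat \<omega> k n)" for N
    proof -
      let ?A = "{- int N..int N} - {0}"
      have small: "c0 * sech_lat \<omega> k n \<le> \<theta>" if n: "n \<in> ?A" for n
      proof -
        have "\<omega> / 2 \<le> \<bar>\<omega> * of_int n + k\<bar>"
        proof (cases "n > 0")
          case True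
          then have "1 \<le> real_of_int n" by simp
          then have "\<omega> * 1 \<le> \<omega> * real_of_int n" using \<omega> by (intro mult_left_mono) auto
          then show ?thesis using k k0 \<omega> by linarith
        next
          case False
          then have "real_of_int n \<le> - 1" using n by auto
          then have "\<omega> * real_of_int n \<le> \<omega> * - 1" using \<omega> by (intro mult_left_mono) auto
          then show ?thesis using k k0 \<omega> by linarith
        qed
        then have "cosh (pi * (\<omega> / 2)) \<le> cosh (pi * \<bar>\<omega> * of_int n + k\<bar>)"
          using \<omega> by (subst cosh_real_nonneg_le_iff) auto
        also have "\<dots> = cosh (pi * (\<omega> * of_int n + k))"
          by (metis abs_mult abs_of_nonneg cosh_real_abs pi_ge_zero)
        finally show ?thesis
          using c0 by (simp add: \<theta>_def sech_lat_def frac_le)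
      qed
      have "(\<Sum>n\<in>?A. c0 * sech_lat \<omega> k n) \<le> c0 * (\<Sum>n\<in>?A. 2 * exp (pi * \<omega>) * exp (- pi * \<omega>) ^ nat \<bar>n\<bar>)"
        unfolding sum_distrib_left
        using c0 k k0 \<omega> by (intro sum_mono mult_left_mono sech_lat_le) auto
      also have "\<dots> \<le> M"
        unfolding M_def using c0
        by (intro mult_left_mono finite_sum_le_infsum summable_on_sech_lat_bound \<omega>) auto
      finally have le: "\<delta> \<le> (\<Prod>n\<in>?A. 1 - c0 * sech_lat \<omega> k n)"
        unfolding \<delta>_def using small \<theta> c0 less_imp_le[OF sech_lat_pos]
        by (intro prod_one_minus_ge) auto
      have eq: "(\<Prod>n\<in>{- int N..int N}. 1 + - c0 * sech_lat \<omega> k n)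
          = (1 - c0 / cosh (pi * k)) * (\<Prod>n\<in>?A. 1 - c0 * sech_lat \<omega> k n)"
        by (subst prod.remove[of _ 0]) (auto simp: sech_lat_def)
      have "1 - c0 / cosh (pi * k) \<ge> 0" using c0k c0 by simp
      from mult_left_mono[OF le this] show ?thesis unfolding eq by (simp only: mult.commute)
    qed
    then show "\<exists>N. \<forall>n\<ge>N. \<delta> * (1 - c0 / cosh (pi * k)) \<le> (\<Prod>n\<in>{- int n..int n}. 1 + - c0 * sech_lat \<omega> k n)" by blast
  qed
  \<comment> \<open>What remains of the lower bound after the identity \<open>det\<close> is solved
    for \<open>sech_sum \<omega> k0 - sech_sum \<omega> k\<close>.\<close>
  define C where "C = 2 * sech_sum \<omega> k0 * \<delta> / b"
  have C: "C > 0" using Fk0 b1 by (simp add: C_def \<delta>_def)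
  have upper: "sech_sum \<omega> k - sech_sum \<omega> k0 \<le> - C * (1 - c0 / cosh (pi * k))" if k: "k0 < k" "k < \<omega> / 2" for k
  proof -
    have "\<delta> * (1 - c0 / cosh (pi * k)) * (2 * sech_sum \<omega> k0) \<le> b * (sech_sum \<omega> k0 - sech_sum \<omega> k)"
      unfolding det[symmetric] using lower[OF k] Fk0 by (intro mult_right_mono) auto
    then have "C * (1 - c0 / cosh (pi * k)) \<le> sech_sum \<omega> k0 - sech_sum \<omega> k"
      using b1 by (simp add: C_def field_simps)
    then show ?thesis by simp
  qed
  \<comment> \<open>\<open>upper\<close> says that \<open>g\<close> does not exceed
    \<open>g k0\<close> just to the right of \<open>k0\<close>, so its derivative there is at most
    0; the term added to \<open>sech_sum\<close> has positive derivative.\<close>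
  define g where "g = (\<lambda>k. sech_sum \<omega> k + C * (1 - c0 / cosh (pi * k)))"
  have gd: "(g has_real_derivative D + C * (pi * tanh (pi * k0))) (at k0)"
    unfolding g_def c0_def
    by (auto intro!: derivative_eq_intros D simp: tanh_def field_simps power2_eq_square)
  have "D + C * (pi * tanh (pi * k0)) \<le> 0"
  proof (rule ccontr)
    assume "\<not> ?thesis"
    then obtain d where d: "d > 0" "\<And>h. 0 < h \<Longrightarrow> h < d \<Longrightarrow> g k0 < g (k0 + h)"
      using DERIV_pos_inc_right[OF gd] by auto
    define h where "h = min (d / 2) ((\<omega> / 2 - k0) / 2)"
    have h: "0 < h" "h < d" "k0 + h < \<omega> / 2" using d(1) k0 by (auto simp: h_def min_def field_simps)
    have "g k0 < g (k0 + h)" using d(2) h by blast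
    moreover have "g (k0 + h) \<le> g k0"
      using upper[of "k0 + h"] h by (simp add: g_def c0_def)
    ultimately show False by simp
  qed
  moreover have "C * (pi * tanh (pi * k0)) > 0" using C k0 by simp
  ultimately show ?thesis by linarith
qed

section \<open>Real entire and real analytic functions\<close>

text \<open>Stated through real coefficients, so that closure under sums and reflection is immediate
  and the series also defines a holomorphic extension with real values on the axis.\<close>

definition entire_real :: "(real \<Rightarrow> real) \<Rightarrow> bool" where
  "entire_real f \<longleftrightarrow> (\<exists>c. \<forall>x. (\<lambda>n. c n * x ^ n) sums f x)"

lemma entire_real_add: "entire_real f \<Longrightarrow> entire_real g \<Longrightarrow> entire_real (\<lambda>x. f x + g x)"
proof -
  assume "entire_real f" "entire_real g"
  then obtain c d where "\<And>x. (\<lambda>n. c n * x ^ n) sums f x" "\<And>x. (\<lambda>n. d n * x ^ n) sums g x"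
    unfolding entire_real_def by blast
  then have "\<And>x. (\<lambda>n. (c n + d n) * x ^ n) sums (f x + g x)"
    unfolding distrib_right by (intro sums_add)
  then show ?thesis unfolding entire_real_def by (intro exI[of _ "\<lambda>n. c n + d n"] allI)
qed

lemma entire_real_cmult: "entire_real f \<Longrightarrow> entire_real (\<lambda>x. a * f x)"
proof -
  assume "entire_real f"
  then obtain c where "\<And>x. (\<lambda>n. c n * x ^ n) sums f x"
    unfolding entire_real_def by blast
  then have "\<And>x. (\<lambda>n. (a * c n) * x ^ n) sums (a * f x)"
    unfolding mult.assoc by (intro sums_mult)
  then show ?thesis unfolding entire_real_def by (intro exI[of _ "\<lambda>n. a * c n"] allI)
qed

lemma entire_real_minus_arg: "entire_real f \<Longrightarrow> entire_real (\<lambda>x. f (- x))"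
proof -
  assume "entire_real f"
  then obtain c where "\<And>x. (\<lambda>n. c n * x ^ n) sums f x"
    unfolding entire_real_def by blast
  then have "\<And>x. (\<lambda>n. c n * (- x) ^ n) sums f (- x)" by blast
  then have "\<And>x. (\<lambda>n. (c n * (- 1) ^ n) * x ^ n) sums f (- x)"
    by (simp add: mult.assoc flip: power_mult_distrib)
  then show ?thesis unfolding entire_real_def by (intro exI[of _ "\<lambda>n. c n * (- 1) ^ n"] allI)
qed

text \<open>Convergence at the real point |z| + 1 gives absolute convergence at z. The extension
  makes the complex factorisation at zeros available.\<close>

lemma entire_real_complexify:
  assumes "entire_real f"
  obtains g where "g holomorphic_on UNIV" "\<And>x. g (of_real x) = of_real (f x)"
proof -
  obtain c where c: "\<And>x. (\<lambda>n. c n * x ^ n) sums f x" using assms unfolding entire_real_def by blast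
  define g where "g = (\<lambda>z::complex. \<Sum>n. of_real (c n) * z ^ n)"
  have of_real: "(\<lambda>n. of_real (c n) * of_real x ^ n) sums (of_real (f x) :: complex)" for x
    using sums_of_real[OF c[of x], where 'a = complex] by simp
  have "summable (\<lambda>n. of_real (c n) * z ^ n)" for z :: complex
  proof -
    have "summable (\<lambda>n. norm (of_real (c n) * z ^ n))"
    proof (rule powser_insidea)
      show "summable (\<lambda>n. of_real (c n) * (of_real (norm z + 1) :: complex) ^ n)"
        using of_real sums_summable by blast
    qed auto
    then show ?thesis by (rule summable_norm_cancel)
  qed
  then have s: "(\<lambda>n. of_real (c n) * (z - 0) ^ n) sums g z" for z
    unfolding g_def by (simp add: summable_sums)
  have "g holomorphic_on ball 0 R" for R
    by (rule power_series_holomorphic[OF s])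
  then have "g holomorphic_on (\<Union>R\<in>UNIV. ball 0 R)"
    by (intro holomorphic_on_UN_open) auto
  moreover have "(\<Union>R\<in>UNIV. ball 0 R) = (UNIV :: complex set)"
    by (auto intro: gt_ex)
  moreover have "g (of_real x) = of_real (f x)" for x
    unfolding g_def using of_real[of x] by (simp add: sums_iff)
  ultimately show ?thesis using that by auto
qed

lemma real_derivative_of_holomorphic:
  assumes "g holomorphic_on S" "open S" "of_real x \<in> S"
  shows "((\<lambda>x. Re (g (of_real x))) has_real_derivative Re (deriv g (of_real x))) (at x)"
proof -
  have "(g has_field_derivative deriv g (of_real x)) (at (of_real x))"
    using holomorphic_derivI[OF assms] .
  then have "((\<lambda>x. g (of_real x)) has_vector_derivative deriv g (of_real x)) (at x)"
    by (rule has_vector_derivative_real_field)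
  then have "((\<lambda>x. Re (g (of_real x))) has_vector_derivative Re (deriv g (of_real x))) (at x)"
    unfolding has_vector_derivative_complex_iff by (simp add: has_real_derivative_iff_has_vector_derivative)
  then show ?thesis by (simp add: has_real_derivative_iff_has_vector_derivative)
qed

lemma entire_real_isCont:
  assumes "entire_real f"
  shows "isCont f x"
proof -
  obtain g where g: "g holomorphic_on UNIV" "\<And>x. g (of_real x) = of_real (f x)"
    using entire_real_complexify[OF assms] by blast
  show ?thesis
    using DERIV_isCont[OF real_derivative_of_holomorphic[OF g(1), of x]] by (simp add: g(2))
qed

text \<open>The holomorphic extension factors at \<open>x1\<close>, and its cofactor is real on the
  axis, so passing to real parts keeps both the factorisation and the non-vanishing at
  \<open>x1\<close>.\<close>

lemma entire_real_factor:
  assumes f: "entire_real f" and nz: "f x0 \<noteq> 0"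
  shows "\<exists>m g g' r. r > 0 \<and> g x1 \<noteq> 0 \<and>
    (\<forall>x. \<bar>x - x1\<bar> < r \<longrightarrow> f x = (x - x1) ^ m * g x \<and> (g has_real_derivative g' x) (at x))"
proof -
  obtain G where G: "G holomorphic_on UNIV" and Gf: "\<And>x. G (of_real x) = of_real (f x)"
    using entire_real_complexify[OF f] by blast
  show ?thesis
  proof (cases "f x1 = 0")
    case False
    have "(f has_real_derivative Re (deriv G (of_real x))) (at x)" for x
      using real_derivative_of_holomorphic[OF G, of x] by (simp add: Gf)
    then show ?thesis using False
      by (intro exI[of _ 0] exI[of _ f] exI[of _ "\<lambda>x. Re (deriv G (of_real x))"] exI[of _ 1]) auto
  next
    case True
    have G0: "G (of_real x1) = 0" using True by (simp add: Gf)
    have nonconst: "\<not> G constant_on UNIV"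
      using nz True Gf unfolding constant_on_def by (metis UNIV_I of_real_0 of_real_eq_iff)
    obtain g r n where g: "0 < n" "0 < r" "g holomorphic_on ball (of_real x1) r"
      "\<And>w. w \<in> ball (of_real x1) r \<Longrightarrow> G w = (w - of_real x1) ^ n * g w"
      "\<And>w. w \<in> ball (of_real x1) r \<Longrightarrow> g w \<noteq> 0"
      using holomorphic_factor_zero_nonconstant[OF G open_UNIV connected_UNIV UNIV_I G0 nonconst] by metis
    define gr where "gr = (\<lambda>x::real. Re (g (of_real x)))"
    have ball: "of_real x \<in> ball (of_real x1 :: complex) r \<longleftrightarrow> \<bar>x - x1\<bar> < r" for x
      by (simp add: dist_norm abs_minus_commute flip: of_real_diff)
    have fx: "of_real (f x) = of_real ((x - x1) ^ n) * g (of_real x)" if "\<bar>x - x1\<bar> < r" for x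
      using g(4)[of "of_real x"] ball[of x] that by (simp add: Gf)
    have der: "(gr has_real_derivative Re (deriv g (of_real x))) (at x)" if "\<bar>x - x1\<bar> < r" for x
      unfolding gr_def using real_derivative_of_holomorphic[OF g(3), of x] ball[of x] that by simp
    have Im0: "Im (g (of_real x)) = 0" if "\<bar>x - x1\<bar> < r" "x \<noteq> x1" for x
      using arg_cong[OF fx[OF that(1)], of Im] that(2) by simp
    \<comment> \<open>At \<open>x1\<close> itself the factorisation reads 0 = 0; there the imaginary
      part of the cofactor vanishes only by continuity.\<close>
    have "isCont (\<lambda>x. Im (g (of_real x))) x1"
    proof -
      have "isCont g (of_real x1)"
        using holomorphic_on_imp_continuous_on[OF g(3)] g(2) by (simp add: continuous_on_eq_continuous_at)
      then have "isCont (\<lambda>x. g (of_real x)) x1" by (intro isCont_o2[of _ of_real g] continuous_intros)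
      then show ?thesis by (rule bounded_linear.isCont[OF bounded_linear_Im])
    qed
    then have "((\<lambda>x. Im (g (of_real x))) \<longlongrightarrow> Im (g (of_real x1))) (at x1)" by (simp add: isCont_def)
    moreover have "eventually (\<lambda>x. Im (g (of_real x)) = 0) (at x1)"
      unfolding eventually_at using g(2) Im0 by (intro exI[of _ r]) (auto simp: dist_real_def)
    then have "((\<lambda>x. Im (g (of_real x))) \<longlongrightarrow> 0) (at x1)" by (rule tendsto_eventually)
    ultimately have "Im (g (of_real x1)) = 0" using tendsto_unique[OF trivial_limit_at] by blast
    then have "gr x1 \<noteq> 0" using g(5)[of "of_real x1"] g(2) by (auto simp: gr_def complex_eq_iff)
    moreover have "f x = (x - x1) ^ n * gr x" if "\<bar>x - x1\<bar> < r" for x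
      using arg_cong[OF fx[OF that], of Re] by (simp add: gr_def)
    ultimately show ?thesis using g(2) der
      by (intro exI[of _ n] exI[of _ gr] exI[of _ "\<lambda>x. Re (deriv g (of_real x))"] exI[of _ r]) auto
  qed
qed

lemma entire_real_isolated_zeros:
  assumes f: "entire_real f" and nz: "f x0 \<noteq> 0"
  shows "\<exists>r>0. \<forall>x. 0 < \<bar>x - x1\<bar> \<and> \<bar>x - x1\<bar> < r \<longrightarrow> f x \<noteq> 0"
proof -
  obtain m g g' r where r: "r > 0" "g x1 \<noteq> 0" and g: "\<And>x. \<bar>x - x1\<bar> < r \<Longrightarrow> f x = (x - x1) ^ m * g x"
    "\<And>x. \<bar>x - x1\<bar> < r \<Longrightarrow> (g has_real_derivative g' x) (at x)"
    using entire_real_factor[OF assms, of x1] by blast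
  have "isCont g x1" using g(2)[of x1] r DERIV_isCont by auto
  then obtain d where d: "d > 0" "\<And>x. dist x1 x < d \<Longrightarrow> g x \<noteq> 0"
    using continuous_at_avoid[of x1 g 0] r(2) by blast
  show ?thesis
  proof (intro exI[of _ "min r d"] conjI allI impI)
    fix x assume "0 < \<bar>x - x1\<bar> \<and> \<bar>x - x1\<bar> < min r d"
    then show "f x \<noteq> 0" using g(1)[of x] d(2)[of x] by (auto simp: dist_real_def abs_minus_commute)
  qed (use r d in auto)
qed

text \<open>Divide by the power of the smaller order: the function of that order keeps a non-zero
  cofactor.\<close>

lemma entire_real_common_factor:
  assumes \<alpha>: "entire_real \<alpha>" and \<beta>: "entire_real \<beta>" and nz: "\<beta> x0 \<noteq> 0"
  shows "\<exists>m a b a' b' r. r > 0 \<and> (a z1 \<noteq> 0 \<or> b z1 \<noteq> 0) \<and>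
      (\<forall>z. \<bar>z - z1\<bar> < r \<longrightarrow> \<alpha> z = (z - z1) ^ m * a z \<and> \<beta> z = (z - z1) ^ m * b z \<and>
        (a has_real_derivative a' z) (at z) \<and> (b has_real_derivative b' z) (at z))"
proof -
  obtain n b b' r where b: "r > 0" "b z1 \<noteq> 0" "\<And>x. \<bar>x - z1\<bar> < r \<Longrightarrow> \<beta> x = (x - z1) ^ n * b x"
    "\<And>x. \<bar>x - z1\<bar> < r \<Longrightarrow> (b has_real_derivative b' x) (at x)"
    using entire_real_factor[OF \<beta> nz, of z1] by blast
  show ?thesis
  proof (cases "\<forall>x. \<alpha> x = 0")
    \<comment> \<open>A function that vanishes identically has no order; the whole order of
      \<open>\<beta>\<close> is divided out and the other cofactor is 0.\<close>
    case True
    then show ?thesis using b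
      by (intro exI[of _ n] exI[of _ "\<lambda>_. 0"] exI[of _ b] exI[of _ b'] exI[of _ r]) auto
  next
    case False
    then obtain y0 where "\<alpha> y0 \<noteq> 0" by blast
    then obtain m a a' s where a: "s > 0" "a z1 \<noteq> 0" "\<And>x. \<bar>x - z1\<bar> < s \<Longrightarrow> \<alpha> x = (x - z1) ^ m * a x"
      "\<And>x. \<bar>x - z1\<bar> < s \<Longrightarrow> (a has_real_derivative a' x) (at x)"
      using entire_real_factor[OF \<alpha>, of y0 z1] by blast
    define l where "l = min m n"
    have pow: "x ^ m * y = x ^ l * (x ^ (m - l) * y)" "x ^ n * y = x ^ l * (x ^ (n - l) * y)" for x y :: real
      by (simp_all add: l_def mult.assoc[symmetric] flip: power_add)
    define A where "A = (\<lambda>x. (x - z1) ^ (m - l) * a x)"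
    define B where "B = (\<lambda>x. (x - z1) ^ (n - l) * b x)"
    have "A z1 \<noteq> 0 \<or> B z1 \<noteq> 0" using a(2) b(2) by (auto simp: A_def B_def l_def min_def)
    moreover have "\<exists>D. (A has_real_derivative D) (at x)" if "\<bar>x - z1\<bar> < s" for x
      unfolding A_def by (rule exI) (rule derivative_intros a(4)[OF that] refl)+
    moreover have "\<exists>D. (B has_real_derivative D) (at x)" if "\<bar>x - z1\<bar> < r" for x
      unfolding B_def by (rule exI) (rule derivative_intros b(4)[OF that] refl)+
    ultimately obtain A' B' where "A z1 \<noteq> 0 \<or> B z1 \<noteq> 0"
      "\<And>x. \<bar>x - z1\<bar> < s \<Longrightarrow> (A has_real_derivative A' x) (at x)"
      "\<And>x. \<bar>x - z1\<bar> < r \<Longrightarrow> (B has_real_derivative B' x) (at x)" by metis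
    then show ?thesis using a(1,3) b(1,3)
      by (intro exI[of _ l] exI[of _ A] exI[of _ B] exI[of _ A'] exI[of _ B'] exI[of _ "min r s"])
         (auto simp: A_def B_def pow[symmetric])
  qed
qed

section \<open>Isolated values of real analytic functions\<close>

lemma real_analytic_deriv:
  assumes "real_analytic f"
  shows "\<exists>d. (f has_real_derivative d) (at x)"
proof -
  obtain r a where r: "r > 0" and a: "\<And>y. \<bar>y - x\<bar> < r \<Longrightarrow> (\<lambda>n. a n * (y - x) ^ n) sums f y"
    using assms unfolding real_analytic_def by meson
  have s: "summable (\<lambda>n. a n * w ^ n)" if "norm w < r" for w
    using a[of "x + w"] that sums_summable by (auto simp: sums_iff)
  have d0: "((\<lambda>z. \<Sum>n. a n * z ^ n) has_field_derivative (\<Sum>n. diffs a n * 0 ^ n)) (at 0)"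
    by (rule termdiffs_strong'[where K = r]) (use s r in auto)
  have "((\<lambda>y. \<Sum>n. a n * (y - x) ^ n) has_field_derivative (\<Sum>n. diffs a n * 0 ^ n) * 1) (at x)"
    by (rule DERIV_chain2[where g = "\<lambda>y. y - x" and f = "\<lambda>z. \<Sum>n. a n * z ^ n"])
       (use d0 in \<open>auto intro!: derivative_eq_intros\<close>)
  moreover have "eventually (\<lambda>y. (\<Sum>n. a n * (y - x) ^ n) = f y) (nhds x)"
    unfolding eventually_nhds_metric using a r by (intro exI[of _ r]) (auto simp: dist_real_def sums_iff)
  ultimately have "(f has_field_derivative (\<Sum>n. diffs a n * 0 ^ n) * 1) (at x)"
    by (subst (asm) DERIV_cong_ev[OF refl _ refl]) auto
  then show ?thesis by blast
qed

lemma real_analytic_locally_constant_or_isolated: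
  assumes "real_analytic f"
  shows "eventually (\<lambda>y. f y \<noteq> c) (at x) \<or> eventually (\<lambda>y. f y = c) (nhds x)"
proof (cases "f x = c")
  case False
  have "(f \<longlongrightarrow> f x) (at x)" using real_analytic_deriv[OF assms] DERIV_isCont isCont_def by blast
  then show ?thesis using False tendsto_imp_eventually_ne by blast
next
  case True
  obtain r a where r: "r > 0" and a: "\<And>y. \<bar>y - x\<bar> < r \<Longrightarrow> (\<lambda>n. a n * (y - x) ^ n) sums f y"
    using assms unfolding real_analytic_def by meson
  have "(\<lambda>n. a n * 0 ^ n) sums c" using a[of x] r True by simp
  then have a0: "a 0 = c" by (rule sums_unique2[OF powser_sums_zero])
  show ?thesis
  proof (cases "\<exists>m>0. a m \<noteq> 0")
    case False
    then have "(\<lambda>n. a n * w ^ n) = (\<lambda>n. if n = 0 then c else 0)" for w :: real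
      using a0 by (auto simp: fun_eq_iff) (metis less_irrefl)
    then have "(\<lambda>n. a n * (y - x) ^ n) sums c" for y
      using sums_single[of 0 "\<lambda>_. c"] by simp
    then have "f y = c" if "\<bar>y - x\<bar> < r" for y
      using a[OF that] sums_unique2 by blast
    then have "eventually (\<lambda>y. f y = c) (nhds x)"
      unfolding eventually_nhds_metric using r by (intro exI[of _ r]) (auto simp: dist_real_def)
    then show ?thesis by blast
  next
    case True
    then obtain m where m: "m > 0" "a m \<noteq> 0" by blast
    define a' where "a' = a(0 := 0)"
    have sm: "(\<lambda>n. a' n * (y - x) ^ n) sums (f y - c)" if "norm (y - x) < r" for y
    proof -
      have "(\<lambda>n. a n * (y - x) ^ n - (if n = 0 then c else 0)) sums (f y - c)"
        using a[of y] that by (intro sums_diff sums_single) auto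
      moreover have "(\<lambda>n. a n * (y - x) ^ n - (if n = 0 then c else 0)) = (\<lambda>n. a' n * (y - x) ^ n)"
        using a0 by (auto simp: a'_def fun_eq_iff)
      ultimately show ?thesis by simp
    qed
    obtain s where s: "0 < s" "\<And>z. z \<in> cball x s - {x} \<Longrightarrow> f z - c \<noteq> 0"
      by (rule powser_0_nonzero[OF r sm, of m]) (use m \<open>f x = c\<close> in \<open>auto simp: a'_def\<close>)
    have "eventually (\<lambda>y. f y \<noteq> c) (at x)"
      unfolding eventually_at
    proof (intro exI[of _ s] conjI ballI impI s(1))
      fix y assume "y \<noteq> x \<and> dist y x < s"
      then show "f y \<noteq> c" using s(2)[of y] by (auto simp: dist_commute)
    qed
    then show ?thesis by blast
  qed
qed

text \<open>If the value were not isolated, the points near which \<open>f\<close> equals it would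
  form a non-empty set that is open and closed, hence the whole line.\<close>

lemma real_analytic_isolated:
  assumes f: "real_analytic f" and nf: "\<not> (\<exists>c. \<forall>k. f k = c)"
  shows "eventually (\<lambda>y. f y \<noteq> f x) (at x)"
proof (rule ccontr)
  assume no: "\<not> ?thesis"
  define A where "A = {y. eventually (\<lambda>z. f z = f x) (nhds y)}"
  have "x \<in> A" using no real_analytic_locally_constant_or_isolated[OF f, of "f x" x] by (simp add: A_def)
  moreover have "open A"
    unfolding A_def by (subst open_subopen) (auto simp: eventually_nhds)
  moreover have "closed A"
  proof -
    have "- A = {y. eventually (\<lambda>z. f z \<noteq> f x) (at y)}"
    proof (intro Set.set_eqI iffI)
      fix y assume "y \<in> - A"
      then show "y \<in> {y. eventually (\<lambda>z. f z \<noteq> f x) (at y)}"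
        using real_analytic_locally_constant_or_isolated[OF f, of "f x" y] by (auto simp: A_def)
    next
      fix y assume "y \<in> {y. eventually (\<lambda>z. f z \<noteq> f x) (at y)}"
      then have ev: "eventually (\<lambda>z. f z \<noteq> f x) (at y)" by simp
      show "y \<in> - A"
      proof
        assume "y \<in> A"
        then have "eventually (\<lambda>z. f z = f x) (at y)" by (simp add: A_def eventually_nhds_conv_at)
        with ev have "eventually (\<lambda>z. False) (at y)" by eventually_elim simp
        then show False by simp
      qed
    qed
    moreover have "open {y. eventually (\<lambda>z. f z \<noteq> f x) (at y)}"
    proof (subst open_subopen, clarify)
      fix y assume "eventually (\<lambda>z. f z \<noteq> f x) (at y)"
      then obtain S where S: "open S" "y \<in> S" "\<And>z. z \<in> S \<Longrightarrow> z \<noteq> y \<Longrightarrow> f z \<noteq> f x"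
        unfolding eventually_at_topological by blast
      have "eventually (\<lambda>z. f z \<noteq> f x) (at w)" if "w \<in> S" for w
      proof (cases "w = y")
        case True
        then show ?thesis using S unfolding eventually_at_topological by blast
      next
        case False
        then have "w \<in> S - {y}" "open (S - {y})" using that S(1) by auto
        then show ?thesis using S(3) unfolding eventually_at_topological by blast
      qed
      then show "\<exists>T. open T \<and> y \<in> T \<and> T \<subseteq> {y. eventually (\<lambda>z. f z \<noteq> f x) (at y)}"
        using S by blast
    qed
    ultimately show ?thesis by (simp add: closed_def)
  qed
  ultimately have "A = UNIV" using clopen[of A] by blast
  then have "f y = f x" for y using eventually_nhds_x_imp_x[of "\<lambda>z. f z = f x" y] by (auto simp: A_def)
  then show False using nf by blast
qed

text \<open>Close to \<open>x\<close> the sign of \<open>f\<close> is that of \<open>f x\<close>, so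
  equal absolute values mean equal values.\<close>

lemma real_analytic_abs_isolated:
  assumes f: "real_analytic f" and nf: "\<not> (\<exists>c. \<forall>k. f k = c)" and nz: "f x \<noteq> 0"
  shows "eventually (\<lambda>y. \<bar>f y\<bar> \<noteq> \<bar>f x\<bar>) (at x)"
proof -
  have "((\<lambda>y. f y * f x) \<longlongrightarrow> f x * f x) (at x)"
    using real_analytic_deriv[OF f] DERIV_isCont isCont_def by (intro tendsto_intros) blast
  moreover have "f x * f x > 0" using nz by (metis not_real_square_gt_zero)
  ultimately have "eventually (\<lambda>y. f y * f x > 0) (at x)" using order_tendstoD(1) by blast
  with real_analytic_isolated[OF f nf] show ?thesis
    by eventually_elim (auto simp: abs_if zero_less_mult_iff split: if_splits)
qed

section \<open>Alternation of the sign of the derivative\<close>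

text \<open>The real-variable part of the argument, with \<open>h\<close> standing for
  \<open>\<omega>\<close> / 2. The assumption \<open>zeros\<close> is the only link between the
  bands and the determinant, and \<open>E_isolated\<close> is the form in which analyticity
  enters.\<close>

locale alternating_bands =
  fixes \<alpha> \<beta> F F' :: "real \<Rightarrow> real" and h :: real
    and J :: "nat set" and E :: "nat \<Rightarrow> real \<Rightarrow> real" and N :: enat and e :: "nat \<Rightarrow> nat"
  assumes cont: "continuous_on UNIV \<alpha>" "continuous_on UNIV \<beta>"
    and at0: "\<alpha> 0 = 0" "\<beta> 0 = 1"
    and factor: "\<And>z\<^sub>1. \<exists>m a b a' b' r. r > 0 \<and> (a z\<^sub>1 \<noteq> 0 \<or> b z\<^sub>1 \<noteq> 0) \<and>
      (\<forall>z. \<bar>z - z\<^sub>1\<bar> < r \<longrightarrow> \<alpha> z = (z - z\<^sub>1) ^ m * a z \<and> \<beta> z = (z - z\<^sub>1) ^ m * b z \<and>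
        (a has_real_derivative a' z) (at z) \<and> (b has_real_derivative b' z) (at z))"
    and isolated_zeros: "\<And>k z\<^sub>1. 0 < k \<Longrightarrow> k < h \<Longrightarrow>
      \<exists>r>0. \<forall>z. 0 < \<bar>z - z\<^sub>1\<bar> \<and> \<bar>z - z\<^sub>1\<bar> < r \<longrightarrow> (\<beta> z)\<^sup>2 \<noteq> (\<alpha> z)\<^sup>2 * (F k)\<^sup>2"
    and F_pos: "\<And>k. 0 < k \<Longrightarrow> k < h \<Longrightarrow> F k > 0"
    and F_deriv: "\<And>k. 0 < k \<Longrightarrow> k < h \<Longrightarrow> (F has_real_derivative F' k) (at k)"
    and F'_neg: "\<And>k. 0 < k \<Longrightarrow> k < h \<Longrightarrow> F' k < 0"
    and zeros: "\<And>k z. 0 < k \<Longrightarrow> k < h \<Longrightarrow> z > 0 \<Longrightarrow>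
      (\<beta> z)\<^sup>2 = (\<alpha> z)\<^sup>2 * (F k)\<^sup>2 \<longleftrightarrow> (\<exists>i\<in>J. \<bar>E i k\<bar> = 1 / z)"
    and E_deriv: "\<And>i k. i \<in> J \<Longrightarrow> \<exists>d. (E i has_real_derivative d) (at k)"
    and E_nz: "\<And>i k. i \<in> J \<Longrightarrow> E i k \<noteq> 0"
    and E_isolated: "\<And>i k. i \<in> J \<Longrightarrow> \<not> (\<exists>c. \<forall>k. E i k = c) \<Longrightarrow> eventually (\<lambda>k'. \<bar>E i k'\<bar> \<noteq> \<bar>E i k\<bar>) (at k)"
    and enum: "bij_betw e {n. enat n < N} {i\<in>J. \<not> (\<exists>c. \<forall>k. E i k = c)}"
    and order: "\<And>n k. enat (Suc n) < N \<Longrightarrow> 0 < k \<Longrightarrow> k < h \<Longrightarrow> \<bar>E (e n) k\<bar> > \<bar>E (e (Suc n)) k\<bar>"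
begin

definition \<zeta> :: "nat \<Rightarrow> real \<Rightarrow> real" where "\<zeta> n k = 1 / \<bar>E (e n) k\<bar>"

text \<open>In the application this is det(1 + z H(k)) det(1 - z H(k)); the product treats
  eigenvalues of both signs alike.\<close>

definition G :: "real \<Rightarrow> real \<Rightarrow> real" where "G k z = (\<beta> z)\<^sup>2 - (\<alpha> z)\<^sup>2 * (F k)\<^sup>2"

lemma e_in: "enat n < N \<Longrightarrow> e n \<in> J" "enat n < N \<Longrightarrow> \<not> (\<exists>c. \<forall>k. E (e n) k = c)"
  using bij_betw_apply[OF enum, of n] by auto

lemma enat_less_mono: "enat n < N \<Longrightarrow> m \<le> n \<Longrightarrow> enat m < N"
  by (meson enat_ord_simps(1) order_le_less_trans)

lemma \<zeta>_pos: "enat n < N \<Longrightarrow> \<zeta> n k > 0"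
  using E_nz[OF e_in(1)] by (simp add: \<zeta>_def)

lemma \<zeta>_deriv:
  assumes "enat n < N"
  shows "\<exists>d. (\<zeta> n has_real_derivative d) (at k)"
proof -
  obtain d where d: "(E (e n) has_real_derivative d) (at k)" using E_deriv e_in(1) assms by blast
  have nz: "E (e n) k \<noteq> 0" using E_nz e_in(1) assms by blast
  \<comment> \<open>\<open>E (e n)\<close> keeps its sign near \<open>k\<close>, so there the
    absolute value is multiplication by the constant \<open>s\<close>.\<close>
  define s where "s = sgn (E (e n) k)"
  have s: "s * E (e n) k > 0" using nz by (simp add: s_def sgn_mult_self_eq zero_less_mult_iff sgn_real_def)
  have "((\<lambda>k. s * E (e n) k) \<longlongrightarrow> s * E (e n) k) (nhds k)"
    using DERIV_isCont[OF DERIV_cmult[OF d, of s]] unfolding isCont_def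
    by (rule iffD1[OF tendsto_at_iff_tendsto_nhds])
  then have "eventually (\<lambda>k'. s * E (e n) k' > 0) (nhds k)" using s order_tendstoD(1) by blast
  then have ev: "eventually (\<lambda>k'. \<zeta> n k' = 1 / (s * E (e n) k')) (nhds k)"
    by eventually_elim (auto simp: \<zeta>_def s_def sgn_real_def abs_if split: if_splits)
  have "((\<lambda>k. 1 / (s * E (e n) k)) has_real_derivative - (s * d) / (s * E (e n) k)\<^sup>2) (at k)"
    using s by (auto intro!: derivative_eq_intros d simp: power2_eq_square)
  then have "(\<zeta> n has_real_derivative - (s * d) / (s * E (e n) k)\<^sup>2) (at k)"
    by (subst DERIV_cong_ev[OF refl ev refl])
  then show ?thesis by blast
qed

lemma \<zeta>_isCont: "enat n < N \<Longrightarrow> isCont (\<zeta> n) k"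
  using \<zeta>_deriv DERIV_isCont by blast

lemma G_\<zeta>: "enat n < N \<Longrightarrow> 0 < k \<Longrightarrow> k < h \<Longrightarrow> G k (\<zeta> n k) = 0"
  using zeros[OF _ _ \<zeta>_pos, of k n k] e_in(1) by (auto simp: G_def \<zeta>_def)

lemma \<zeta>_less:
  assumes "enat m < N" "n < m" "0 < k" "k < h"
  shows "\<zeta> n k < \<zeta> m k"
  using assms(2,1)
proof (induction rule: less_Suc_induct)
  case (1 i)
  then have "\<bar>E (e (Suc i)) k\<bar> < \<bar>E (e i) k\<bar>" using order assms by blast
  moreover have "\<bar>E (e (Suc i)) k\<bar> > 0" using E_nz e_in(1)[OF 1] by simp
  ultimately show ?case by (simp add: \<zeta>_def frac_less2)
next
  case (2 i j l)
  then show ?case using enat_less_mono[of l j] by force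
qed

lemma F_less:
  assumes "0 < k" "k < k'" "k' < h"
  shows "F k' < F k"
proof (rule DERIV_neg_imp_decreasing[OF assms(2)])
  fix x assume "k \<le> x" "x \<le> k'"
  then show "\<exists>y. (F has_real_derivative y) (at x) \<and> y < 0"
    using F_deriv[of x] F'_neg[of x] assms by auto
qed

text \<open>A flat band makes \<open>z\<close> a zero for every k, while F takes different values at
  the sample points h/3 and h/2. Contrapositively, zeros with \<open>\<alpha> z \<noteq> 0\<close>
  belong to non-flat bands.\<close>

lemma flat_imp_zero:
  assumes "i \<in> J" "\<exists>c. \<forall>k. E i k = c" "\<bar>E i k\<bar> = 1 / z" "z > 0" "0 < h"
  shows "\<alpha> z = 0"
proof -
  have "\<bar>E i (h/3)\<bar> = 1 / z" "\<bar>E i (h/2)\<bar> = 1 / z" using assms(2,3) by metis+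
  then have "(\<beta> z)\<^sup>2 = (\<alpha> z)\<^sup>2 * (F (h/3))\<^sup>2" "(\<beta> z)\<^sup>2 = (\<alpha> z)\<^sup>2 * (F (h/2))\<^sup>2"
    using zeros[of "h/3" z] zeros[of "h/2" z] assms(1,4,5) by auto
  moreover have "(F (h/2))\<^sup>2 < (F (h/3))\<^sup>2"
    using F_less[of "h/3" "h/2"] F_pos[of "h/2"] assms(5) by (intro power_strict_mono) auto
  ultimately show ?thesis by auto
qed

section \<open>Local analysis at one point of the positive axis\<close>

context
  fixes k0 assumes k0: "0 < k0" "k0 < h"
begin

lemma eventually_k: "eventually (\<lambda>k. 0 < k \<and> k < h) (nhds k0)"
  using k0 eventually_nhds_in_open[of "{0<..<h}" k0] by simp

context
  fixes z\<^sub>1 r :: real and m :: nat and a b a' b' :: "real \<Rightarrow> real"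
  assumes z1: "z\<^sub>1 > 0" and r: "r > 0" and ab: "a z\<^sub>1 \<noteq> 0 \<or> b z\<^sub>1 \<noteq> 0"
    and fac: "\<And>z. \<bar>z - z\<^sub>1\<bar> < r \<Longrightarrow> \<alpha> z = (z - z\<^sub>1) ^ m * a z"
      "\<And>z. \<bar>z - z\<^sub>1\<bar> < r \<Longrightarrow> \<beta> z = (z - z\<^sub>1) ^ m * b z"
    and ab': "\<And>z. \<bar>z - z\<^sub>1\<bar> < r \<Longrightarrow> (a has_real_derivative a' z) (at z)"
      "\<And>z. \<bar>z - z\<^sub>1\<bar> < r \<Longrightarrow> (b has_real_derivative b' z) (at z)"
begin

text \<open>\<open>G\<close> without the common factor
  \<open>(z - z\<^sub>1) ^ (2 * m)\<close>.\<close>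

definition Gt :: "real \<Rightarrow> real \<Rightarrow> real" where "Gt k z = (b z)\<^sup>2 - (a z)\<^sup>2 * (F k)\<^sup>2"

lemma G_eq_Gt: "\<bar>z - z\<^sub>1\<bar> < r \<Longrightarrow> G k z = ((z - z\<^sub>1) ^ m)\<^sup>2 * Gt k z"
  by (simp add: G_def Gt_def fac power_mult_distrib algebra_simps)

lemma Gt_z_deriv: "(Gt k has_real_derivative 2 * b z\<^sub>1 * b' z\<^sub>1 - 2 * a z\<^sub>1 * a' z\<^sub>1 * (F k)\<^sup>2) (at z\<^sub>1)"
  unfolding Gt_def using r by (auto intro!: derivative_eq_intros ab' simp: power2_eq_square)

lemma Gt_z_cont: "\<bar>z - z\<^sub>1\<bar> < r \<Longrightarrow> isCont (Gt k) z"
  unfolding Gt_def by (intro continuous_intros DERIV_isCont[OF ab'(1)] DERIV_isCont[OF ab'(2)])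

lemma Gt_k_cont: "isCont (\<lambda>k. Gt k z) k0"
  unfolding Gt_def by (intro continuous_intros DERIV_isCont[OF F_deriv] k0)

lemma a_nz: "Gt k0 z\<^sub>1 = 0 \<Longrightarrow> a z\<^sub>1 \<noteq> 0"
  using ab by (auto simp: Gt_def)

text \<open>\<open>Gt\<close> vanishes along the band. Differentiating this identity, the
  z-derivative of \<open>Gt\<close> times \<open>d\<close> plus its k-derivative
  \<open>- 2 * (a z\<^sub>1)\<^sup>2 * F k0 * F' k0\<close> is 0, and the latter is positive. In
  particular neither the z-derivative nor \<open>d\<close> is 0.\<close>

lemma band_crossing:
  assumes n: "enat n < N" "\<zeta> n k0 = z\<^sub>1" and d: "(\<zeta> n has_real_derivative d) (at k0)"
  shows "Gt k0 z\<^sub>1 = 0" "(2 * b z\<^sub>1 * b' z\<^sub>1 - 2 * a z\<^sub>1 * a' z\<^sub>1 * (F k0)\<^sup>2) * d < 0"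
proof -
  have lim: "(\<zeta> n \<longlongrightarrow> z\<^sub>1) (at k0)" using \<zeta>_isCont[OF n(1), of k0] n(2) by (simp add: isCont_def)
  have near: "eventually (\<lambda>k. \<bar>\<zeta> n k - z\<^sub>1\<bar> < r) (at k0)"
    using tendstoD[OF lim r] by (simp add: dist_real_def)
  \<comment> \<open>Where the band takes the value \<open>z\<^sub>1\<close> the removed factor may
    vanish, and \<open>G = 0\<close> then says nothing about \<open>Gt\<close>. For a non-flat band
    this occurs only at isolated \<open>k\<close>; continuity settles \<open>k0\<close>.\<close>
  have ne: "eventually (\<lambda>k. \<zeta> n k \<noteq> z\<^sub>1) (at k0)"
    using E_isolated[OF e_in[OF n(1)], of k0]
  proof eventually_elim
    case (elim k)
    then show ?case using n(2) by (auto simp: \<zeta>_def)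
  qed
  have ev0: "eventually (\<lambda>k. Gt k (\<zeta> n k) = 0) (at k0)"
    using near ne eventually_nhds_conv_at[THEN iffD1, OF eventually_k, THEN conjunct1]
  proof eventually_elim
    case (elim k)
    then show ?case using G_eq_Gt[of "\<zeta> n k" k] G_\<zeta>[OF n(1), of k] by simp
  qed
  have F0: "(F has_real_derivative F' k0) (at k0)" by (rule F_deriv[OF k0])
  define P where "P = 2 * b z\<^sub>1 * b' z\<^sub>1 - 2 * a z\<^sub>1 * a' z\<^sub>1 * (F k0)\<^sup>2"
  have ad: "(a has_real_derivative a' z\<^sub>1) (at (\<zeta> n k0))" and bd: "(b has_real_derivative b' z\<^sub>1) (at (\<zeta> n k0))"
    using ab'[of z\<^sub>1] r n(2) by auto
  have der: "((\<lambda>k. Gt k (\<zeta> n k)) has_real_derivative P * d - 2 * (a z\<^sub>1)\<^sup>2 * F k0 * F' k0) (at k0)"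
    unfolding Gt_def P_def
    by (auto intro!: derivative_eq_intros DERIV_chain2[OF ad d] DERIV_chain2[OF bd d] F0 simp: n(2) power2_eq_square algebra_simps)
  have "((\<lambda>k. Gt k (\<zeta> n k)) \<longlongrightarrow> Gt k0 (\<zeta> n k0)) (at k0)"
    using DERIV_isCont[OF der] by (simp add: isCont_def)
  moreover have "((\<lambda>k. Gt k (\<zeta> n k)) \<longlongrightarrow> 0) (at k0)"
    using ev0 by (simp add: tendsto_eventually)
  ultimately have "Gt k0 (\<zeta> n k0) = 0" using tendsto_unique[OF trivial_limit_at] by blast
  then show G0: "Gt k0 z\<^sub>1 = 0" using n(2) by simp
  have "eventually (\<lambda>k. Gt k (\<zeta> n k) = 0) (nhds k0)"
    using ev0 G0 n(2) by (simp add: eventually_nhds_conv_at)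
  then have der0: "((\<lambda>k. Gt k (\<zeta> n k)) has_real_derivative 0) (at k0)"
    by (subst DERIV_cong_ev[OF refl _ refl, of _ "\<lambda>_. 0"]) auto
  have "P * d = 2 * (a z\<^sub>1)\<^sup>2 * F k0 * F' k0"
    using DERIV_unique[OF der der0] by simp
  moreover have "(a z\<^sub>1)\<^sup>2 * F k0 * F' k0 < 0"
    using a_nz[OF G0] F_pos[OF k0] F'_neg[OF k0] by (simp add: mult_pos_neg)
  ultimately show "(2 * b z\<^sub>1 * b' z\<^sub>1 - 2 * a z\<^sub>1 * a' z\<^sub>1 * (F k0)\<^sup>2) * d < 0"
    unfolding P_def by linarith
qed

text \<open>At fixed z with \<open>a z \<noteq> 0\<close>, \<open>Gt\<close> increases with k. A
  slight move of k in the right direction gives \<open>Gt k z\<^sub>1\<close> the sign opposite to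
  that at a nearby \<open>w\<close>, and the intermediate value theorem yields a zero between them,
  away from \<open>z\<^sub>1\<close>.\<close>

lemma nearby_band:
  assumes G0: "Gt k0 z\<^sub>1 = 0" and \<epsilon>: "\<epsilon> > 0" and Q: "eventually Q (nhds k0)"
  shows "\<exists>k n. Q k \<and> enat n < N \<and> \<bar>\<zeta> n k - z\<^sub>1\<bar> < \<epsilon>"
proof -
  have "isCont a z\<^sub>1" using ab'(1)[of z\<^sub>1] r by (auto intro: DERIV_isCont)
  then have "eventually (\<lambda>z. a z \<noteq> 0) (nhds z\<^sub>1)"
    using a_nz[OF G0] by (metis continuous_at_imp_continuous_within isCont_def t1_space_nhds tendsto_imp_eventually_ne tendsto_nhds_iff)
  then obtain r1 where r1: "r1 > 0" "\<And>z. \<bar>z - z\<^sub>1\<bar> < r1 \<Longrightarrow> a z \<noteq> 0"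
    unfolding eventually_nhds_metric dist_real_def by blast
  obtain r2 where r2: "r2 > 0" "\<And>z. 0 < \<bar>z - z\<^sub>1\<bar> \<Longrightarrow> \<bar>z - z\<^sub>1\<bar> < r2 \<Longrightarrow> G k0 z \<noteq> 0"
    using isolated_zeros[OF k0, of z\<^sub>1] unfolding G_def by auto
  \<comment> \<open>Half the minimum, so that all the inequalities below are strict.\<close>
  define \<rho> where "\<rho> = Min {\<epsilon>, r, r1, r2, z\<^sub>1} / 2"
  have \<rho>: "\<rho> > 0" "\<rho> < \<epsilon>" "\<rho> < r" "\<rho> < r1" "\<rho> < r2" "\<rho> < z\<^sub>1"
    using \<epsilon> r r1 r2 z1 by (auto simp: \<rho>_def min_def)
  define w where "w = z\<^sub>1 + \<rho>"
  have w: "\<bar>w - z\<^sub>1\<bar> = \<rho>" using \<rho> by (simp add: w_def)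
  have Gw: "Gt k0 w \<noteq> 0" using r2(2)[of w] G_eq_Gt[of w k0] w \<rho> by auto
  have Qk: "eventually (\<lambda>k. Q k \<and> 0 < k \<and> k < h) (nhds k0)"
    using Q eventually_k by eventually_elim simp
  have limw: "((\<lambda>k. Gt k w) \<longlongrightarrow> Gt k0 w) (nhds k0)"
    using Gt_k_cont[of w] unfolding isCont_def by (rule iffD1[OF tendsto_at_iff_tendsto_nhds])
  have "\<exists>k. Q k \<and> 0 < k \<and> k < h \<and> Gt k w * Gt k z\<^sub>1 < 0"
  proof (cases "Gt k0 w < 0")
    case True
    then have "eventually (\<lambda>k. Gt k w < 0) (nhds k0)" using limw order_tendstoD(2) by blast
    with Qk have "eventually (\<lambda>k. Q k \<and> 0 < k \<and> k < h \<and> Gt k w < 0) (nhds k0)" by eventually_elim simp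
    then obtain d where d: "d > 0" "\<And>k. \<bar>k - k0\<bar> < d \<Longrightarrow> Q k \<and> 0 < k \<and> k < h \<and> Gt k w < 0"
      unfolding eventually_nhds_metric dist_real_def by blast
    \<comment> \<open>Moving k to the right lowers F, which lifts \<open>Gt k z\<^sub>1\<close>
      above 0; in the other case k moves to the left.\<close>
    define k where "k = k0 + d / 2"
    have k: "Q k \<and> 0 < k \<and> k < h \<and> Gt k w < 0" using d(1) by (intro d(2)) (simp add: k_def)
    have "(F k)\<^sup>2 < (F k0)\<^sup>2"
      using F_less[of k0 k] k k0 d(1) F_pos[of k] by (intro power_strict_mono) (auto simp: k_def)
    then have "Gt k0 z\<^sub>1 < Gt k z\<^sub>1" using a_nz[OF G0] by (simp add: Gt_def)
    then show ?thesis using G0 k by (intro exI[of _ k]) (auto simp: mult_neg_pos)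
  next
    case False
    then have "Gt k0 w > 0" using Gw by simp
    then have "eventually (\<lambda>k. Gt k w > 0) (nhds k0)" using limw order_tendstoD(1) by blast
    with Qk have "eventually (\<lambda>k. Q k \<and> 0 < k \<and> k < h \<and> Gt k w > 0) (nhds k0)" by eventually_elim simp
    then obtain d where d: "d > 0" "\<And>k. \<bar>k - k0\<bar> < d \<Longrightarrow> Q k \<and> 0 < k \<and> k < h \<and> Gt k w > 0"
      unfolding eventually_nhds_metric dist_real_def by blast
    define k where "k = k0 - d / 2"
    have k: "Q k \<and> 0 < k \<and> k < h \<and> Gt k w > 0" using d(1) by (intro d(2)) (simp add: k_def)
    have "(F k0)\<^sup>2 < (F k)\<^sup>2"
      using F_less[of k k0] k k0 d(1) F_pos[of k0] by (intro power_strict_mono) (auto simp: k_def)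
    then have "Gt k z\<^sub>1 < Gt k0 z\<^sub>1" using a_nz[OF G0] by (simp add: Gt_def)
    then show ?thesis using G0 k by (intro exI[of _ k]) (auto simp: mult_pos_neg)
  qed
  then obtain k where k: "Q k" "0 < k" "k < h" "Gt k w * Gt k z\<^sub>1 < 0" by blast
  have cont: "continuous_on {z\<^sub>1..w} (Gt k)"
    using \<rho> by (intro continuous_at_imp_continuous_on ballI Gt_z_cont) (auto simp: w_def)
  have "\<exists>z. z\<^sub>1 \<le> z \<and> z \<le> w \<and> Gt k z = 0"
  proof (cases "Gt k z\<^sub>1 \<le> 0")
    case True
    then have "Gt k w \<ge> 0" using k(4) by (metis less_le_not_le mult_nonpos_nonpos nle_le)
    then show ?thesis using IVT'[OF True _ _ cont] \<rho> by (auto simp: w_def)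
  next
    case False
    then have "Gt k w \<le> 0" using k(4) by (metis less_le_not_le mult_nonneg_nonneg nle_le)
    then show ?thesis using IVT2'[of "Gt k" w 0 z\<^sub>1] cont False \<rho> by (auto simp: w_def)
  qed
  then obtain z where z: "z\<^sub>1 \<le> z" "z \<le> w" "Gt k z = 0" by blast
  have "z \<noteq> z\<^sub>1" using z(3) k(4) by auto
  then have zz: "0 < \<bar>z - z\<^sub>1\<bar>" "\<bar>z - z\<^sub>1\<bar> \<le> \<rho>" "z > 0" using z w z1 \<rho> by (auto simp: w_def)
  then have "G k z = 0" using G_eq_Gt[of z k] z(3) \<rho> by simp
  then obtain i where i: "i \<in> J" "\<bar>E i k\<bar> = 1 / z" using zeros[OF k(2,3) zz(3)] by (auto simp: G_def)
  \<comment> \<open>This is what the displacement from \<open>z\<^sub>1\<close> achieves: flat bands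
    are excluded at \<open>z\<close>.\<close>
  have "\<alpha> z \<noteq> 0" using fac(1)[of z] r1(2)[of z] zz \<rho> by simp
  then have "\<not> (\<exists>c. \<forall>k. E i k = c)" using flat_imp_zero[OF i(1) _ i(2) zz(3)] k0 by auto
  then have "i \<in> e ` {n. enat n < N}" using bij_betw_imp_surj_on[OF enum] i(1) by blast
  then obtain n where n: "enat n < N" "e n = i" by blast
  have "\<zeta> n k = z" using n i zz by (simp add: \<zeta>_def)
  then show ?thesis using n(1) k(1) zz \<rho> by (intro exI[of _ k] exI[of _ n]) auto
qed


text \<open>A bounded increasing sequence of zeros of \<open>G k0\<close> would accumulate, against
  the isolation of zeros.\<close>

lemma \<zeta>_unbounded:
  assumes "N = \<infinity>"
  shows "\<exists>n. \<zeta> n k0 > z"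
proof (rule ccontr)
  assume "\<not> ?thesis"
  then have le: "\<zeta> n k0 \<le> z" for n by (simp add: not_less)
  have inc: "\<zeta> n k0 < \<zeta> (Suc n) k0" for n using \<zeta>_less[of "Suc n" n k0] k0 assms by simp
  then have "incseq (\<lambda>n. \<zeta> n k0)" by (intro incseq_SucI) (simp add: less_imp_le)
  then obtain L where L: "(\<lambda>n. \<zeta> n k0) \<longlonglongrightarrow> L" "\<forall>n. \<zeta> n k0 \<le> L" using incseq_convergent le by metis
  obtain \<rho> where \<rho>: "\<rho> > 0" "\<And>z. 0 < \<bar>z - L\<bar> \<Longrightarrow> \<bar>z - L\<bar> < \<rho> \<Longrightarrow> G k0 z \<noteq> 0"
    using isolated_zeros[OF k0, of L] unfolding G_def by auto
  obtain n where "\<bar>\<zeta> n k0 - L\<bar> < \<rho>" using LIMSEQ_D[OF L(1) \<rho>(1)] by auto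
  moreover have "\<zeta> n k0 < L" using inc[of n] L(2)[rule_format, of "Suc n"] by simp
  ultimately have "G k0 (\<zeta> n k0) \<noteq> 0" by (intro \<rho>(2)) auto
  then show False using G_\<zeta>[of n k0] k0 assms by simp
qed

text \<open>If no band passed through \<open>z\<^sub>1\<close> at \<open>k0\<close>, all would stay
  away from it for k near \<open>k0\<close>, against \<open>nearby_band\<close>. For finitely many
  bands this is continuity; the later ones lie above a band that already exceeds
  \<open>z\<^sub>1\<close>.\<close>

lemma band_through_zero:
  assumes G0: "Gt k0 z\<^sub>1 = 0"
  shows "\<exists>n. enat n < N \<and> \<zeta> n k0 = z\<^sub>1"
proof (rule ccontr)
  assume no: "\<not> ?thesis"
  \<comment> \<open>For finite \<open>N\<close> the index \<open>n0 = N\<close> leaves no later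
    bands; for infinite \<open>N\<close> the band \<open>n0\<close> is the barrier under the later
    ones.\<close>
  have "\<exists>n0. (N \<noteq> \<infinity> \<longrightarrow> enat n0 = N) \<and> (N = \<infinity> \<longrightarrow> \<zeta> n0 k0 > z\<^sub>1)"
    using \<zeta>_unbounded by (cases N) auto
  then obtain n0 where n0: "N \<noteq> \<infinity> \<Longrightarrow> enat n0 = N" "N = \<infinity> \<Longrightarrow> \<zeta> n0 k0 > z\<^sub>1" by blast
  define B where "B = {n. n \<le> n0 \<and> enat n < N}"
  have B: "finite B" unfolding B_def by simp
  define \<epsilon> where "\<epsilon> = Min (insert 1 ((\<lambda>n. \<bar>\<zeta> n k0 - z\<^sub>1\<bar> / 2) ` B))"
  have \<epsilon>: "\<epsilon> > 0" unfolding \<epsilon>_def using B no by (subst Min_gr_iff) (auto simp: B_def)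
  have \<epsilon>_le: "2 * \<epsilon> \<le> \<bar>\<zeta> n k0 - z\<^sub>1\<bar>" if "n \<in> B" for n
  proof -
    have "\<epsilon> \<le> \<bar>\<zeta> n k0 - z\<^sub>1\<bar> / 2" unfolding \<epsilon>_def using B that by (intro Min_le) auto
    then show ?thesis by simp
  qed
  have "eventually (\<lambda>k. \<forall>n\<in>B. \<bar>\<zeta> n k - \<zeta> n k0\<bar> < \<epsilon>) (nhds k0)"
  proof (intro eventually_ball_finite[OF B] ballI)
    fix n assume "n \<in> B"
    then have "(\<zeta> n \<longlongrightarrow> \<zeta> n k0) (nhds k0)"
      using \<zeta>_isCont[of n k0] unfolding isCont_def by (subst tendsto_at_iff_tendsto_nhds[symmetric]) (simp add: B_def)
    from tendstoD[OF this \<epsilon>] show "eventually (\<lambda>k. \<bar>\<zeta> n k - \<zeta> n k0\<bar> < \<epsilon>) (nhds k0)"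
      by (simp add: dist_real_def)
  qed
  with eventually_k have Q: "eventually (\<lambda>k. (0 < k \<and> k < h) \<and> (\<forall>n\<in>B. \<bar>\<zeta> n k - \<zeta> n k0\<bar> < \<epsilon>)) (nhds k0)"
    by eventually_elim simp
  obtain k n where k: "0 < k" "k < h" and near: "\<And>n. n \<in> B \<Longrightarrow> \<bar>\<zeta> n k - \<zeta> n k0\<bar> < \<epsilon>"
    and n: "enat n < N" "\<bar>\<zeta> n k - z\<^sub>1\<bar> < \<epsilon>"
    using nearby_band[OF G0 \<epsilon> Q] by blast
  show False
  proof (cases "n \<in> B")
    case True
    then show False using near[OF True] n(2) \<epsilon>_le[OF True] by linarith
  next
    case False
    then have "n0 < n" using n(1) by (simp add: B_def)
    then have inf: "N = \<infinity>" using n(1) n0(1) by (metis enat_ord_simps(2) less_asym)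
    then have n0B: "n0 \<in> B" by (simp add: B_def)
    have "\<zeta> n0 k < \<zeta> n k" using \<zeta>_less[OF n(1) \<open>n0 < n\<close>] k by simp
    moreover have "\<zeta> n0 k > \<zeta> n0 k0 - \<epsilon>" using near[OF n0B] by linarith
    moreover have "\<zeta> n0 k0 \<ge> z\<^sub>1 + 2 * \<epsilon>" using \<epsilon>_le[OF n0B] n0(2)[OF inf] by linarith
    ultimately show False using n(2) by linarith
  qed
qed

lemma eventually_near: "eventually (\<lambda>z. \<bar>z - z\<^sub>1\<bar> < r \<and> z \<noteq> z\<^sub>1) (at z\<^sub>1)"
  unfolding eventually_at using r by (intro exI[of _ r]) (auto simp: dist_real_def)

text \<open>The removed factor is a square, so common zeros of \<open>\<alpha>\<close> and
  \<open>\<beta>\<close> do not affect signs.\<close>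

lemma G_sgn: "\<bar>z - z\<^sub>1\<bar> < r \<Longrightarrow> z \<noteq> z\<^sub>1 \<Longrightarrow> \<sigma> * G k z > 0 \<longleftrightarrow> \<sigma> * Gt k z > 0" for \<sigma> :: real
  by (simp add: G_eq_Gt mult.left_commute[of \<sigma>] zero_less_mult_iff)

text \<open>\<open>G k0\<close> may still vanish at \<open>z\<^sub>1\<close>, on account of flat
  bands; hence the punctured neighbourhoods.\<close>

lemma no_sign_change:
  assumes "\<And>n. enat n < N \<Longrightarrow> \<zeta> n k0 \<noteq> z\<^sub>1"
  shows "eventually (\<lambda>z. G k0 z > 0) (at z\<^sub>1) \<or> eventually (\<lambda>z. - 1 * G k0 z > 0) (at z\<^sub>1)"
proof -
  have nz: "Gt k0 z\<^sub>1 \<noteq> 0" using band_through_zero assms by blast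
  have lim: "((\<lambda>z. Gt k0 z) \<longlongrightarrow> Gt k0 z\<^sub>1) (at z\<^sub>1)" using Gt_z_cont[of z\<^sub>1 k0] r by (simp add: isCont_def)
  show ?thesis
  proof (cases "Gt k0 z\<^sub>1 > 0")
    case True
    have "eventually (\<lambda>z. G k0 z > 0) (at z\<^sub>1)"
      using order_tendstoD(1)[OF lim True] eventually_near
      by eventually_elim (use G_sgn[of _ 1 k0] in auto)
    then show ?thesis by blast
  next
    case False
    then have "Gt k0 z\<^sub>1 < 0" using nz by simp
    have "eventually (\<lambda>z. - 1 * G k0 z > 0) (at z\<^sub>1)"
      using order_tendstoD(2)[OF lim \<open>Gt k0 z\<^sub>1 < 0\<close>] eventually_near
    proof eventually_elim
      case (elim z)
      then show ?case using G_sgn[of z "-1" k0] by simp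
    qed
    then show ?thesis by blast
  qed
qed

text \<open>By \<open>band_crossing\<close> the z-derivative of \<open>Gt\<close> and
  \<open>d\<close> have opposite signs, so \<open>G k0\<close> passes from the sign of
  \<open>d\<close> to its opposite.\<close>

lemma sign_change:
  assumes n: "enat n < N" "\<zeta> n k0 = z\<^sub>1" and d: "(\<zeta> n has_real_derivative d) (at k0)"
  obtains \<sigma> where "\<sigma> \<in> {1, - 1}" "\<sigma> * d > 0"
    "eventually (\<lambda>z. \<sigma> * G k0 z > 0) (at_left z\<^sub>1)" "eventually (\<lambda>z. - \<sigma> * G k0 z > 0) (at_right z\<^sub>1)"
proof -
  define P where "P = 2 * b z\<^sub>1 * b' z\<^sub>1 - 2 * a z\<^sub>1 * a' z\<^sub>1 * (F k0)\<^sup>2"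
  note G0 = band_crossing(1)[OF assms]
  have Pd: "P * d < 0" unfolding P_def by (rule band_crossing(2)[OF assms])
  define \<sigma> :: real where "\<sigma> = sgn d"
  have \<sigma>: "\<sigma> \<in> {1, - 1}" "\<sigma> * d > 0" "\<sigma> * P < 0"
    using Pd by (auto simp: \<sigma>_def sgn_real_def mult_less_0_iff split: if_splits)
  have der: "((\<lambda>z. - \<sigma> * Gt k0 z) has_real_derivative - \<sigma> * P) (at z\<^sub>1)"
    unfolding P_def by (intro DERIV_cmult Gt_z_deriv)
  have pos: "- \<sigma> * P > 0" using \<sigma>(3) by simp
  obtain d1 where d1: "d1 > 0" "\<And>x. 0 < x \<Longrightarrow> x < d1 \<Longrightarrow> - \<sigma> * Gt k0 (z\<^sub>1 + x) > 0"
    using DERIV_pos_inc_right[OF der pos] G0 by auto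
  obtain d2 where d2: "d2 > 0" "\<And>x. 0 < x \<Longrightarrow> x < d2 \<Longrightarrow> - \<sigma> * Gt k0 (z\<^sub>1 - x) < 0"
    using DERIV_pos_inc_left[OF der pos] G0 by auto
  have "eventually (\<lambda>z. z < z\<^sub>1 \<and> z\<^sub>1 - z < d2 \<and> z\<^sub>1 - z < r) (at_left z\<^sub>1)"
    unfolding eventually_at_left_field using d2(1) r by (intro exI[of _ "z\<^sub>1 - min d2 r"]) auto
  then have L: "eventually (\<lambda>z. \<sigma> * G k0 z > 0) (at_left z\<^sub>1)"
  proof eventually_elim
    case (elim z)
    then have "\<sigma> * Gt k0 z > 0" using d2(2)[of "z\<^sub>1 - z"] by simp
    then show ?case using elim G_sgn[of z \<sigma> k0] by simp
  qed
  have "eventually (\<lambda>z. z > z\<^sub>1 \<and> z - z\<^sub>1 < d1 \<and> z - z\<^sub>1 < r) (at_right z\<^sub>1)"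
    unfolding eventually_at_right_field using d1(1) r by (intro exI[of _ "z\<^sub>1 + min d1 r"]) auto
  then have R: "eventually (\<lambda>z. - \<sigma> * G k0 z > 0) (at_right z\<^sub>1)"
  proof eventually_elim
    case (elim z)
    then have "- \<sigma> * Gt k0 z > 0" using d1(2)[of "z - z\<^sub>1"] by simp
    then show ?case using elim G_sgn[of z "- \<sigma>" k0] by simp
  qed
  show ?thesis using that[OF \<sigma>(1,2) L R] .
qed

end

section \<open>Propagation of the sign along the axis\<close>

lemma no_sign_change':
  assumes "z > 0" "\<And>n. enat n < N \<Longrightarrow> \<zeta> n k0 \<noteq> z"
  shows "eventually (\<lambda>z. G k0 z > 0) (at z) \<or> eventually (\<lambda>z. - 1 * G k0 z > 0) (at z)"
  using factor[of z] no_sign_change[OF assms(1) _ _ _ _ _ _ assms(2)] by metis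

lemma sign_change':
  assumes n: "enat n < N" and d: "(\<zeta> n has_real_derivative d) (at k0)"
  shows "\<exists>\<sigma>\<in>{1, - 1}. \<sigma> * d > 0 \<and> eventually (\<lambda>z. \<sigma> * G k0 z > 0) (at_left (\<zeta> n k0)) \<and>
    eventually (\<lambda>z. - \<sigma> * G k0 z > 0) (at_right (\<zeta> n k0))"
proof -
  obtain m a b a' b' r where *: "r > 0" "a (\<zeta> n k0) \<noteq> 0 \<or> b (\<zeta> n k0) \<noteq> 0"
    "\<And>z. \<bar>z - \<zeta> n k0\<bar> < r \<Longrightarrow> \<alpha> z = (z - \<zeta> n k0) ^ m * a z"
    "\<And>z. \<bar>z - \<zeta> n k0\<bar> < r \<Longrightarrow> \<beta> z = (z - \<zeta> n k0) ^ m * b z"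
    "\<And>z. \<bar>z - \<zeta> n k0\<bar> < r \<Longrightarrow> (a has_real_derivative a' z) (at z)"
    "\<And>z. \<bar>z - \<zeta> n k0\<bar> < r \<Longrightarrow> (b has_real_derivative b' z) (at z)"
    using factor[of "\<zeta> n k0"] by metis
  obtain \<sigma> where "\<sigma> \<in> {1, - 1::real}" "\<sigma> * d > 0" "eventually (\<lambda>z. \<sigma> * G k0 z > 0) (at_left (\<zeta> n k0))"
    "eventually (\<lambda>z. - \<sigma> * G k0 z > 0) (at_right (\<zeta> n k0))"
    using sign_change[OF \<zeta>_pos[OF n] * n refl d] .
  then show ?thesis by (intro bexI[of _ \<sigma>] conjI)
qed

text \<open>Isolated zeros inside the interval are possible, so the sign is read off punctured
  neighbourhoods. The points around which it is \<open>\<sigma>\<close>, and those around which it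
  is \<open>\<tau>\<close>, are two open sets covering a connected interval; if
  \<open>\<sigma> \<noteq> \<tau>\<close> they would be disjoint and both non-empty.\<close>

lemma sign_transfer:
  assumes xy: "0 \<le> x" "x < y" and no: "\<And>n. enat n < N \<Longrightarrow> \<zeta> n k0 \<notin> {x<..<y}"
    and \<sigma>: "\<sigma> \<in> {1, - 1}" "\<tau> \<in> {1, - 1}"
    and R: "eventually (\<lambda>z. \<sigma> * G k0 z > 0) (at_right x)" and L: "eventually (\<lambda>z. \<tau> * G k0 z > 0) (at_left y)"
  shows "\<sigma> = \<tau>"
proof (rule ccontr)
  assume ne: "\<sigma> \<noteq> \<tau>"
  define U where "U = (\<lambda>s::real. {z \<in> {x<..<y}. eventually (\<lambda>z. s * G k0 z > 0) (at z)})"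
  have op: "open (U s)" for s
  proof (rule Topological_Spaces.openI)
    fix z assume z: "z \<in> U s"
    have "eventually (\<lambda>z. s * G k0 z > 0) (at z)" using z by (simp add: U_def)
    then obtain S where S: "open S" "z \<in> S" "\<And>w. w \<in> S \<Longrightarrow> w \<noteq> z \<Longrightarrow> s * G k0 w > 0"
      unfolding eventually_at_topological by blast
    have "w \<in> U s" if "w \<in> S \<inter> {x<..<y}" for w
    proof (cases "w = z")
      case True
      then show ?thesis using z by simp
    next
      case False
      have "eventually (\<lambda>v. v \<in> S - {z}) (at w)"
        using that False S(1) by (intro eventually_at_in_open') auto
      then have "eventually (\<lambda>v. s * G k0 v > 0) (at w)"
        by eventually_elim (use S(3) in auto)
      then show ?thesis using that by (simp add: U_def)
    qed
    then show "\<exists>T. open T \<and> z \<in> T \<and> T \<subseteq> U s"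
      using S(1,2) z by (intro exI[of _ "S \<inter> {x<..<y}"]) (auto simp: U_def)
  qed
  have cover: "{x<..<y} \<subseteq> U \<sigma> \<union> U \<tau>"
  proof
    fix z assume z: "z \<in> {x<..<y}"
    then have "z > 0" using xy by simp
    moreover have "\<And>n. enat n < N \<Longrightarrow> \<zeta> n k0 \<noteq> z" using no z by blast
    ultimately show "z \<in> U \<sigma> \<union> U \<tau>"
      using no_sign_change'[of z] z \<sigma> ne by (auto simp: U_def)
  qed
  have disj: "U \<sigma> \<inter> U \<tau> \<inter> {x<..<y} = {}"
  proof (rule ccontr)
    assume "\<not> ?thesis"
    then obtain z where "eventually (\<lambda>z. \<sigma> * G k0 z > 0) (at z)" "eventually (\<lambda>z. \<tau> * G k0 z > 0) (at z)"
      by (auto simp: U_def)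
    then have "eventually (\<lambda>z. \<sigma> * G k0 z > 0 \<and> \<tau> * G k0 z > 0) (at z)" by (rule eventually_conj)
    then obtain w where "\<sigma> * G k0 w > 0 \<and> \<tau> * G k0 w > 0"
      using eventually_happens trivial_limit_at by blast
    then show False using \<sigma> ne by auto
  qed
  have near: "\<exists>w\<in>{x<..<y}. w \<in> U s" if w: "w \<in> {x<..<y}" "s * G k0 w > 0" for s w
  proof -
    have "isCont (\<lambda>z. s * G k0 z) w"
      unfolding G_def using cont by (intro continuous_intros) (auto simp: continuous_on_eq_continuous_at)
    then have "((\<lambda>z. s * G k0 z) \<longlongrightarrow> s * G k0 w) (at w)" by (simp add: isCont_def)
    then have "eventually (\<lambda>z. s * G k0 z > 0) (at w)" using w(2) order_tendstoD(1) by blast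
    then show ?thesis using w by (auto simp: U_def)
  qed
  have "eventually (\<lambda>z. z \<in> {x<..<y}) (at_right x)"
    using eventually_at_right_real[OF xy(2)] by simp
  with R have "eventually (\<lambda>z. \<sigma> * G k0 z > 0 \<and> z \<in> {x<..<y}) (at_right x)" by eventually_elim simp
  then obtain w where "\<sigma> * G k0 w > 0" "w \<in> {x<..<y}" using eventually_happens by force
  then have 1: "U \<sigma> \<inter> {x<..<y} \<noteq> {}" using near by blast
  have "eventually (\<lambda>z. z \<in> {x<..<y}) (at_left y)"
    using eventually_at_left_real[OF xy(2)] by simp
  with L have "eventually (\<lambda>z. \<tau> * G k0 z > 0 \<and> z \<in> {x<..<y}) (at_left y)" by eventually_elim simp
  then obtain w where "\<tau> * G k0 w > 0" "w \<in> {x<..<y}" using eventually_happens by force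
  then have 2: "U \<tau> \<inter> {x<..<y} \<noteq> {}" using near by blast
  show False
    using connectedD[of "{x<..<y}" "U \<sigma>" "U \<tau>"] op cover disj 1 2 by auto
qed

text \<open>The sign is positive near 0, is carried across each gap by \<open>sign_transfer\<close>,
  and is reversed at each band.\<close>

lemma sign_at_left:
  assumes "enat n < N"
  shows "eventually (\<lambda>z. (- 1) ^ n * G k0 z > 0) (at_left (\<zeta> n k0))"
  using assms
proof (induction n)
  case 0
  obtain d where d: "(\<zeta> 0 has_real_derivative d) (at k0)" using \<zeta>_deriv 0 by blast
  obtain \<tau> where \<tau>: "\<tau> \<in> {1, - 1::real}" "eventually (\<lambda>z. \<tau> * G k0 z > 0) (at_left (\<zeta> 0 k0))"
    using sign_change'[OF 0 d] by blast
  have "isCont (G k0) 0"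
    unfolding G_def using cont by (intro continuous_intros) (auto simp: continuous_on_eq_continuous_at)
  then have lim: "(G k0 \<longlongrightarrow> 1) (at 0)" using at0 by (simp add: isCont_def G_def)
  have "eventually (\<lambda>z. G k0 z > 0) (at 0)" using order_tendstoD(1)[OF lim, of 0] by simp
  then have R: "eventually (\<lambda>z. 1 * G k0 z > 0) (at_right 0)" by (simp add: eventually_at_split)
  have "\<zeta> n k0 \<notin> {0<..<\<zeta> 0 k0}" if "enat n < N" for n
    using \<zeta>_less[of n 0 k0] k0 that by (cases n) auto
  from sign_transfer[OF order_refl \<zeta>_pos[OF 0] this _ \<tau>(1) R \<tau>(2)] have "\<tau> = 1" by simp
  then show ?case using \<tau>(2) by simp
next
  case (Suc n)
  then have n: "enat n < N" using enat_less_mono[OF Suc.prems, of n] by simp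
  obtain d where d: "(\<zeta> n has_real_derivative d) (at k0)" using \<zeta>_deriv n by blast
  obtain d' where d': "(\<zeta> (Suc n) has_real_derivative d') (at k0)" using \<zeta>_deriv Suc.prems by blast
  obtain \<sigma> where \<sigma>: "\<sigma> \<in> {1, - 1::real}" "eventually (\<lambda>z. \<sigma> * G k0 z > 0) (at_left (\<zeta> n k0))"
    "eventually (\<lambda>z. - \<sigma> * G k0 z > 0) (at_right (\<zeta> n k0))"
    using sign_change'[OF n d] by blast
  obtain \<tau> where \<tau>: "\<tau> \<in> {1, - 1::real}" "eventually (\<lambda>z. \<tau> * G k0 z > 0) (at_left (\<zeta> (Suc n) k0))"
    using sign_change'[OF Suc.prems d'] by blast
  \<comment> \<open>Two eventual signs on the same side hold at a common point and therefore
    agree.\<close>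
  have "eventually (\<lambda>z. (- 1) ^ n * G k0 z > 0 \<and> \<sigma> * G k0 z > 0) (at_left (\<zeta> n k0))"
    using Suc.IH[OF n] \<sigma>(2) by eventually_elim simp
  then obtain w where "(- 1) ^ n * G k0 w > 0 \<and> \<sigma> * G k0 w > 0" using eventually_happens by force
  then have s: "\<sigma> = (- 1) ^ n" using \<sigma>(1) by (cases "even n") auto
  have no: "\<zeta> l k0 \<notin> {\<zeta> n k0<..<\<zeta> (Suc n) k0}" if "enat l < N" for l
  proof -
    consider "l < n" | "l = n" | "l = Suc n" | "Suc n < l" by linarith
    then show ?thesis
      by cases (use \<zeta>_less[of l "Suc n" k0] \<zeta>_less[of n l k0] k0 that n in auto)
  qed
  have "- \<sigma> = \<tau>"
    by (rule sign_transfer[OF _ _ no _ \<tau>(1) \<sigma>(3) \<tau>(2)])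
       (use \<sigma>(1) \<zeta>_pos[OF n] \<zeta>_less[OF Suc.prems, of n k0] k0 in \<open>auto intro: less_imp_le\<close>)
  then show ?case using \<tau>(2) s by simp
qed

text \<open>The sign of \<open>G k0\<close> to the left of the band is (-1)^n by counting and the
  sign of the slope of \<open>\<zeta> n\<close> by the local analysis. Taking reciprocals reverses
  the slope.\<close>

lemma alternating:
  assumes n: "enat n < N"
  shows "\<exists>d. ((\<lambda>x. \<bar>E (e n) x\<bar>) has_real_derivative d) (at k0) \<and> (- 1) ^ (n + 1) * d > 0"
proof -
  obtain d where d: "(\<zeta> n has_real_derivative d) (at k0)" using \<zeta>_deriv n by blast
  obtain \<sigma> where \<sigma>: "\<sigma> \<in> {1, - 1::real}" "\<sigma> * d > 0" "eventually (\<lambda>z. \<sigma> * G k0 z > 0) (at_left (\<zeta> n k0))"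
    using sign_change'[OF n d] by blast
  have "eventually (\<lambda>z. (- 1) ^ n * G k0 z > 0 \<and> \<sigma> * G k0 z > 0) (at_left (\<zeta> n k0))"
    using sign_at_left[OF n] \<sigma>(3) by eventually_elim simp
  then obtain w where "(- 1) ^ n * G k0 w > 0 \<and> \<sigma> * G k0 w > 0" using eventually_happens by force
  then have s: "\<sigma> = (- 1) ^ n" using \<sigma>(1) by (cases "even n") auto
  have pos: "\<zeta> n k0 > 0" by (rule \<zeta>_pos[OF n])
  have "((\<lambda>x. 1 / \<zeta> n x) has_real_derivative - d / (\<zeta> n k0)\<^sup>2) (at k0)"
    using pos by (auto intro!: derivative_eq_intros d simp: power2_eq_square)
  moreover have "(\<lambda>x. 1 / \<zeta> n x) = (\<lambda>x. \<bar>E (e n) x\<bar>)" by (simp add: \<zeta>_def)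
  moreover have "(- 1) ^ (n + 1) * (- d / (\<zeta> n k0)\<^sup>2) > 0"
    using \<sigma>(2) s pos by simp
  ultimately show ?thesis by metis
qed

end

end

section \<open>The matrices of a periodic Hankel operator\<close>

text \<open>A permutation meets each row and each column of \<open>S\<close> once.\<close>

lemma principal_minor_scale:
  assumes "finite S"
  shows "principal_minor (\<lambda>i j. c i * d j * A i j) S = (\<Prod>i\<in>S. c i * d i) * principal_minor A S"
proof -
  have "(\<Prod>i\<in>S. c i * d (\<sigma> i) * A i (\<sigma> i)) = (\<Prod>i\<in>S. c i * d i) * (\<Prod>i\<in>S. A i (\<sigma> i))"
    if "\<sigma> permutes S" for \<sigma>
    using prod.permute[OF that, of d] by (simp add: prod.distrib o_def)
  then show ?thesis
    by (simp add: principal_minor_def sum_distrib_left mult_ac)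
qed

text \<open>Conjugation transposes the matrix, and replacing each permutation by its inverse
  transposes it back.\<close>

lemma principal_minor_hermitian_real:
  assumes S: "finite S" and herm: "\<And>i j. cnj (A i j) = A j i"
  shows "principal_minor A S = of_real (Re (principal_minor A S))"
proof -
  have "cnj (principal_minor A S) = (\<Sum>\<sigma> | \<sigma> permutes S. of_int (sign \<sigma>) * (\<Prod>i\<in>S. A (\<sigma> i) i))"
    by (simp add: principal_minor_def cnj_sum cnj_prod herm)
  also have "\<dots> = (\<Sum>\<sigma> | \<sigma> permutes S. of_int (sign (inv_into UNIV \<sigma>)) * (\<Prod>i\<in>S. A (inv_into UNIV \<sigma> i) i))"
    by (rule sum_permutations_inverse)
  also have "\<dots> = principal_minor A S"
    unfolding principal_minor_def
  proof (rule sum.cong[OF refl], clarify)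
    fix \<sigma> assume \<sigma>: "\<sigma> permutes S"
    have "(\<Prod>i\<in>S. A (inv_into UNIV \<sigma> i) i) = (\<Prod>i\<in>S. A (inv_into UNIV \<sigma> (\<sigma> i)) (\<sigma> i))"
      using prod.permute[OF \<sigma>, of "\<lambda>i. A (inv_into UNIV \<sigma> i) i"] by (simp add: o_def)
    also have "\<dots> = (\<Prod>i\<in>S. A i (\<sigma> i))" using permutes_inverses(2)[OF \<sigma>] by simp
    finally show "of_int (sign (inv_into UNIV \<sigma>)) * (\<Prod>i\<in>S. A (inv_into UNIV \<sigma> i) i) = of_int (sign \<sigma>) * (\<Prod>i\<in>S. A i (\<sigma> i))"
      using sign_inverse[OF permutes_imp_permutation[OF S \<sigma>]] by simp
  qed
  finally show ?thesis by (simp add: complex_eq_iff)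
qed

section \<open>Gamma factors and absolute summability of the entries\<close>

lemma of_real_cosh: "cosh (of_real x :: complex) = of_real (cosh x)"
  and of_real_sinh: "sinh (of_real x :: complex) = of_real (sinh x)"
  by (simp_all add: cosh_def sinh_def scaleR_conv_of_real flip: exp_of_real of_real_minus)

lemma Gamma_half_reflection:
  "Gamma (1/2 - \<i> * of_real y) * Gamma (1/2 + \<i> * of_real y) = of_real (pi / cosh (pi * y))"
proof -
  have "sin (of_real pi * (1/2 - \<i> * of_real y)) = of_real (cosh (pi * y))"
    using cosh_conv_cos[of "of_real (pi * y)", unfolded of_real_cosh]
      sin_cos_eq[of "of_real pi * (1/2 - \<i> * of_real y)"] by (simp add: algebra_simps)
  moreover have "1 - (1/2 - \<i> * of_real y) = 1/2 + \<i> * of_real y" by simp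
  ultimately show ?thesis
    using Gamma_reflection_complex[of "1/2 - \<i> * of_real y"] by simp
qed

lemma norm_Gamma_half: "(cmod (Gamma (1/2 + \<i> * of_real y)))\<^sup>2 = pi / cosh (pi * y)"
proof -
  have "of_real ((cmod (Gamma (1/2 + \<i> * of_real y)))\<^sup>2) = (of_real (pi / cosh (pi * y)) :: complex)"
    unfolding Gamma_half_reflection[symmetric] complex_norm_square by (simp add: cnj_Gamma mult.commute)
  then show ?thesis by (simp only: of_real_eq_iff)
qed

lemma norm_Gamma_one:
  assumes "y \<noteq> 0"
  shows "(cmod (Gamma (1 - \<i> * of_real y)))\<^sup>2 = pi * y / sinh (pi * y)"
proof -
  have nz: "\<i> * of_real y \<notin> \<int>\<^sub>\<le>\<^sub>0"
    using assms by (auto elim!: nonpos_Ints_cases simp: complex_eq_iff)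
  have "Gamma (1 + \<i> * of_real y) = \<i> * of_real y * Gamma (\<i> * of_real y)"
    using Gamma_plus1[OF nz] by (simp add: add.commute)
  then have "Gamma (1 + \<i> * of_real y) * Gamma (1 - \<i> * of_real y) = \<i> * of_real y * (of_real pi / sin (of_real pi * (\<i> * of_real y)))"
    unfolding Gamma_reflection_complex[of "\<i> * of_real y", symmetric] by simp
  also have "sin (of_real pi * (\<i> * of_real y)) = \<i> * of_real (sinh (pi * y))"
    using sinh_conv_sin[of "of_real (pi * y)", unfolded of_real_sinh] by (simp add: mult_ac)
  also have "\<i> * of_real y * (of_real pi / (\<i> * of_real (sinh (pi * y)))) = (of_real (pi * y / sinh (pi * y)) :: complex)"
    by simp
  finally have "of_real ((cmod (Gamma (1 - \<i> * of_real y)))\<^sup>2) = (of_real (pi * y / sinh (pi * y)) :: complex)"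
    unfolding complex_norm_square by (simp add: cnj_Gamma mult.commute)
  then show ?thesis by (simp only: of_real_eq_iff)
qed

text \<open>The matrix Q of the overview. In the Beta function \<open>k\<close> cancels from z1 +
  z2, and the denominator depends on n - m only.\<close>

definition toeplitz_symbol :: "real \<Rightarrow> (real \<Rightarrow> real) \<Rightarrow> int \<Rightarrow> int \<Rightarrow> complex" where
  "toeplitz_symbol T p n m = fourier_coeff T p (n - m) / Gamma (1 - \<i> * of_real (freq T * of_int (n - m)))"

lemma Hk_factor:
  "Hk T p k n m = Gamma (1/2 - \<i> * of_real (freq T * of_int n + k)) *
     Gamma (1/2 + \<i> * of_real (freq T * of_int m + k)) * toeplitz_symbol T p n m"
proof -
  have 1: "1/2 - \<i> * of_real (freq T) * of_int n - \<i> * of_real k = 1/2 - \<i> * of_real (freq T * of_int n + k)"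
    and 2: "1/2 + \<i> * of_real (freq T) * of_int m + \<i> * of_real k = 1/2 + \<i> * of_real (freq T * of_int m + k)"
    and 3: "(1/2 - \<i> * of_real (freq T * of_int n + k)) + (1/2 + \<i> * of_real (freq T * of_int m + k))
       = 1 - \<i> * of_real (freq T * of_int (n - m))"
    by (simp_all add: algebra_simps)
  show ?thesis unfolding Hk_def Beta_c_def toeplitz_symbol_def 1 2 3 by simp
qed

lemma fourier_coeff_cnj: "cnj (fourier_coeff T p l) = fourier_coeff T p (- l)"
  by (simp add: fourier_coeff_def integral_cnj exp_cnj)

lemma toeplitz_symbol_cnj: "cnj (toeplitz_symbol T p n m) = toeplitz_symbol T p m n"
  by (simp add: toeplitz_symbol_def fourier_coeff_cnj cnj_Gamma algebra_simps)

lemma principal_minor_Hk: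
  assumes "finite S"
  shows "principal_minor (Hk T p k) S
    = of_real (Re (principal_minor (toeplitz_symbol T p) S) * pi ^ card S * (\<Prod>n\<in>S. sech_lat (freq T) k n))"
proof -
  have "principal_minor (Hk T p k) S = (\<Prod>n\<in>S. of_real (pi * sech_lat (freq T) k n)) * principal_minor (toeplitz_symbol T p) S"
    unfolding Hk_factor[abs_def] principal_minor_scale[OF assms] Gamma_half_reflection
    by (simp add: sech_lat_def)
  also have "principal_minor (toeplitz_symbol T p) S = of_real (Re (principal_minor (toeplitz_symbol T p) S))"
    by (rule principal_minor_hermitian_real[OF assms toeplitz_symbol_cnj])
  finally show ?thesis by (simp add: prod.distrib mult_ac)
qed

lemma principal_minor_toeplitz_shift:
  assumes "finite S"
  shows "principal_minor (toeplitz_symbol T p) ((\<lambda>n. n + j) ` S) = principal_minor (toeplitz_symbol T p) S"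
proof -
  have "toeplitz_symbol T p (n + j) (m + j) = toeplitz_symbol T p n m" for n m
    by (simp add: toeplitz_symbol_def)
  then show ?thesis by (subst principal_minor_reindex[OF assms]) simp_all
qed

text \<open>These square roots are the n-dependence of the entries on the l-th diagonal. One step is
  bounded by the arithmetic mean of two neighbouring secants; for |l| steps the square root is
  subadditive. The growth |l|, divided by the factor sqrt |l| in \<open>norm_Hk_offdiag\<close>,
  leaves the weight sqrt |l| of the hypothesis on the symbol.\<close>

lemma sqrt_tanh_diff_sum:
  fixes k :: real
  assumes \<omega>: "\<omega> > 0"
  defines "t \<equiv> \<lambda>n::int. tanh (pi * (\<omega> * of_int n + k))"
  shows "\<exists>K\<ge>0. \<forall>l. (\<lambda>n. sqrt \<bar>t n - t (n - l)\<bar>) summable_on UNIV \<and>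
    (\<Sum>\<^sub>\<infinity>n. sqrt \<bar>t n - t (n - l)\<bar>) \<le> \<bar>of_int l\<bar> * K"
proof -
  have shift: "bij_betw (\<lambda>n::int. n + j) UNIV UNIV" for j
    by (rule bij_betw_byWitness[where f' = "\<lambda>n. n - j"]) auto
  have t_mono: "t n \<le> t m" if "n \<le> m" for n m
    using that \<omega> by (simp add: t_def)
  define u where "u = (\<lambda>j n. sqrt (t (n + int j) - t n))"
  have u0: "u j n \<ge> 0" for j n using t_mono by (simp add: u_def)
  have u1: "u 1 summable_on UNIV"
  proof (rule summable_on_comparison_test)
    have "sech_lat \<omega> k summable_on UNIV" by (rule summable_on_sech_lat[OF \<omega>])
    moreover from this have "(\<lambda>n. sech_lat \<omega> k (n + 1)) summable_on UNIV"
      using summable_on_reindex_bij_betw[OF shift] by blast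
    ultimately show "(\<lambda>n. sqrt (sinh (pi * \<omega>)) / 2 * (sech_lat \<omega> k n + sech_lat \<omega> k (n + 1))) summable_on UNIV"
      by (intro summable_on_cmult_right summable_on_add)
    fix n :: int
    have "t (n + 1) - t n = sinh (pi * \<omega>) * (sech_lat \<omega> k n * sech_lat \<omega> k (n + 1))"
      unfolding t_def tanh_diff_eq sech_lat_def by (simp add: algebra_simps)
    then have "u 1 n = sqrt (sinh (pi * \<omega>)) * sqrt (sech_lat \<omega> k n * sech_lat \<omega> k (n + 1))"
      by (simp add: u_def real_sqrt_mult)
    also have "\<dots> \<le> sqrt (sinh (pi * \<omega>)) * ((sech_lat \<omega> k n + sech_lat \<omega> k (n + 1)) / 2)"
      using \<omega> less_imp_le[OF sech_lat_pos] by (intro mult_left_mono arith_geo_mean_sqrt) auto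
    finally show "u 1 n \<le> sqrt (sinh (pi * \<omega>)) / 2 * (sech_lat \<omega> k n + sech_lat \<omega> k (n + 1))" by simp
  qed (rule u0)
  define K where "K = (\<Sum>\<^sub>\<infinity>n. u 1 n)"
  have K: "K \<ge> 0" unfolding K_def by (rule infsum_nonneg) (rule u0)
  have uj: "u j summable_on UNIV \<and> (\<Sum>\<^sub>\<infinity>n. u j n) \<le> real j * K" for j
  proof (induction j)
    case 0
    show ?case by (simp add: u_def[abs_def])
  next
    case (Suc j)
    have le: "u (Suc j) n \<le> u j n + u 1 (n + int j)" for n
    proof -
      have "t (n + int (Suc j)) - t n = (t (n + int j) - t n) + (t (n + int j + 1) - t (n + int j))"
        by (simp add: algebra_simps)
      then show ?thesis
        unfolding u_def using sqrt_add_le_add_sqrt[of "t (n + int j) - t n" "t (n + int j + 1) - t (n + int j)"] t_mono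
        by (simp add: algebra_simps)
    qed
    have s1: "(\<lambda>n. u 1 (n + int j)) summable_on UNIV"
      using u1 summable_on_reindex_bij_betw[OF shift] by blast
    have i1: "(\<Sum>\<^sub>\<infinity>n. u 1 (n + int j)) = K"
      unfolding K_def by (rule infsum_reindex_bij_betw[OF shift])
    have s2: "(\<lambda>n. u j n + u 1 (n + int j)) summable_on UNIV"
      using Suc s1 by (intro summable_on_add) auto
    have s3: "u (Suc j) summable_on UNIV"
      by (rule summable_on_comparison_test[OF s2]) (use le u0 in auto)
    have "(\<Sum>\<^sub>\<infinity>n. u (Suc j) n) \<le> (\<Sum>\<^sub>\<infinity>n. u j n + u 1 (n + int j))"
      by (rule infsum_mono[OF s3 s2]) (rule le)
    also have "\<dots> = (\<Sum>\<^sub>\<infinity>n. u j n) + K"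
      using Suc s1 i1 by (subst infsum_add) auto
    also have "\<dots> \<le> real (Suc j) * K" using Suc by (simp add: algebra_simps)
    finally show ?case using s3 by blast
  qed
  have "(\<lambda>n. sqrt \<bar>t n - t (n - l)\<bar>) summable_on UNIV \<and> (\<Sum>\<^sub>\<infinity>n. sqrt \<bar>t n - t (n - l)\<bar>) \<le> \<bar>of_int l\<bar> * K" for l
  proof (cases "l \<ge> 0")
    case True
    have "u (nat l) (n + (- l)) = sqrt \<bar>t n - t (n - l)\<bar>" for n
      using True t_mono[of "n - l" n] by (simp add: u_def)
    then show ?thesis
      using uj[of "nat l"] True summable_on_reindex_bij_betw[OF shift[of "- l"], of "u (nat l)"]
        infsum_reindex_bij_betw[OF shift[of "- l"], of "u (nat l)"] by simp
  next
    case False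
    have "u (nat (- l)) n = sqrt \<bar>t n - t (n - l)\<bar>" for n
      using False t_mono[of n "n - l"] by (simp add: u_def abs_if)
    then have "u (nat (- l)) = (\<lambda>n. sqrt \<bar>t n - t (n - l)\<bar>)" by auto
    then show ?thesis using uj[of "nat (- l)"] False by simp
  qed
  then show ?thesis using K by blast
qed

text \<open>The factor \<open>sinh\<close> from the modulus of Gamma(1 - iy) combines with the two
  \<open>cosh\<close> into a difference of tanh.\<close>

lemma norm_Hk_offdiag:
  assumes \<omega>: "freq T > 0" and l: "l \<noteq> 0"
  shows "cmod (Hk T p k n (n - l)) = cmod (fourier_coeff T p l) * (pi / sqrt (pi * freq T * \<bar>of_int l\<bar>)) *
    sqrt \<bar>tanh (pi * (freq T * of_int n + k)) - tanh (pi * (freq T * of_int (n - l) + k))\<bar>"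
proof -
  let ?x = "freq T * of_int n + k" and ?y = "freq T * of_int (n - l) + k"
  have L: "freq T * of_int l \<noteq> 0" using \<omega> l by simp
  have "(cmod (Gamma (1/2 - \<i> * of_real ?x)))\<^sup>2 = pi / cosh (pi * ?x)"
    using norm_Gamma_half[of "- ?x"] cosh_minus[of "pi * ?x"] by (simp only: of_real_minus mult_minus_right diff_conv_add_uminus)
  moreover have "(cmod (Gamma (1/2 + \<i> * of_real ?y)))\<^sup>2 = pi / cosh (pi * ?y)"
    by (rule norm_Gamma_half)
  moreover have "(cmod (Gamma (1 - \<i> * of_real (freq T * of_int l))))\<^sup>2 = pi * (freq T * of_int l) / sinh (pi * (freq T * of_int l))"
    by (rule norm_Gamma_one[OF L])
  ultimately have sq: "(cmod (Hk T p k n (n - l)))\<^sup>2 = pi / cosh (pi * ?x) * (pi / cosh (pi * ?y)) *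
      ((cmod (fourier_coeff T p l))\<^sup>2 / (pi * (freq T * of_int l) / sinh (pi * (freq T * of_int l))))"
    unfolding Hk_factor toeplitz_symbol_def by (simp add: norm_mult norm_divide power_mult_distrib power_divide)
  have "tanh (pi * ?x) - tanh (pi * ?y) = sinh (pi * (freq T * of_int l)) / (cosh (pi * ?x) * cosh (pi * ?y))"
    unfolding tanh_diff_eq by (simp add: algebra_simps)
  then have "(cmod (Hk T p k n (n - l)))\<^sup>2 = (cmod (fourier_coeff T p l))\<^sup>2 * (pi\<^sup>2 / (pi * freq T * of_int l)) * (tanh (pi * ?x) - tanh (pi * ?y))"
    unfolding sq using l \<omega> by (simp add: field_simps power2_eq_square)
  also have "\<dots> = (cmod (fourier_coeff T p l))\<^sup>2 * (pi\<^sup>2 / (pi * freq T * \<bar>of_int l\<bar>)) * \<bar>tanh (pi * ?x) - tanh (pi * ?y)\<bar>"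
  proof (cases "l > 0")
    case True
    then have "tanh (pi * ?y) \<le> tanh (pi * ?x)" using \<omega> by simp
    then show ?thesis using True by simp
  next
    case False
    then have "tanh (pi * ?x) \<le> tanh (pi * ?y)" using \<omega> by (simp add: mult_nonneg_nonpos)
    then have "\<bar>tanh (pi * ?x) - tanh (pi * ?y)\<bar> = - (tanh (pi * ?x) - tanh (pi * ?y))" by linarith
    moreover have "\<bar>real_of_int l\<bar> = - of_int l" using False by simp
    ultimately show ?thesis by (simp only:)
  qed
  finally have eq: "(cmod (Hk T p k n (n - l)))\<^sup>2 = (cmod (fourier_coeff T p l))\<^sup>2 * (pi\<^sup>2 / (pi * freq T * \<bar>of_int l\<bar>)) * \<bar>tanh (pi * ?x) - tanh (pi * ?y)\<bar>" .
  have "cmod (Hk T p k n (n - l)) = sqrt ((cmod (Hk T p k n (n - l)))\<^sup>2)" by simp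
  also have "\<dots> = cmod (fourier_coeff T p l) * (pi / sqrt (pi * freq T * \<bar>of_int l\<bar>)) * sqrt \<bar>tanh (pi * ?x) - tanh (pi * ?y)\<bar>"
    unfolding eq by (simp add: real_sqrt_mult real_sqrt_divide)
  finally show ?thesis .
qed

lemma norm_Hk_diag: "cmod (Hk T p k n n) = cmod (fourier_coeff T p 0) * pi * sech_lat (freq T) k n"
proof -
  have "Hk T p k n n = of_real (pi * sech_lat (freq T) k n) * fourier_coeff T p 0"
    unfolding Hk_factor Gamma_half_reflection by (simp add: toeplitz_symbol_def sech_lat_def)
  then show ?thesis using less_imp_le[OF sech_lat_pos] by (simp add: norm_mult abs_mult)
qed

text \<open>The entries are summed along diagonals n - m = l, where the Fourier coefficient is a
  constant factor.\<close>

lemma Hk_abs_summable: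
  assumes "smooth_periodic_symbol T p"
  shows "(\<lambda>x. cmod (case x of (n, m) \<Rightarrow> Hk T p k n m)) summable_on UNIV"
proof -
  have T: "T > 0" and pf: "(\<lambda>l::int. cmod (fourier_coeff T p l) * (1 + (real_of_int l)\<^sup>2) powr (1/4)) summable_on UNIV"
    using assms unfolding smooth_periodic_symbol_def by auto
  define \<omega> where "\<omega> = freq T"
  have \<omega>: "\<omega> > 0" using T by (simp add: \<omega>_def freq_def)
  define t where "t = (\<lambda>n::int. tanh (pi * (\<omega> * of_int n + k)))"
  obtain K where K: "K \<ge> 0" "\<And>l. (\<lambda>n. sqrt \<bar>t n - t (n - l)\<bar>) summable_on UNIV"
    "\<And>l. (\<Sum>\<^sub>\<infinity>n. sqrt \<bar>t n - t (n - l)\<bar>) \<le> \<bar>of_int l\<bar> * K"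
    using sqrt_tanh_diff_sum[OF \<omega>, of k] unfolding t_def by blast
  \<comment> \<open>The first summand serves the main diagonal, the second all the others.\<close>
  define C where "C = pi * sech_sum \<omega> k + pi * K / sqrt (pi * \<omega>)"
  have C1: "pi * sech_sum \<omega> k \<ge> 0" "pi * K / sqrt (pi * \<omega>) \<ge> 0"
    using sech_sum_pos[OF \<omega>, of k] K(1) \<omega> by auto
  have diag: "(\<lambda>n. cmod (Hk T p k n (n - l))) summable_on UNIV \<and>
      (\<Sum>\<^sub>\<infinity>n. cmod (Hk T p k n (n - l))) \<le> C * (cmod (fourier_coeff T p l) * (1 + (real_of_int l)\<^sup>2) powr (1/4))" for l
  proof (cases "l = 0")
    case True
    have "((\<lambda>n. cmod (Hk T p k n n)) has_sum cmod (fourier_coeff T p 0) * pi * sech_sum \<omega> k) UNIV"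
      unfolding norm_Hk_diag using has_sum_cmult_right[OF has_sum_sech_lat[OF \<omega>, of k]] by (simp add: \<omega>_def)
    then have "(\<lambda>n. cmod (Hk T p k n n)) summable_on UNIV"
      "(\<Sum>\<^sub>\<infinity>n. cmod (Hk T p k n n)) = cmod (fourier_coeff T p 0) * (pi * sech_sum \<omega> k)"
      by (auto simp: has_sum_iff mult.assoc)
    moreover have "cmod (fourier_coeff T p 0) * (pi * sech_sum \<omega> k) \<le> cmod (fourier_coeff T p 0) * C"
      using C1 by (intro mult_left_mono) (auto simp: C_def)
    ultimately show ?thesis using True by (simp add: mult.commute)
  next
    case False
    define D where "D = cmod (fourier_coeff T p l) * (pi / sqrt (pi * \<omega> * \<bar>of_int l\<bar>))"
    have D0: "D \<ge> 0" using \<omega> by (simp add: D_def)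
    have eq: "(\<lambda>n. cmod (Hk T p k n (n - l))) = (\<lambda>n. D * sqrt \<bar>t n - t (n - l)\<bar>)"
      using norm_Hk_offdiag[of T l p k] \<omega> False by (auto simp: D_def t_def \<omega>_def)
    have "(\<lambda>n. cmod (Hk T p k n (n - l))) summable_on UNIV"
      unfolding eq by (intro summable_on_cmult_right K)
    moreover have "(\<Sum>\<^sub>\<infinity>n. cmod (Hk T p k n (n - l))) = D * (\<Sum>\<^sub>\<infinity>n. sqrt \<bar>t n - t (n - l)\<bar>)"
      unfolding eq by (rule infsum_cmult_right')
    moreover have "D * (\<Sum>\<^sub>\<infinity>n. sqrt \<bar>t n - t (n - l)\<bar>) \<le> D * (\<bar>of_int l\<bar> * K)"
      by (intro mult_left_mono K D0)
    moreover have "D * (\<bar>of_int l\<bar> * K) = cmod (fourier_coeff T p l) * (pi * K / sqrt (pi * \<omega>) * sqrt \<bar>of_int l\<bar>)"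
    proof -
      have "\<bar>real_of_int l\<bar> = sqrt \<bar>of_int l\<bar> * sqrt \<bar>of_int l\<bar>" by simp
      then show ?thesis unfolding D_def using False \<omega>
        by (simp add: real_sqrt_mult field_simps)
    qed
    moreover have "\<dots> \<le> C * (cmod (fourier_coeff T p l) * (1 + (real_of_int l)\<^sup>2) powr (1/4))"
    proof -
      have "sqrt \<bar>real_of_int l\<bar> = ((real_of_int l)\<^sup>2) powr (1/4)"
      proof -
        have "((real_of_int l)\<^sup>2) powr (1/4) = (\<bar>real_of_int l\<bar> powr 2) powr (1/4)"
          using False by simp
        also have "\<dots> = \<bar>real_of_int l\<bar> powr (1/2)" unfolding powr_powr by simp
        finally show ?thesis by (simp add: powr_half_sqrt)
      qed
      also have "\<dots> \<le> (1 + (real_of_int l)\<^sup>2) powr (1/4)" by (intro powr_mono2) auto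
      finally have 1: "sqrt \<bar>real_of_int l\<bar> \<le> (1 + (real_of_int l)\<^sup>2) powr (1/4)" .
      have "pi * K / sqrt (pi * \<omega>) * sqrt \<bar>of_int l\<bar> \<le> C * (1 + (real_of_int l)\<^sup>2) powr (1/4)"
        using C1 1 by (intro mult_mono) (auto simp: C_def)
      then have "cmod (fourier_coeff T p l) * (pi * K / sqrt (pi * \<omega>) * sqrt \<bar>of_int l\<bar>)
          \<le> cmod (fourier_coeff T p l) * (C * (1 + (real_of_int l)\<^sup>2) powr (1/4))"
        by (intro mult_left_mono) auto
      then show ?thesis by (simp add: mult_ac)
    qed
    ultimately show ?thesis by linarith
  qed
  have "(\<lambda>x. cmod (case x of (l, n) \<Rightarrow> Hk T p k n (n - l))) summable_on Sigma UNIV (\<lambda>_. UNIV)"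
    unfolding Infinite_Sum.abs_summable_on_Sigma_iff
  proof (intro conjI ballI)
    show "(\<lambda>n. cmod (case (l, n) of (l, n) \<Rightarrow> Hk T p k n (n - l))) summable_on UNIV" for l
      using diag[of l] by simp
    have "(\<lambda>l. C * (cmod (fourier_coeff T p l) * (1 + (real_of_int l)\<^sup>2) powr (1/4))) summable_on UNIV"
      using pf by (rule summable_on_cmult_right)
    then have "(\<lambda>l. \<Sum>\<^sub>\<infinity>n. cmod (Hk T p k n (n - l))) summable_on UNIV"
      by (rule summable_on_comparison_test) (use diag in \<open>auto intro: infsum_nonneg\<close>)
    then show "(\<lambda>l. norm (\<Sum>\<^sub>\<infinity>n. cmod (case (l, n) of (l, n) \<Rightarrow> Hk T p k n (n - l)))) summable_on UNIV"
      by (simp add: infsum_nonneg)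
  qed
  then have "(\<lambda>x. cmod (case (\<lambda>(l, n). (n, n - l)) x of (n, m) \<Rightarrow> Hk T p k n m)) summable_on (UNIV :: (int \<times> int) set)"
    by (simp add: case_prod_unfold)
  moreover have "bij_betw (\<lambda>(l, n). (n, n - l)) (UNIV :: (int \<times> int) set) UNIV"
    by (rule bij_betw_byWitness[where f' = "\<lambda>(n, m). (n - m, n)"]) auto
  ultimately show ?thesis
    using summable_on_reindex_bij_betw[of "\<lambda>(l, n). (n, n - l)" UNIV UNIV "\<lambda>x. cmod (case x of (n, m) \<Rightarrow> Hk T p k n m)"] by blast
qed

section \<open>The determinant of H(k) and the bands\<close>

lemma Hk_row_bound:
  assumes "smooth_periodic_symbol T p"
  obtains r where "r summable_on UNIV" "\<And>i U. finite U \<Longrightarrow> (\<Sum>j\<in>U. cmod (Hk T p k i j)) \<le> r i"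
proof -
  have "(\<lambda>x. cmod (case x of (n, m) \<Rightarrow> Hk T p k n m)) summable_on Sigma UNIV (\<lambda>_. UNIV)"
    using Hk_abs_summable[OF assms, of k] by simp
  then have 1: "\<And>n. (\<lambda>m. cmod (Hk T p k n m)) summable_on UNIV"
    and 2: "(\<lambda>n. norm (\<Sum>\<^sub>\<infinity>m. cmod (Hk T p k n m))) summable_on UNIV"
    unfolding Infinite_Sum.abs_summable_on_Sigma_iff by auto
  show ?thesis
  proof (rule that)
    show "(\<lambda>n. \<Sum>\<^sub>\<infinity>m. cmod (Hk T p k n m)) summable_on UNIV" using 2 by (rule abs_summable_summable)
    show "(\<Sum>j\<in>U. cmod (Hk T p k i j)) \<le> (\<Sum>\<^sub>\<infinity>m. cmod (Hk T p k i m))" if "finite U" for i U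
      by (rule finite_sum_le_infsum[OF 1 that]) auto
  qed
qed

text \<open>The part of a principal minor of H(k) that is free of \<open>k\<close>. Taking
  \<open>Re\<close> loses nothing as the symbol matrix is Hermitian, and the powers of pi complete
  \<open>sech_lat\<close> to the squared moduli of the diagonal factors.\<close>

definition Hk_coeff :: "real \<Rightarrow> (real \<Rightarrow> real) \<Rightarrow> int set \<Rightarrow> real" where
  "Hk_coeff T p S = Re (principal_minor (toeplitz_symbol T p) S) * pi ^ card S"

lemma Hk_coeff_summable:
  assumes "smooth_periodic_symbol T p"
  shows "(\<lambda>S. norm (Hk_coeff T p S * (\<Prod>n\<in>S. sech_lat (freq T) k n) * z ^ card S)) summable_on Collect finite"
proof -
  obtain r where r: "r summable_on UNIV" "\<And>i U. finite U \<Longrightarrow> (\<Sum>j\<in>U. cmod (Hk T p k i j)) \<le> r i"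
    using Hk_row_bound[OF assms, of k] by blast
  have "(\<lambda>S. norm (principal_minor (Hk T p k) S * of_real z ^ card S)) summable_on Collect finite"
    by (rule summable_on_norm_minor_power[OF r])
  then show ?thesis
    by (rule iffD1[OF summable_on_cong, rotated])
       (simp add: principal_minor_Hk Hk_coeff_def norm_mult norm_power abs_mult power_abs del: of_real_mult of_real_prod)
qed

lemma fredholm_det_Hk:
  assumes "smooth_periodic_symbol T p"
  shows "fredholm_det (\<lambda>n m. of_real z * Hk T p k n m) = of_real (lattice_det (Hk_coeff T p) (freq T) k (- z))"
proof -
  have "((\<lambda>S. Hk_coeff T p S * (\<Prod>n\<in>S. sech_lat (freq T) k n) * (- z) ^ card S) has_sum
      lattice_det (Hk_coeff T p) (freq T) k (- z)) (Collect finite)"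
    unfolding lattice_det_def
    by (rule has_sum_infsum, rule abs_summable_summable, rule Hk_coeff_summable[OF assms])
  then have "((\<lambda>S. complex_of_real (Hk_coeff T p S * (\<Prod>n\<in>S. sech_lat (freq T) k n) * (- z) ^ card S)) has_sum
      of_real (lattice_det (Hk_coeff T p) (freq T) k (- z))) (Collect finite)"
    by (rule has_sum_of_real)
  moreover have eq: "(-1) ^ card S * principal_minor (\<lambda>n m. of_real z * Hk T p k n m) S
      = complex_of_real (Hk_coeff T p S * (\<Prod>n\<in>S. sech_lat (freq T) k n) * (- z) ^ card S)" if "finite S" for S
    using that by (simp add: principal_minor_cmult principal_minor_Hk Hk_coeff_def power_minus[of z] mult_ac)
  ultimately have "((\<lambda>S. (-1) ^ card S * principal_minor (\<lambda>n m. of_real z * Hk T p k n m) S) has_sum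
      of_real (lattice_det (Hk_coeff T p) (freq T) k (- z))) (Collect finite)"
    by (subst has_sum_cong[OF eq]) simp_all
  then show ?thesis
    unfolding fredholm_det_def by (rule infsumI)
qed

text \<open>Fixed vectors of z H(k) are eigenvectors of H(k) for 1/z. The multiplicity condition
  translates the existence of one into a non-empty set of indices.\<close>

lemma fixed_vector_iff_band:
  assumes symb: "smooth_periodic_symbol T p" and bands: "band_functions T p J E" and z: "z \<noteq> 0"
  shows "fredholm_det (\<lambda>n m. of_real z * Hk T p k n m) = 0 \<longleftrightarrow> (\<exists>i\<in>J. E i k = 1 / z)"
proof -
  define lam :: complex where "lam = of_real (1 / z)"
  have lam: "lam \<noteq> 0" using z by (simp add: lam_def)
  define I where "I = {i\<in>J. complex_of_real (E i k) = lam}"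
  have fin: "finite I" and mult: "eig_mult (Hk T p k) lam (card I)"
    using bands lam unfolding band_functions_def I_def by blast+
  have I: "(\<exists>i\<in>J. E i k = 1 / z) \<longleftrightarrow> I \<noteq> {}" unfolding I_def lam_def of_real_eq_iff by blast
  obtain r where r: "r summable_on UNIV" and row: "\<And>i U. finite U \<Longrightarrow> (\<Sum>j\<in>U. cmod (Hk T p k i j)) \<le> r i"
    using Hk_row_bound[OF symb, of k] by blast
  define r' where "r' = (\<lambda>i. \<bar>z\<bar> * r i)"
  have r': "r' summable_on UNIV" unfolding r'_def using r by (rule summable_on_cmult_right)
  have row': "(\<Sum>j\<in>U. cmod (of_real z * Hk T p k i j)) \<le> r' i" if "finite U" for i U
    using row[OF that, of i] by (simp add: r'_def norm_mult mult_left_mono flip: sum_distrib_left)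
  show ?thesis unfolding I
  proof
    assume det0: "fredholm_det (\<lambda>n m. of_real z * Hk T p k n m) = 0"
    have "\<exists>x i0 C. x i0 \<noteq> 0 \<and> (\<forall>i. cmod (x i) \<le> C * r' i) \<and>
        (\<forall>i. ((\<lambda>j. of_real z * Hk T p k i j * x j) has_sum x i) UNIV)"
      by (rule fixed_vector_if_fredholm_det_eq_0[OF r' row' det0]) blast+
    then obtain x i0 C where x: "x i0 \<noteq> 0" "\<And>i. cmod (x i) \<le> C * r' i"
      "\<And>i. ((\<lambda>j. of_real z * Hk T p k i j * x j) has_sum x i) UNIV" by blast
    have C0: "C * r' i \<ge> 0" for i using order_trans[OF norm_ge_zero x(2)] .
    define B where "B = infsum (\<lambda>i. C * r' i) UNIV"
    have Cr: "(\<lambda>i. C * r' i) summable_on UNIV" using r' by (rule summable_on_cmult_right)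
    have B: "C * r' i \<le> B" for i
      unfolding B_def using finite_sum_le_infsum[OF Cr, of "{i}"] C0 by simp
    \<comment> \<open>The fixed vector comes with a summable majorant, which is also bounded, hence
      square summable.\<close>
    have "ell2 x"
      unfolding ell2_def
    proof (rule summable_on_comparison_test)
      show "(\<lambda>i. B * (C * r' i)) summable_on UNIV" using Cr by (rule summable_on_cmult_right)
      show "(cmod (x i))\<^sup>2 \<le> B * (C * r' i)" for i
        unfolding power2_eq_square using x(2)[of i] B[of i] C0[of i] by (intro mult_mono) auto
    qed auto
    moreover have "((\<lambda>m. Hk T p k n m * x m) has_sum (lam * x n)) UNIV" for n
      using has_sum_cmult_right[OF x(3)[of n], of lam] z by (simp add: lam_def mult.assoc[symmetric])
    ultimately have "{x} \<subseteq> eigenspace_l2 (Hk T p k) lam" by (simp add: eigenspace_l2_def)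
    moreover have "lin_indep_c {x}" using x(1) by (auto simp: lin_indep_c_def)
    ultimately have "card {x} \<le> card I" using mult unfolding eig_mult_def by blast
    then show "I \<noteq> {}" using fin by auto
  next
    assume "I \<noteq> {}"
    then have "card I > 0" using fin by (simp add: card_gt_0_iff)
    then obtain S where S: "S \<subseteq> eigenspace_l2 (Hk T p k) lam" "lin_indep_c S" "card S > 0"
      using mult unfolding eig_mult_def by metis
    then obtain x where x: "x \<in> S" by fastforce
    have "\<exists>i0. x i0 \<noteq> 0"
    proof (rule ccontr)
      assume "\<not> ?thesis"
      then have 0: "\<forall>n. (\<Sum>v\<in>S. (\<lambda>v. if v = x then 1 else 0) v * v n) = 0"
        by (intro allI sum.neutral) auto
      have "\<forall>c. (\<forall>n. (\<Sum>v\<in>S. c v * v n) = 0) \<longrightarrow> (\<forall>v\<in>S. c v = 0)"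
        using S(2) unfolding lin_indep_c_def by (rule conjunct2)
      from mp[OF spec[OF this] 0] x show False by auto
    qed
    then obtain i0 where i0: "x i0 \<noteq> 0" by blast
    have l2: "(\<lambda>n. (cmod (x n))\<^sup>2) summable_on UNIV" and eig: "\<And>n. ((\<lambda>m. Hk T p k n m * x m) has_sum (lam * x n)) UNIV"
      using S(1) x by (auto simp: eigenspace_l2_def ell2_def)
    have bd: "cmod (x n) \<le> sqrt (infsum (\<lambda>n. (cmod (x n))\<^sup>2) UNIV)" for n
      using finite_sum_le_infsum[OF l2, of "{n}"] by (intro real_le_rsqrt) auto
    show "fredholm_det (\<lambda>n m. of_real z * Hk T p k n m) = 0"
    proof (rule fredholm_det_eq_0_if_fixed_vector[where x = x, OF r' row' bd i0])
      show "((\<lambda>j. of_real z * Hk T p k i j * x j) has_sum x i) UNIV" for i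
        using has_sum_cmult_right[OF eig[of i], of "of_real z"] z by (simp add: lam_def mult.assoc[symmetric])
    qed
  qed
qed

theorem theorem7p1:
  fixes T :: real and p :: "real \<Rightarrow> real"
    and J :: "nat set" and E :: "nat \<Rightarrow> real \<Rightarrow> real"
    and N :: enat and e :: "nat \<Rightarrow> nat"
  assumes symb: "smooth_periodic_symbol T p"
    and bands: "band_functions T p J E"
    and enum: "bij_betw e {n. enat n < N} {i\<in>J. \<not> flat (E i)}"
    and order: "\<And>n k. enat (Suc n) < N \<Longrightarrow> k \<in> {0<..<freq T / 2} \<Longrightarrow>
                  \<bar>E (e n) k\<bar> > \<bar>E (e (Suc n)) k\<bar>"
  shows "\<forall>n. enat n < N \<longrightarrow> (\<forall>k\<in>{0<..<freq T / 2}.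
           \<exists>d. ((\<lambda>x. \<bar>E (e n) x\<bar>) has_real_derivative d) (at k) \<and> (-1) ^ (n + 1) * d > 0)"
proof -
  define \<omega> where "\<omega> = freq T"
  have \<omega>: "\<omega> > 0" using symb by (simp add: \<omega>_def freq_def smooth_periodic_symbol_def)
  define f where "f = Hk_coeff T p"
  define d where "d = lattice_det f \<omega>"
  define F where "F = sech_sum \<omega>"
  have inv: "f ((\<lambda>n. n + j) ` S) = f S" if "finite S" for S j
    using principal_minor_toeplitz_shift[OF that, of T p j] by (simp add: f_def Hk_coeff_def card_image)
  have sm: "(\<lambda>S. norm (f S * (\<Prod>n\<in>S. sech_lat \<omega> k n) * z ^ card S)) summable_on Collect finite" for k z
    unfolding f_def \<omega>_def by (rule Hk_coeff_summable[OF symb])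
  have Fpos: "F k > 0" for k unfolding F_def by (rule sech_sum_pos[OF \<omega>])
  \<comment> \<open>Half the sum and, divided by F, half the difference of the determinants at z and
    -z, taken at the reference point k = 0.\<close>
  define \<beta> where "\<beta> = (\<lambda>z. 1/2 * d 0 z + 1/2 * d 0 (- z))"
  define \<alpha> where "\<alpha> = (\<lambda>z. 1 / (2 * F 0) * d 0 z + - 1 / (2 * F 0) * d 0 (- z))"
  have d_pm: "d k z = \<beta> z + \<alpha> z * F k" "d k (- z) = \<beta> z - \<alpha> z * F k" for k z
  proof -
    have "d k z + d k (- z) = 2 * \<beta> z"
      unfolding d_def \<beta>_def using lattice_det_even[OF \<omega> inv sm, of k z 0] by simp
    moreover have "(d k z - d k (- z)) * F 0 = (d 0 z - d 0 (- z)) * F k"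
      unfolding d_def F_def by (rule lattice_det_odd[OF \<omega> inv sm])
    then have "d k z - d k (- z) = 2 * (\<alpha> z * F k)"
      using Fpos[of 0] by (simp add: \<alpha>_def field_simps)
    ultimately show "d k z = \<beta> z + \<alpha> z * F k" "d k (- z) = \<beta> z - \<alpha> z * F k" by linarith+
  qed
  have ent_d: "entire_real (d k)" for k
    unfolding entire_real_def d_def by (intro exI allI, rule lattice_det_sums[OF \<omega> inv sm])
  have ent: "entire_real \<alpha>" "entire_real \<beta>"
    unfolding \<alpha>_def \<beta>_def by (intro entire_real_add entire_real_cmult entire_real_minus_arg ent_d)+
  have d0: "d k 0 = 1" for k
  proof -
    have "d k 0 = (\<Sum>\<^sub>\<infinity>S\<in>{{}}. f S * (\<Prod>n\<in>S. sech_lat \<omega> k n) * 0 ^ card S)"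
      unfolding d_def lattice_det_def by (rule infsum_cong_neutral) auto
    then show ?thesis by (simp add: f_def Hk_coeff_def principal_minor_def)
  qed
  have at0: "\<alpha> 0 = 0" "\<beta> 0 = 1" by (simp_all add: \<alpha>_def \<beta>_def d0)
  have prod: "(\<beta> z)\<^sup>2 - (\<alpha> z)\<^sup>2 * (F k)\<^sup>2 = d k z * d k (- z)" for k z
    by (simp only: d_pm(1)[of k z] d_pm(2)[of k z]) (simp add: power2_eq_square algebra_simps)
  \<comment> \<open>\<open>d k z\<close> is det(1 + z H(k)), hence the minus sign.\<close>
  have zero_iff: "d k z = 0 \<longleftrightarrow> (\<exists>i\<in>J. E i k = - 1 / z)" if "z \<noteq> 0" for k z
    using fixed_vector_iff_band[OF symb bands, of "- z" k] fredholm_det_Hk[OF symb, of "- z" k] that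
    by (simp add: d_def f_def \<omega>_def)
  have zeros: "(\<beta> z)\<^sup>2 = (\<alpha> z)\<^sup>2 * (F k)\<^sup>2 \<longleftrightarrow> (\<exists>i\<in>J. \<bar>E i k\<bar> = 1 / z)" if "z > 0" for k z
  proof -
    have "(\<beta> z)\<^sup>2 = (\<alpha> z)\<^sup>2 * (F k)\<^sup>2 \<longleftrightarrow> d k z = 0 \<or> d k (- z) = 0"
      using prod[of z k] by auto
    also have "\<dots> \<longleftrightarrow> (\<exists>i\<in>J. E i k = - 1 / z) \<or> (\<exists>i\<in>J. E i k = 1 / z)"
      using zero_iff[of z k] zero_iff[of "- z" k] that by simp
    also have "\<dots> \<longleftrightarrow> (\<exists>i\<in>J. \<bar>E i k\<bar> = 1 / z)"
    proof -
      have "\<bar>x\<bar> = 1 / z \<longleftrightarrow> x = - 1 / z \<or> x = 1 / z" for x :: real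
      proof -
        have "1 / z > 0" "- 1 / z = - (1 / z)" using that by auto
        then show ?thesis by linarith
      qed
      then show ?thesis by auto
    qed
    finally show ?thesis .
  qed
  have "\<forall>k. \<exists>D. (F has_real_derivative D) (at k)"
    unfolding F_def using sech_sum_has_derivative[OF \<omega>] by blast
  then obtain F' where F': "\<And>k. (F has_real_derivative F' k) (at k)" by metis
  have ana: "real_analytic (E i)" and nz: "E i k \<noteq> 0" if "i \<in> J" for i k
    using bands that by (auto simp: band_functions_def)
  interpret alternating_bands \<alpha> \<beta> F F' "\<omega> / 2" J E N e
  proof
    show "continuous_on UNIV \<alpha>" "continuous_on UNIV \<beta>"
      using entire_real_isCont ent by (auto intro!: continuous_at_imp_continuous_on)
    show "\<alpha> 0 = 0" "\<beta> 0 = 1" by (fact at0)+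
    show "\<exists>m a b a' b' r. r > 0 \<and> (a z\<^sub>1 \<noteq> 0 \<or> b z\<^sub>1 \<noteq> 0) \<and>
      (\<forall>z. \<bar>z - z\<^sub>1\<bar> < r \<longrightarrow> \<alpha> z = (z - z\<^sub>1) ^ m * a z \<and> \<beta> z = (z - z\<^sub>1) ^ m * b z \<and>
        (a has_real_derivative a' z) (at z) \<and> (b has_real_derivative b' z) (at z))" for z\<^sub>1
      by (rule entire_real_common_factor[OF ent, of 0]) (simp add: at0)
    show "\<exists>r>0. \<forall>z. 0 < \<bar>z - z\<^sub>1\<bar> \<and> \<bar>z - z\<^sub>1\<bar> < r \<longrightarrow> (\<beta> z)\<^sup>2 \<noteq> (\<alpha> z)\<^sup>2 * (F k)\<^sup>2" for k z\<^sub>1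
    proof -
      \<comment> \<open>The zeros of \<open>d k z\<close> and \<open>d k (- z)\<close> are isolated
        separately; the value 1 at 0 shows that neither function is identically zero.\<close>
      obtain r s where r: "r > 0" "\<And>z. 0 < \<bar>z - z\<^sub>1\<bar> \<Longrightarrow> \<bar>z - z\<^sub>1\<bar> < r \<Longrightarrow> d k z \<noteq> 0"
        and s: "s > 0" "\<And>z. 0 < \<bar>z - z\<^sub>1\<bar> \<Longrightarrow> \<bar>z - z\<^sub>1\<bar> < s \<Longrightarrow> d k (- z) \<noteq> 0"
        using entire_real_isolated_zeros[OF ent_d[of k], of 0 z\<^sub>1]
          entire_real_isolated_zeros[OF entire_real_minus_arg[OF ent_d[of k]], of 0 z\<^sub>1] d0 by auto
      show ?thesis
      proof (intro exI[of _ "min r s"] conjI allI impI)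
        fix z assume "0 < \<bar>z - z\<^sub>1\<bar> \<and> \<bar>z - z\<^sub>1\<bar> < min r s"
        then have "d k z * d k (- z) \<noteq> 0" using r(2)[of z] s(2)[of z] by simp
        then show "(\<beta> z)\<^sup>2 \<noteq> (\<alpha> z)\<^sup>2 * (F k)\<^sup>2" using prod[of z k] by auto
      qed (use r(1) s(1) in simp)
    qed
    show "F k > 0" for k by (rule Fpos)
    show "(F has_real_derivative F' k) (at k)" for k by (rule F')
    show "F' k < 0" if "0 < k" "k < \<omega> / 2" for k
      using sech_sum_deriv_neg[OF \<omega> that] F'[of k] by (simp add: F_def)
    show "(\<beta> z)\<^sup>2 = (\<alpha> z)\<^sup>2 * (F k)\<^sup>2 \<longleftrightarrow> (\<exists>i\<in>J. \<bar>E i k\<bar> = 1 / z)" if "z > 0" for k z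
      by (rule zeros[OF that])
    show "\<exists>d. (E i has_real_derivative d) (at k)" if "i \<in> J" for i k
      by (rule real_analytic_deriv[OF ana[OF that]])
    show "E i k \<noteq> 0" if "i \<in> J" for i k by (rule nz[OF that])
    show "eventually (\<lambda>k'. \<bar>E i k'\<bar> \<noteq> \<bar>E i k\<bar>) (at k)" if "i \<in> J" "\<not> (\<exists>c. \<forall>k. E i k = c)" for i k
      by (rule real_analytic_abs_isolated[OF ana[OF that(1)] that(2) nz[OF that(1)]])
    show "bij_betw e {n. enat n < N} {i\<in>J. \<not> (\<exists>c. \<forall>k. E i k = c)}"
      using enum by (simp add: flat_def)
    show "\<bar>E (e n) k\<bar> > \<bar>E (e (Suc n)) k\<bar>" if "enat (Suc n) < N" "0 < k" "k < \<omega> / 2" for n k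
      using order[OF that(1), of k] that by (simp add: \<omega>_def)
  qed
  show ?thesis
    using alternating by (auto simp: \<omega>_def)
qed

end
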